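(* Let $\Gamma$ be a connected finite planar acyclic quiver and let the ground field $\mathbf{k}$ be of characteristic $0$. Then the disjoint union $$\{D_{p,r}\mid(p,r)\in\Gamma_{AL}\}\cup\{D_{\mathfrak{c}}\mid\mathfrak{c}\text{ is a bounded primitive cycle of }\Gamma\}$$ forms (via cosets modulo inner derivations) a basis of $HH^1(\mathbf{k}\Gamma)$.
   Context: A quiver $\Gamma=(V,E,t,h)$ consists of a set $V$ of vertices, a set $E$ of arrows and maps $t,h:E\to V$ (tail and head). It is acyclic if it has no oriented cycles, and connected if its underlying graph is connected. A path of length $\ell\ge0$ is $p=v_0p_1v_1\cdots p_\ell v_\ell$ with $p_j\in E$, $t(p_j)=v_{j-1}$, $h(p_j)=v_j$; $t(p)=v_0$, $h(p)=v_\ell$; vertices are the paths of length $0$; $\mathcal{P}$ is the set of paths. The path algebra $\mathbf{k}\Gamma$ has basis $\mathcal{P}$, with product of $p,q$ the concatenation $pq$ if $h(p)=t(q)$ and $0$ otherwise. $p\parallel q$ means $t(p)=t(q)$ and $h(p)=h(q)$. $HH^1(\mathbf{k}\Gamma)=\mathrm{Der}(\mathbf{k}\Gamma)/\mathrm{InDer}(\mathbf{k}\Gamma)$, derivations modulo inner derivations $D_a(b)=ab-ba$. For $r\in E$, $s\in\mathcal{P}$, $s\parallel r$, $D_{r,s}$ is the derivation of $\mathbf{k}\Gamma$ with $D_{r,s}(v)=0$ for $v\in V$, $D_{r,s}(r)=s$ and $D_{r,s}(q)=0$ for $q\in E$, $q\ne r$. $\Gamma_{AL}$ is the set of almost oriented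 cycles: pairs $(p,r)$ with $p\in E$, $r\in\mathcal{P}$, $r\neq p$, $r\parallel p$. A planar quiver comes with a fixed embedding of its underlying graph in the plane. Its faces are the connected components of the complement of $\Gamma$ in the plane; exactly one is unbounded. The boundary $\mathfrak{c}=\mathfrak{c}_f$ of a face $f$ is called a primitive cycle, and it is called bounded if $f$ is a bounded face. The face derivation $D_{\mathfrak{c}}$ is the derivation of $\mathbf{k}\Gamma$ with $D_{\mathfrak{c}}(v)=0$ for $v\in V$ and, for $p\in E$, $D_{\mathfrak{c}}(p)=p$ if $p$ is clockwise on $\mathfrak{c}$, $-p$ if $p$ is counterclockwise on $\mathfrak{c}$, and $0$ if $p$ is not on $\mathfrak{c}$; clockwise is as viewed from inside $f$ (i.e. $f$ lies on the right of $p$). If both sides of $p$ lie in $f$, then $p$ occurs once in each direction, the contributions cancel, and $D_{\mathfrak{c}}(p)=0$. *)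

theory Defs
  imports
    "HOL-Complex_Analysis.Complex_Analysis"
    "HOL-Library.Poly_Mapping"
    "HOL-Algebra.AbelCoset"
    "Graph_Theory.Digraph_Component"
    "Jordan_Normal_Form.VS_Connect"
begin

section \<open>Derivations and the first Hochschild cohomology\<close>

text \<open>
  A (not necessarily commutative) algebra is given by a \<^typ>\<open>('k, 'a) module\<close> record, whose
  ring part carries the product. Derivations are maps on the carrier, made unique as HOL functions
  by extensionality.
\<close>

definition derivations :: "('k, 'm) ring_scheme \<Rightarrow> ('k, 'a, 'n) module_scheme \<Rightarrow> ('a \<Rightarrow> 'a) set" where
  "derivations K A = {D \<in> LinearCombinations.module_hom K A A \<inter> extensional (carrier A).
     \<forall>a\<in>carrier A. \<forall>b\<in>carrier A. D (a \<otimes>\<^bsub>A\<^esub> b) = D a \<otimes>\<^bsub>A\<^esub> b \<oplus>\<^bsub>A\<^esub> a \<otimes>\<^bsub>A\<^esub> D b}"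

(* The fields mult and one of the records below play no role. *)
definition Der :: "('k, 'm) ring_scheme \<Rightarrow> ('k, 'a, 'n) module_scheme \<Rightarrow> ('k, 'a \<Rightarrow> 'a) module" where
  "Der K A =
    \<lparr>carrier = derivations K A,
     mult = (\<lambda>_ _. undefined),
     one = undefined,
     zero = (\<lambda>a\<in>carrier A. \<zero>\<^bsub>A\<^esub>),
     add = (\<lambda>D D'. \<lambda>a\<in>carrier A. D a \<oplus>\<^bsub>A\<^esub> D' a),
     smult = (\<lambda>c D. \<lambda>a\<in>carrier A. c \<odot>\<^bsub>A\<^esub> D a)\<rparr>"

definition InDer :: "('k, 'a, 'n) module_scheme \<Rightarrow> ('a \<Rightarrow> 'a) set" where
  "InDer A = (\<lambda>a. \<lambda>b\<in>carrier A. a \<otimes>\<^bsub>A\<^esub> b \<ominus>\<^bsub>A\<^esub> b \<otimes>\<^bsub>A\<^esub> a) ` carrier A"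

definition quotient_module :: "('k, 'a, 'n) module_scheme \<Rightarrow> 'a set \<Rightarrow> ('k, 'a set) module" where
  "quotient_module M N =
    \<lparr>carrier = a_rcosets\<^bsub>M\<^esub> N,
     mult = (\<lambda>_ _. undefined),
     one = undefined,
     zero = N,
     add = (\<lambda>X Y. X <+>\<^bsub>M\<^esub> Y),
     smult = (\<lambda>c X. \<Union>x\<in>X. N +>\<^bsub>M\<^esub> (c \<odot>\<^bsub>M\<^esub> x))\<rparr>"

definition HH1 :: "('k, 'm) ring_scheme \<Rightarrow> ('k, 'a, 'n) module_scheme \<Rightarrow> ('k, ('a \<Rightarrow> 'a) set) module" where
  "HH1 K A = quotient_module (Der K A) (InDer A)"

definition HH1_class ::
    "('k, 'm) ring_scheme \<Rightarrow> ('k, 'a, 'n) module_scheme \<Rightarrow> ('a \<Rightarrow> 'a) \<Rightarrow> ('a \<Rightarrow> 'a) set" where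
  "HH1_class K A D = InDer A +>\<^bsub>Der K A\<^esub> D"

definition basis_family ::
    "('k, 'm) ring_scheme \<Rightarrow> ('k, 'a, 'n) module_scheme \<Rightarrow> 'i set \<Rightarrow> ('i \<Rightarrow> 'a) \<Rightarrow> bool" where
  "basis_family K V I b \<longleftrightarrow> vectorspace K V \<and> inj_on b I \<and> vectorspace.basis K V (b ` I)"


section \<open>Quivers and their path algebras\<close>

text \<open>
  A quiver is a \<^typ>\<open>('v, 'e) pre_digraph\<close>; a path is its starting vertex together with its list
  of arrows, the vertex \<open>v\<close> being the path \<open>(v, [])\<close>.
\<close>

type_synonym ('v, 'e) qpath = "'v \<times> 'e list"

definition qpaths :: "('v, 'e) pre_digraph \<Rightarrow> ('v, 'e) qpath set" where
  "qpaths \<Gamma> = {(u, es). \<exists>v. pre_digraph.awalk \<Gamma> u es v}"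

definition qpath_tail :: "('v, 'e) qpath \<Rightarrow> 'v" where
  "qpath_tail p = fst p"

definition qpath_head :: "('v, 'e) pre_digraph \<Rightarrow> ('v, 'e) qpath \<Rightarrow> 'v" where
  "qpath_head \<Gamma> p = pre_digraph.awlast \<Gamma> (fst p) (snd p)"

definition parallel :: "('v, 'e) pre_digraph \<Rightarrow> ('v, 'e) qpath \<Rightarrow> ('v, 'e) qpath \<Rightarrow> bool" where
  "parallel \<Gamma> p q \<longleftrightarrow> qpath_tail p = qpath_tail q \<and> qpath_head \<Gamma> p = qpath_head \<Gamma> q"

definition arrow :: "('v, 'e) pre_digraph \<Rightarrow> 'e \<Rightarrow> ('v, 'e) qpath" where
  "arrow \<Gamma> e = (tail \<Gamma> e, [e])"

definition acyclic_quiver :: "('v, 'e) pre_digraph \<Rightarrow> bool" where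
  "acyclic_quiver \<Gamma> \<longleftrightarrow> (\<nexists>es. pre_digraph.cycle \<Gamma> es)"

definition path_mult :: "('v, 'e) pre_digraph \<Rightarrow> (('v, 'e) qpath \<Rightarrow>\<^sub>0 'k::field) \<Rightarrow>
    (('v, 'e) qpath \<Rightarrow>\<^sub>0 'k) \<Rightarrow> (('v, 'e) qpath \<Rightarrow>\<^sub>0 'k)" where
  "path_mult \<Gamma> a b =
    (\<Sum>p\<in>Poly_Mapping.keys a. \<Sum>q\<in>Poly_Mapping.keys b.
       if qpath_head \<Gamma> p = qpath_tail q
       then Poly_Mapping.single (fst p, snd p @ snd q) (Poly_Mapping.lookup a p * Poly_Mapping.lookup b q) else 0)"

definition path_algebra :: "('v, 'e) pre_digraph \<Rightarrow> ('k::field, ('v, 'e) qpath \<Rightarrow>\<^sub>0 'k) module" where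
  "path_algebra \<Gamma> =
    \<lparr>carrier = {a. Poly_Mapping.keys a \<subseteq> qpaths \<Gamma>},
     mult = path_mult \<Gamma>,
     one = (\<Sum>v\<in>verts \<Gamma>. Poly_Mapping.single (v, []) 1),
     zero = 0,
     add = (+),
     smult = (\<lambda>c. Poly_Mapping.map ((*) c))\<rparr>"

text \<open>The derivation of \<open>k\<Gamma>\<close> that vanishes on vertices and takes prescribed values on arrows.\<close>

definition arrow_derivation :: "('v, 'e) pre_digraph \<Rightarrow> ('e \<Rightarrow> ('v, 'e) qpath \<Rightarrow>\<^sub>0 'k::field) \<Rightarrow>
    (('v, 'e) qpath \<Rightarrow>\<^sub>0 'k) \<Rightarrow> (('v, 'e) qpath \<Rightarrow>\<^sub>0 'k)" where
  "arrow_derivation \<Gamma> w = (THE D. D \<in> derivations class_ring (path_algebra \<Gamma>) \<and>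
     (\<forall>v\<in>verts \<Gamma>. D (Poly_Mapping.single (v, []) 1) = 0) \<and>
     (\<forall>e\<in>arcs \<Gamma>. D (Poly_Mapping.single (arrow \<Gamma> e) 1) = w e))"

definition path_derivation :: "('v, 'e) pre_digraph \<Rightarrow> 'e \<Rightarrow> ('v, 'e) qpath \<Rightarrow>
    (('v, 'e) qpath \<Rightarrow>\<^sub>0 'k::field) \<Rightarrow> (('v, 'e) qpath \<Rightarrow>\<^sub>0 'k)" where
  "path_derivation \<Gamma> r s =
    arrow_derivation \<Gamma> (\<lambda>q. if q = r then Poly_Mapping.single s 1 else 0)"

definition almost_oriented_cycles :: "('v, 'e) pre_digraph \<Rightarrow> ('e \<times> ('v, 'e) qpath) set" where
  "almost_oriented_cycles \<Gamma> =
    {(p, r). p \<in> arcs \<Gamma> \<and> r \<in> qpaths \<Gamma> \<and> r \<noteq> arrow \<Gamma> p \<and> parallel \<Gamma> r (arrow \<Gamma> p)}"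


section \<open>Plane embeddings and faces\<close>

definition plane_embedding ::
    "('v, 'e) pre_digraph \<Rightarrow> ('v \<Rightarrow> complex) \<Rightarrow> ('e \<Rightarrow> real \<Rightarrow> complex) \<Rightarrow> bool" where
  "plane_embedding \<Gamma> pos \<gamma> \<longleftrightarrow>
     inj_on pos (verts \<Gamma>) \<and>
     (\<forall>e\<in>arcs \<Gamma>. simple_path (\<gamma> e) \<and>
        pathstart (\<gamma> e) = pos (tail \<Gamma> e) \<and> pathfinish (\<gamma> e) = pos (head \<Gamma> e) \<and>
        \<gamma> e ` {0<..<1} \<inter> pos ` verts \<Gamma> = {}) \<and>
     (\<forall>e\<in>arcs \<Gamma>. \<forall>e'\<in>arcs \<Gamma>. e \<noteq> e' \<longrightarrow> \<gamma> e ` {0<..<1} \<inter> \<gamma> e' ` {0<..<1} = {})"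

definition drawing ::
    "('v, 'e) pre_digraph \<Rightarrow> ('v \<Rightarrow> complex) \<Rightarrow> ('e \<Rightarrow> real \<Rightarrow> complex) \<Rightarrow> complex set" where
  "drawing \<Gamma> pos \<gamma> = pos ` verts \<Gamma> \<union> (\<Union>e\<in>arcs \<Gamma>. path_image (\<gamma> e))"

definition bounded_faces ::
    "('v, 'e) pre_digraph \<Rightarrow> ('v \<Rightarrow> complex) \<Rightarrow> ('e \<Rightarrow> real \<Rightarrow> complex) \<Rightarrow> complex set set" where
  "bounded_faces \<Gamma> pos \<gamma> = {f \<in> components (- drawing \<Gamma> pos \<gamma>). bounded f}"

text \<open>
  The region \<open>f\<close>, disjoint from the arc \<open>g\<close>, lies on the right of \<open>g\<close>. Arcs are merely continuous,
  so there are no tangents, and sides are told apart by winding numbers: when \<open>g\<close> is closed up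
  by some path \<open>q\<close> away from a point \<open>x\<close> of \<open>g\<close>, the winding number of the resulting
  loop increases by \<open>1\<close> on crossing \<open>g\<close> near \<open>x\<close> from its right to its left. Neither
  \<open>x\<close> nor \<open>q\<close> matters if \<open>f\<close> is a face and \<open>g\<close> is an edge of a plane graph.
\<close>

definition on_right :: "(real \<Rightarrow> complex) \<Rightarrow> complex set \<Rightarrow> bool" where
  "on_right g f \<longleftrightarrow>
     (\<exists>q x. path q \<and> pathstart q = pathfinish g \<and> pathfinish q = pathstart g \<and>
        x \<in> path_image g - path_image q \<and>
        (\<forall>\<epsilon>>0. \<exists>y \<in> ball x \<epsilon> \<inter> f - path_image (g +++ q). \<exists>z \<in> ball x \<epsilon> - path_image (g +++ q).
           winding_number (g +++ q) z = winding_number (g +++ q) y + 1))"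

definition on_left :: "(real \<Rightarrow> complex) \<Rightarrow> complex set \<Rightarrow> bool" where
  "on_left g f \<longleftrightarrow> on_right (reversepath g) f"

text \<open>
  The derivation attached to the boundary of the face \<open>f\<close>: an arrow is clockwise on this
  boundary if \<open>f\<close> is on its right and counterclockwise if \<open>f\<close> is on its left; both
  contributions are present, and cancel, if \<open>f\<close> is on both sides.
\<close>

definition face_derivation :: "('v, 'e) pre_digraph \<Rightarrow> ('e \<Rightarrow> real \<Rightarrow> complex) \<Rightarrow> complex set \<Rightarrow>
    (('v, 'e) qpath \<Rightarrow>\<^sub>0 'k::field) \<Rightarrow> (('v, 'e) qpath \<Rightarrow>\<^sub>0 'k)" where
  "face_derivation \<Gamma> \<gamma> f = arrow_derivation \<Gamma>
     (\<lambda>p. Poly_Mapping.single (arrow \<Gamma> p) (of_bool (on_right (\<gamma> p) f) - of_bool (on_left (\<gamma> p) f)))"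

end

theory Submission
  imports Defs
begin

text \<open>
  Modulo inner derivations, every derivation of \<open>k\<Gamma>\<close> vanishes on vertices and so sends each arrow
  to a combination of parallel paths. For an acyclic quiver the remaining inner derivations come
  from functions on the vertices and only affect the coefficient of each arrow in its own image.
  The claim is therefore that the face boundaries are a basis of the space of functions on arrows
  modulo coboundaries.

  Near an inner point \<open>x\<close> of an edge \<open>g\<close>, the last and first meeting points of \<open>g\<close> with a small
  circle about \<open>x\<close> and an arc of that circle give a Jordan curve through \<open>x\<close>. By the Jordan curve
  theorem the winding number of \<open>g\<close> is, up to a continuous term, a function taking both values
  0 and 1 arbitrarily close to every point of \<open>g\<close> near \<open>x\<close>, and by Janiszewski's theorem its level
  sets near \<open>x\<close> each lie in one face. This yields the two sides of an edge, and everything else is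
  read off from sums of winding numbers. For an integer cycle \<open>z\<close>, the function
  \<open>\<Sum> z\<^sub>e wn(g\<^sub>e, -)\<close> is an integer on each face, vanishes on unbounded faces and jumps by \<open>z\<^sub>e\<close> across
  \<open>e\<close>; so \<open>z\<close> is a combination of boundaries of bounded faces. Conversely, for a function \<open>c\<close> on
  faces with jumps \<open>a\<^sub>e\<close>, the function \<open>c + \<Sum> a\<^sub>e wn(g\<^sub>e, -)\<close> extends continuously to the complement
  of the vertices; its exponential along a small circle about a vertex shows that face boundaries
  are cycles, and connectedness of that complement shows that \<open>c\<close> is determined by its jumps. Over
  the rationals cycles and coboundaries are orthogonal complements, and additive maps
  \<open>k \<rightarrow> \<rat>\<close> reduce linear independence over \<open>k\<close> to this case.
\<close>

text \<open>An edge is merely continuous: it has no normal vectors and may oscillate at every scale,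
  so its sides have to be read from the values of a function. The winding number of an open arc is
  not an integer, but closing the arc up changes it only by a term continuous away from the closing
  path; what remains is an intrinsic jump by 1. Summed over all edges, these jumps give the duality
  between faces and cycles directly, without induction on the graph or a count of faces. Acyclicity
  enters twice: it excludes loops, so that edges are arcs, and it leaves only trivial closed paths,
  so that elements commuting with all vertices are diagonal. Characteristic 0 enters when a rational
  cycle is divided by a common denominator and when \<open>'k\<close> is viewed as a rational vector
  space. A general field carries no positive definite form; this is why self-orthogonality is
  exploited only over the rationals, where a sum of squares vanishes only if every term
  does.\<close>

hide_const (open) Digraph_Component.connected

section \<open>The two sides of an arc\<close>

text \<open>Preimages of closed sets are relatively closed, so a closed condition spreads from a
  dense part to all of \<open>S\<close>. It serves for integrality and for the vanishing of a
  difference, typically known at first only off the drawing.\<close>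

lemma dense_closed_preimage:
  fixes f :: "'a::topological_space \<Rightarrow> 'b::topological_space"
  assumes "continuous_on S f" "closed T" "D \<subseteq> S" "S \<subseteq> closure D" "\<And>y. y \<in> D \<Longrightarrow> f y \<in> T" "y \<in> S"
  shows "f y \<in> T"
proof -
  have "closedin (top_of_set S) (S \<inter> f -` T)"
    using assms(1,2) by (rule continuous_closedin_preimage)
  then obtain C where C: "closed C" "S \<inter> f -` T = S \<inter> C"
    by (auto simp: closedin_closed)
  have "D \<subseteq> C" using assms(3,5) C(2) by auto
  then have "closure D \<subseteq> C" using C(1) by (rule closure_minimal)
  then show ?thesis using assms(4,6) C(2) by auto
qed

lemma closure_memD:
  assumes "x \<in> closure {y \<in> A. P y}"
  obtains y where "y \<in> A" "P y"
proof -
  have "{y \<in> A. P y} \<noteq> {}" using assms by (metis closure_empty empty_iff)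
  then show thesis using that by auto
qed

lemma closure_approachableD:
  assumes "x \<in> closure {y \<in> A. P y}" "0 < e"
  obtains y where "y \<in> A" "P y" "dist y x < e"
  using assms unfolding closure_approachable by auto

text \<open>Distinct integers are at distance at least 1, so continuity and connectedness leave a
  single value. The dense set \<open>D\<close> appears because winding numbers are controlled only
  off the drawing.\<close>

lemma integer_valued_constant_on:
  fixes f :: "'a::topological_space \<Rightarrow> complex"
  assumes S: "connected S" "continuous_on S f" and D: "D \<subseteq> S" "S \<subseteq> closure D"
    and int: "\<And>y. y \<in> D \<Longrightarrow> f y \<in> \<int>"
  shows "f constant_on S"
proof (rule continuous_discrete_range_constant[OF S])
  have Z: "f y \<in> \<int>" if "y \<in> S" for y
    using dense_closed_preimage[OF S(2) closed_Ints D] int that by blast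
  fix x assume "x \<in> S"
  have "1 \<le> norm (f y - f x)" if "y \<in> S" "f y \<noteq> f x" for y
  proof -
    have "f y - f x \<in> \<int>" using Z \<open>x \<in> S\<close> that(1) by auto
    then obtain n where n: "f y - f x = of_int n" by (auto elim: Ints_cases)
    with that(2) have "n \<noteq> 0" by auto
    then show ?thesis unfolding n by simp
  qed
  then show "\<exists>e>0. \<forall>y. y \<in> S \<and> f y \<noteq> f x \<longrightarrow> e \<le> norm (f y - f x)"
    by (intro exI[of _ 1]) auto
qed

text \<open>\<open>a\<close> is the largest time with \<open>r \<le> f a\<close>; the intermediate
  value theorem turns this into equality, since a later time with value \<open>r\<close> would
  contradict maximality. With \<open>f\<close> the distance to a fixed point, this finds where an
  arc enters a disc for the last time.\<close>

lemma last_exit: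
  fixes f :: "real \<Rightarrow> real"
  assumes "continuous_on {0..t} f" "r \<le> f 0" "f t < r" "0 \<le> t"
  obtains a where "0 \<le> a" "a < t" "f a = r" "\<And>u. a < u \<Longrightarrow> u \<le> t \<Longrightarrow> f u < r"
proof -
  let ?S = "{u \<in> {0..t}. r \<le> f u}"
  have "compact ?S"
  proof -
    have "closed ?S"
      using continuous_closed_preimage[OF assms(1) closed_real_atLeastAtMost closed_atLeast, of r]
      by (auto simp: vimage_def Int_def)
    then show ?thesis
      unfolding compact_eq_bounded_closed by (auto intro: bounded_subset[of "{0..t}"])
  qed
  moreover have "?S \<noteq> {}" using assms by auto
  ultimately obtain a where a: "a \<in> ?S" "\<And>u. u \<in> ?S \<Longrightarrow> u \<le> a"
    using compact_attains_sup[of ?S] by blast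
  have less: "f u < r" if "a < u" "u \<le> t" for u
    using a(1) a(2)[of u] that by (cases "r \<le> f u") auto
  have "a < t" using a(1) assms(3) by (cases "a = t") auto
  obtain u where "a \<le> u" "u \<le> t" "f u = r"
    using IVT2'[of f t r a] a(1) assms \<open>a < t\<close> continuous_on_subset[OF assms(1), of "{a..t}"] by force
  then have "f a = r" using less by (cases "u = a") force+
  with that[of a] less a(1) \<open>a < t\<close> show thesis by auto
qed

lemma circle_arc:
  fixes x :: complex
  assumes "p \<in> sphere x r" "q \<in> sphere x r" "p \<noteq> q" "0 < r"
  obtains c where "arc c" "pathstart c = p" "pathfinish c = q" "path_image c \<subseteq> sphere x r"
proof -
  define s where "s = Arg (p - x)"
  define u where "u = Arg (q - x)"
  have nz: "p - x \<noteq> 0" "q - x \<noteq> 0" and n: "norm (p - x) = r" "norm (q - x) = r"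
    using assms by (auto simp: dist_norm norm_minus_commute)
  have p: "p = x + of_real r * exp (\<i> * of_real s)" and q: "q = x + of_real r * exp (\<i> * of_real u)"
    using Arg_eq[OF nz(1)] Arg_eq[OF nz(2)] n by (auto simp: s_def u_def algebra_simps)
  have "s \<noteq> u" using p q assms(3) by auto
  have bnd: "- pi < s" "s \<le> pi" "- pi < u" "u \<le> pi"
    using Arg_bounded by (auto simp: s_def u_def)
  \<comment> \<open>Two principal arguments differ by less than a full turn, which makes the
    circular path injective.\<close>
  have "\<bar>s - u\<bar> < 2 * pi" using bnd by linarith
  then have "arc (part_circlepath x r s u)"
    using \<open>s \<noteq> u\<close> assms(4) by (intro arc_part_circlepath) auto
  moreover have "path_image (part_circlepath x r s u) \<subseteq> sphere x r"
    using assms(4) path_image_part_circlepath_subset' by auto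
  ultimately show thesis using that p q by (simp add: exp_eq_polar)
qed

text \<open>The last entry into the disc before time \<open>t\<close> and the first exit after it
  bound a piece of \<open>g\<close> whose interior stays off the circle, so an arc of the circle
  closes it up without further intersections. The exit is \<open>last_exit\<close> with time
  reversed, which is why it first appears as \<open>1 - b\<close>.\<close>

lemma crosscut:
  fixes g :: "real \<Rightarrow> complex"
  assumes g: "arc g" and t: "0 < t" "t < 1" and r: "0 < r" "r < dist (g t) (g 0)" "r < dist (g t) (g 1)"
  obtains a b c where "0 \<le> a" "a < t" "t < b" "b \<le> 1" "arc c"
    "pathstart c = g b" "pathfinish c = g a" "path_image c \<subseteq> sphere (g t) r"
    "g ` {a<..<b} \<subseteq> ball (g t) r"
proof -
  have cg: "continuous_on {0..1} g" using g by (simp add: arc_def path_def)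
  have inj: "inj_on g {0..1}" using g by (simp add: arc_def)
  have "continuous_on {0..t} (\<lambda>u. dist (g t) (g u))"
    using t by (intro continuous_intros continuous_on_subset[OF cg]) auto
  from last_exit[OF this, of r] obtain a where a: "0 \<le> a" "a < t" "dist (g t) (g a) = r"
      "\<And>u. a < u \<Longrightarrow> u \<le> t \<Longrightarrow> dist (g t) (g u) < r"
    using t r by auto
  have "continuous_on {0..1-t} (\<lambda>u. dist (g t) (g (1 - u)))"
    using t by (intro continuous_intros continuous_on_compose2[OF cg]) auto
  from last_exit[OF this, of r] obtain b where b: "0 \<le> b" "b < 1 - t" "dist (g t) (g (1 - b)) = r"
      "\<And>u. b < u \<Longrightarrow> u \<le> 1 - t \<Longrightarrow> dist (g t) (g (1 - u)) < r"
    using t r by auto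
  have "g (1 - b) \<noteq> g a" using inj a b t by (auto dest!: inj_onD)
  then obtain c where "arc c" "pathstart c = g (1 - b)" "pathfinish c = g a" "path_image c \<subseteq> sphere (g t) r"
    using circle_arc[of "g (1 - b)" "g t" r "g a"] a(3) b(3) r(1) by auto
  moreover have "g u \<in> ball (g t) r" if "a < u" "u < 1 - b" for u
    using a(4)[of u] b(4)[of "1 - u"] that by (cases "u \<le> t") auto
  then have "g ` {a<..<1 - b} \<subseteq> ball (g t) r" by auto
  ultimately show thesis using that[of a "1 - b" c] a(1,2) b(1,2) by auto
qed

text \<open>
  \<open>\<sigma>\<close> is the discontinuous part of the winding number of \<open>g\<close>. Any path closing up \<open>g\<close> away from
  \<open>U\<close> contributes a continuous term, so \<open>\<sigma>\<close> tells the right side (0) from the left side (1) for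
  every choice of that path in \<^const>\<open>on_right\<close>.
\<close>

definition sides_on :: "complex set \<Rightarrow> (real \<Rightarrow> complex) \<Rightarrow> complex set \<Rightarrow> complex set \<Rightarrow> complex set \<Rightarrow> bool" where
  "sides_on K g R L U \<longleftrightarrow> open U \<and> U \<inter> K \<subseteq> path_image g \<and>
     (\<exists>\<sigma> h. continuous_on U h \<and>
       (\<forall>y\<in>U - K. winding_number g y = \<sigma> y + h y \<and> (\<sigma> y = 0 \<and> y \<in> R \<or> \<sigma> y = 1 \<and> y \<in> L)) \<and>
       (\<forall>x\<in>U \<inter> K. x \<in> closure {y \<in> U - K. \<sigma> y = 0} \<and> x \<in> closure {y \<in> U - K. \<sigma> y = 1}))"

lemma sides_onI:
  assumes "open U" "U \<inter> K \<subseteq> path_image g" "continuous_on U h"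
    and "\<And>y. y \<in> U - K \<Longrightarrow> winding_number g y = \<sigma> y + h y"
    and "\<And>y. y \<in> U - K \<Longrightarrow> \<sigma> y = 0 \<and> y \<in> R \<or> \<sigma> y = 1 \<and> y \<in> L"
    and "\<And>x. x \<in> U \<inter> K \<Longrightarrow> x \<in> closure {y \<in> U - K. \<sigma> y = 0}"
    and "\<And>x. x \<in> U \<inter> K \<Longrightarrow> x \<in> closure {y \<in> U - K. \<sigma> y = 1}"
  shows "sides_on K g R L U"
  unfolding sides_on_def using assms by blast

lemma sides_onE:
  assumes "sides_on K g R L U"
  obtains \<sigma> h where "continuous_on U h"
    "\<forall>y\<in>U - K. winding_number g y = \<sigma> y + h y"
    "\<forall>y\<in>U - K. \<sigma> y = 0 \<and> y \<in> R \<or> \<sigma> y = 1 \<and> y \<in> L"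
    "\<forall>x\<in>U \<inter> K. x \<in> closure {y \<in> U - K. \<sigma> y = 0}"
    "\<forall>x\<in>U \<inter> K. x \<in> closure {y \<in> U - K. \<sigma> y = 1}"
  using assms unfolding sides_on_def by blast

lemma sides_on_subset:
  assumes "sides_on K g R L U" "open V" "V \<subseteq> U"
  shows "sides_on K g R L V"
proof -
  from assms(1) obtain \<sigma> h where h0: "continuous_on U h"
    "\<forall>y\<in>U - K. winding_number g y = \<sigma> y + h y"
    "\<forall>y\<in>U - K. \<sigma> y = 0 \<and> y \<in> R \<or> \<sigma> y = 1 \<and> y \<in> L"
    "\<forall>x\<in>U \<inter> K. x \<in> closure {y \<in> U - K. \<sigma> y = 0}"
    "\<forall>x\<in>U \<inter> K. x \<in> closure {y \<in> U - K. \<sigma> y = 1}"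
    by (rule sides_onE)
  note h = h0(1) h0(2-5)[rule_format]
  have cl: "x \<in> closure {y \<in> V - K. \<sigma> y = j}" if "x \<in> V" "x \<in> closure {y \<in> U - K. \<sigma> y = j}" for x j
  proof -
    have "x \<in> closure (V \<inter> {y \<in> U - K. \<sigma> y = j})"
      using open_Int_closure_subset[OF assms(2)] that by blast
    then show ?thesis by (rule subsetD[OF closure_mono, rotated]) auto
  qed
  have "V \<inter> K \<subseteq> path_image g" using assms unfolding sides_on_def by blast
  then show ?thesis
    using assms(2,3) h(2-5) cl continuous_on_subset[OF h(1) assms(3)]
    by (intro sides_onI[where \<sigma> = \<sigma> and h = h]) blast+
qed

lemma sides_on_exist:
  fixes g :: "real \<Rightarrow> complex"
  assumes g: "arc g" and t: "0 < t" "t < 1" and K: "closed K" "path_image g \<subseteq> K"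
    and r0: "0 < r0" "ball (g t) r0 \<inter> K \<subseteq> path_image g"
  obtains R L U where "g t \<in> U" "sides_on K g R L U" "R \<in> components (- K)" "L \<in> components (- K)"
proof -
  let ?x = "g t"
  have inj: "inj_on g {0..1}" and cg: "continuous_on {0..1} g" and pg: "path g"
    using g by (auto simp add: arc_def path_def)
  have "?x \<noteq> g 0" "?x \<noteq> g 1" using inj_onD[OF inj, of t 0] inj_onD[OF inj, of t 1] t by auto
  \<comment> \<open>The radius must be smaller than the distances to both ends of \<open>g\<close>,
    so that the arc leaves the disc on either side of \<open>t\<close>, and smaller than
    \<open>r0\<close>, so that the disc meets no other part of \<open>K\<close>.\<close>
  then have "0 < min (dist ?x (g 0)) (min (dist ?x (g 1)) r0)" using r0(1) by auto
  from dense[OF this] obtain r where r: "0 < r" "r < dist ?x (g 0)" "r < dist ?x (g 1)" "r < r0"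
    by auto
  from crosscut[OF g t r(1-3)] obtain a b c where
    ab: "0 \<le> a" "a < t" "t < b" "b \<le> 1" and c: "arc c"
    "pathstart c = g b" "pathfinish c = g a" "path_image c \<subseteq> sphere ?x r"
    and gab: "g ` {a<..<b} \<subseteq> ball ?x r" by metis
  define C where "C = subpath a b g +++ c"
  have s: "arc (subpath a b g)" using g ab by (intro arc_subpath_arc) auto
  have pis: "path_image (subpath a b g) = g ` {a..b}"
    using ab by (simp add: path_image_subpath)
  have ab_split: "{a..b} = {a<..<b} \<union> {a, b}" using ab by auto
  have gs: "g ` {a..b} \<subseteq> insert (g a) (insert (g b) (ball ?x r))"
    unfolding ab_split using gab by auto
  have ball_c: "ball ?x r \<inter> path_image c = {}" using c(4) by (auto simp: subset_iff)
  have scd: "simple_path C"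
    unfolding C_def
  proof (rule simple_path_join_loop[OF s c(1)])
    show "path_image (subpath a b g) \<inter> path_image c \<subseteq> {pathstart (subpath a b g), pathstart c}"
      unfolding pis using gs ball_c c(2,3) by (auto simp: pathstart_subpath)
  qed (use c in auto)
  have loop: "pathfinish C = pathstart C" using c by (simp add: C_def)
  have piC: "path_image C = g ` {a..b} \<union> path_image c"
    unfolding C_def using c by (subst path_image_join) (auto simp: pis)
  note J = Jordan_inside_outside[OF scd loop]
  \<comment> \<open>\<open>T\<close> covers the rest of \<open>K\<close>: the part outside the disc
    and both remaining ends of \<open>g\<close>. The closing arc is added so that \<open>T\<close>
    meets the Jordan curve exactly in \<open>path_image c\<close>, a connected set as Janiszewski's
    theorem demands.\<close>
  define T where "T = (K - ball ?x r) \<union> g ` {0..a} \<union> g ` {b..1} \<union> path_image c"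
  have "closed T"
  proof -
    have "closed (g ` {0..a})" "closed (g ` {b..1})"
      by (rule compact_imp_closed, rule compact_continuous_image, rule continuous_on_subset[OF cg], use ab in auto)+
    then show ?thesis
      unfolding T_def using K c(1) by (intro closed_Un closed_Diff closed_path_image arc_imp_path) auto
  qed
  have "g u \<notin> g ` {a<..<b}" if "u \<in> {0..a} \<union> {b..1}" for u
    using inj_onD[OF inj, of u] that ab by fastforce
  then have gT: "T \<inter> g ` {a<..<b} = {}"
    unfolding T_def using gab ball_c by blast
  have xT: "?x \<notin> T" using gT ab by auto
  have KCT: "K \<subseteq> path_image C \<union> T"
  proof
    fix k assume k: "k \<in> K"
    show "k \<in> path_image C \<union> T"
    proof (cases "k \<in> ball ?x r")
      case True
      then have "k \<in> path_image g" using r0(2) r(4) k by auto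
      then obtain u where "k = g u" "u \<in> {0..1}" by (auto simp: path_image_def)
      then show ?thesis by (cases "u \<le> a"; cases "u \<ge> b") (auto simp: T_def piC)
    qed (use k in \<open>auto simp: T_def\<close>)
  qed
  have CT: "path_image C \<inter> T = path_image c"
  proof -
    have "g a \<in> path_image c" "g b \<in> path_image c"
      using c(2,3) pathfinish_in_path_image[of c] pathstart_in_path_image[of c] by auto
    then have "g ` {a..b} \<inter> T \<subseteq> path_image c"
      unfolding ab_split using gT by auto
    then show ?thesis unfolding piC by (auto simp: T_def)
  qed
  have "open (- T \<inter> ball ?x r)" using \<open>closed T\<close> by auto
  then obtain \<delta> where \<delta>: "0 < \<delta>" "ball ?x \<delta> \<subseteq> - T \<inter> ball ?x r"
    using xT r(1) by (metis ComplI Int_iff centre_in_ball open_contains_ball)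
  let ?B = "ball ?x \<delta>"
  have BK: "?B \<inter> K \<subseteq> path_image C" using KCT \<delta> by auto
  have "?B \<subseteq> ball ?x r0" using \<delta> r(4) subset_ball[of r r0 ?x] by auto
  then have BKg: "?B \<inter> K \<subseteq> path_image g" using r0(2) by blast
  \<comment> \<open>Two points of the ball that the curve does not separate are not separated by
    \<open>T\<close> either, because the ball misses \<open>T\<close>. As the two sets meet in a
    connected set, their union, and hence \<open>K\<close>, does not separate these points.\<close>
  have same: "connected_component (- K) y z"
    if "y \<in> ?B" "z \<in> ?B" "connected_component (- path_image C) y z" for y z
  proof -
    have "connected_component (- (path_image C \<union> T)) y z"
    proof (rule Janiszewski)
      show "compact (path_image C)" using scd by (simp add: compact_simple_path_image)
      show "connected (path_image C \<inter> T)" unfolding CT using c(1) by (simp add: connected_arc_image)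
      show "connected_component (- T) y z"
        unfolding connected_component_def using that \<delta> by (intro exI[of _ ?B]) auto
    qed (use that \<open>closed T\<close> in auto)
    then show ?thesis
      by (rule connected_component_of_subset) (use KCT in auto)
  qed
  \<comment> \<open>Both complementary regions of a Jordan curve have the whole curve as frontier,
    so each accumulates at every point of \<open>K\<close> in the ball, all of which lie on the
    curve.\<close>
  have near: "x' \<in> closure {y \<in> ?B - K. y \<in> S}"
    if "S = inside (path_image C) \<or> S = outside (path_image C)" "x' \<in> ?B \<inter> K" for S x'
  proof -
    have "frontier S = path_image C" "S \<inter> path_image C = {}"
      using that(1) J inside_no_overlap[of "path_image C"] outside_no_overlap[of "path_image C"] by blast+
    then have "x' \<in> closure S" "S \<inter> ?B \<inter> K = {}"
      using that(2) BK by (auto simp: frontier_def)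
    then have "x' \<in> closure (?B \<inter> S)"
      using open_Int_closure_subset[of ?B S] that(2) by blast
    then show ?thesis
      by (rule subsetD[OF closure_mono, rotated]) (use \<open>S \<inter> ?B \<inter> K = {}\<close> in auto)
  qed
  have xBK: "?x \<in> ?B \<inter> K" using \<delta> K(2) t by (auto simp: path_image_def)
  obtain yi where yi: "yi \<in> ?B - K" "yi \<in> inside (path_image C)"
    using closure_memD[OF near[of "inside (path_image C)", OF _ xBK]] by blast
  obtain yo where yo: "yo \<in> ?B - K" "yo \<in> outside (path_image C)"
    using closure_memD[OF near[of "outside (path_image C)", OF _ xBK]] by blast
  define FI where "FI = connected_component_set (- K) yi"
  define FO where "FO = connected_component_set (- K) yo"
  have comps: "FI \<in> components (- K)" "FO \<in> components (- K)"
    using yi yo by (auto simp: FI_def FO_def intro!: componentsI)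
  have inFI: "y \<in> FI" if "y \<in> ?B - K" "y \<in> inside (path_image C)" for y
  proof -
    have "connected_component (- path_image C) yi y"
      unfolding connected_component_def
      using J that yi inside_no_overlap[of "path_image C"]
      by (intro exI[of _ "inside (path_image C)"]) blast
    then show ?thesis using same[of yi y] that yi by (auto simp: FI_def)
  qed
  have inFO: "y \<in> FO" if "y \<in> ?B - K" "y \<in> outside (path_image C)" for y
  proof -
    have "connected_component (- path_image C) yo y"
      unfolding connected_component_def
      using J that yo outside_no_overlap[of "path_image C"]
      by (intro exI[of _ "outside (path_image C)"]) blast
    then show ?thesis using same[of yo y] that yo by (auto simp: FO_def)
  qed
  have io: "y \<in> inside (path_image C) \<or> y \<in> outside (path_image C)" if "y \<in> ?B - K" for y
    proof -
    have "g ` {a..b} \<subseteq> path_image g" using ab by (auto simp: path_image_def)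
    then have "path_image C \<subseteq> K \<union> T" unfolding piC T_def using K(2) by blast
    then have "y \<notin> path_image C" using that \<delta> by blast
    then show ?thesis using inside_Un_outside[of "path_image C"] by blast
  qed
  have wo: "winding_number C y = 0" if "y \<in> outside (path_image C)" for y
    using winding_number_zero_in_outside[OF simple_path_imp_path[OF scd] loop that] .
  \<comment> \<open>The ends of \<open>g\<close> left out of \<open>C\<close> are added and the
    closing arc, which does not belong to \<open>g\<close>, is subtracted. All three paths lie in
    \<open>T\<close>, so their winding numbers are continuous on the ball.\<close>
  define h where "h y = winding_number (subpath 0 a g) y + winding_number (subpath b 1 g) y
      - winding_number c y" for y
  have hc: "continuous_on ?B h"
  proof -
    have "path_image (subpath 0 a g) \<subseteq> T" "path_image (subpath b 1 g) \<subseteq> T" "path_image c \<subseteq> T"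
      using ab by (auto simp: T_def path_image_subpath)
    then show ?thesis
      unfolding h_def using pg ab arc_imp_path[OF c(1)] \<delta>
      by (intro continuous_intros continuous_on_subset[OF continuous_on_winding_number] path_subpath) auto
  qed
  have wg: "winding_number g y = winding_number C y + h y" if "y \<in> ?B - K" for y
  proof -
    have yg: "y \<notin> path_image g" using that K(2) by auto
    have yc: "y \<notin> path_image c" using that \<delta> by (auto simp: T_def)
    have ys: "y \<notin> path_image (subpath a b g)"
      using yg ab path_image_subpath_subset[of a b g] by auto
    have "winding_number C y = winding_number (subpath a b g) y + winding_number c y"
      unfolding C_def using s c yc ys by (intro winding_number_join arc_imp_path) auto
    moreover have "winding_number (subpath 0 a g) y + winding_number (subpath a b g) y = winding_number (subpath 0 b g) y"
      using ab by (intro winding_number_subpath_combine pg yg) auto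
    moreover have "winding_number (subpath 0 b g) y + winding_number (subpath b 1 g) y = winding_number (subpath 0 1 g) y"
      using ab by (intro winding_number_subpath_combine pg yg) auto
    ultimately have "winding_number g y = winding_number (subpath 0 a g) y
        + (winding_number C y - winding_number c y) + winding_number (subpath b 1 g) y" by simp
    then show ?thesis by (simp add: h_def)
  qed
  \<comment> \<open>The constant \<open>k\<close> allows for the orientation of \<open>C\<close>: it
    shifts the two winding numbers near the arc to 0 and 1 and is compensated in the continuous
    term.\<close>
  have main: "sides_on K g R L ?B"
    if "\<And>y. y \<in> ?B - K \<Longrightarrow> y \<in> R \<and> \<sigma> y = 0 \<or> y \<in> L \<and> \<sigma> y = 1"
      and "\<And>y. y \<in> ?B - K \<Longrightarrow> \<sigma> y = winding_number C y + k"
      and cl: "\<And>x. x \<in> ?B \<inter> K \<Longrightarrow> x \<in> closure {y \<in> ?B - K. \<sigma> y = 0} \<and> x \<in> closure {y \<in> ?B - K. \<sigma> y = 1}"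
    for \<sigma> k R L
  proof (rule sides_onI[where \<sigma> = \<sigma> and h = "\<lambda>y. h y - k"])
    show "continuous_on ?B (\<lambda>y. h y - k)" using hc by (intro continuous_intros)
    fix y assume y: "y \<in> ?B - K"
    show "winding_number g y = \<sigma> y + (h y - k)" using wg[OF y] that(2)[OF y] by simp
    show "\<sigma> y = 0 \<and> y \<in> R \<or> \<sigma> y = 1 \<and> y \<in> L" using that(1)[OF y] by blast
  qed (use BKg cl in simp_all)
  show thesis
  proof (rule simple_closed_path_winding_number_inside[OF scd])
    assume i: "\<And>z. z \<in> inside (path_image C) \<Longrightarrow> winding_number C z = 1"
    have w: "y \<in> outside (path_image C) \<and> winding_number C y = 0 \<or> y \<in> inside (path_image C) \<and> winding_number C y = 1"
      if "y \<in> ?B - K" for y using io[OF that] i wo by blast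
    have "sides_on K g FO FI ?B"
    proof (rule main[where \<sigma> = "winding_number C" and k = 0])
      fix x assume x: "x \<in> ?B \<inter> K"
      have "{y \<in> ?B - K. y \<in> outside (path_image C)} \<subseteq> {y \<in> ?B - K. winding_number C y = 0}"
        "{y \<in> ?B - K. y \<in> inside (path_image C)} \<subseteq> {y \<in> ?B - K. winding_number C y = 1}"
        using i wo by auto
      note this[THEN closure_mono]
      moreover have "x \<in> closure {y \<in> ?B - K. y \<in> outside (path_image C)}"
        "x \<in> closure {y \<in> ?B - K. y \<in> inside (path_image C)}"
        using near[OF _ x] by simp_all
      ultimately show "x \<in> closure {y \<in> ?B - K. winding_number C y = 0} \<and> x \<in> closure {y \<in> ?B - K. winding_number C y = 1}"
        by (blast dest: subsetD)
    qed (use w inFI inFO in blast, simp)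
    then show thesis using that[of ?B FO FI] comps \<delta>(1) by simp
  next
    \<comment> \<open>A clockwise curve has winding number -1 inside. Adding 1 makes the inside the
      level set of 0, so the inner face is now the right one.\<close>
    assume i: "\<And>z. z \<in> inside (path_image C) \<Longrightarrow> winding_number C z = -1"
    let ?s = "\<lambda>y. winding_number C y + 1"
    have w: "y \<in> outside (path_image C) \<and> ?s y = 1 \<or> y \<in> inside (path_image C) \<and> ?s y = 0"
      if "y \<in> ?B - K" for y using io[OF that] i[of y] wo[of y] by auto
    have "sides_on K g FI FO ?B"
    proof (rule main[where \<sigma> = ?s and k = 1])
      fix x assume x: "x \<in> ?B \<inter> K"
      have "{y \<in> ?B - K. y \<in> outside (path_image C)} \<subseteq> {y \<in> ?B - K. ?s y = 1}"
        "{y \<in> ?B - K. y \<in> inside (path_image C)} \<subseteq> {y \<in> ?B - K. ?s y = 0}"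
        using i wo by auto
      note this[THEN closure_mono]
      moreover have "x \<in> closure {y \<in> ?B - K. y \<in> outside (path_image C)}"
        "x \<in> closure {y \<in> ?B - K. y \<in> inside (path_image C)}"
        using near[OF _ x] by simp_all
      ultimately show "x \<in> closure {y \<in> ?B - K. ?s y = 0} \<and> x \<in> closure {y \<in> ?B - K. ?s y = 1}"
        by (blast dest: subsetD)
    qed (use w inFI inFO in blast, simp)
    then show thesis using that[of ?B FI FO] comps \<delta>(1) by simp
  qed
qed

lemma sides_on_dense:
  assumes "sides_on K g R L U"
  shows "U \<subseteq> closure (U - K)"
proof
  fix x assume "x \<in> U"
  obtain \<sigma> where "\<forall>x\<in>U \<inter> K. x \<in> closure {y \<in> U - K. \<sigma> y = (0::complex)}"
    using assms by (auto simp: sides_on_def)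
  moreover have "closure {y \<in> U - K. \<sigma> y = (0::complex)} \<subseteq> closure (U - K)" by (rule closure_mono) auto
  ultimately show "x \<in> closure (U - K)"
    using \<open>x \<in> U\<close> closure_subset[of "U - K"] by blast
qed

text \<open>Reversal negates the winding number. Writing \<open>- \<sigma>\<close> as
  \<open>(1 - \<sigma>) - 1\<close> restores the values 0 and 1 with their roles exchanged and moves
  the constant into the continuous term.\<close>

lemma sides_on_reversepath:
  assumes "path g" "path_image g \<subseteq> K" "sides_on K g R L U"
  shows "sides_on K (reversepath g) L R U"
proof -
  from assms(3) obtain \<sigma> h where h0: "continuous_on U h"
    "\<forall>y\<in>U - K. winding_number g y = \<sigma> y + h y"
    "\<forall>y\<in>U - K. \<sigma> y = 0 \<and> y \<in> R \<or> \<sigma> y = 1 \<and> y \<in> L"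
    "\<forall>x\<in>U \<inter> K. x \<in> closure {y \<in> U - K. \<sigma> y = 0}"
    "\<forall>x\<in>U \<inter> K. x \<in> closure {y \<in> U - K. \<sigma> y = 1}"
    by (rule sides_onE)
  note h = h0(1) h0(2-5)[rule_format]
  have "winding_number (reversepath g) y = (1 - \<sigma> y) + (- h y - 1)" if "y \<in> U - K" for y
    using h(2)[OF that] that assms(1,2) by (subst winding_number_reversepath) auto
  moreover have "continuous_on U (\<lambda>y. - h y - 1)" using h(1) by (intro continuous_intros)
  moreover have "{y \<in> U - K. 1 - \<sigma> y = 0} = {y \<in> U - K. \<sigma> y = 1}"
    "{y \<in> U - K. 1 - \<sigma> y = 1} = {y \<in> U - K. \<sigma> y = 0}" by auto
  moreover have "1 - \<sigma> y = 0 \<and> y \<in> L \<or> 1 - \<sigma> y = 1 \<and> y \<in> R" if "y \<in> U - K" for y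
    using h(3)[OF that] by auto
  moreover have "open U" "U \<inter> K \<subseteq> path_image (reversepath g)" using assms(3) by (auto simp: sides_on_def)
  ultimately show ?thesis
    using h(4,5) by (intro sides_onI[where \<sigma> = "\<lambda>y. 1 - \<sigma> y" and h = "\<lambda>y. - h y - 1"]) simp_all
qed

lemma components_eqI: "A \<in> components S \<Longrightarrow> B \<in> components S \<Longrightarrow> y \<in> A \<Longrightarrow> y \<in> B \<Longrightarrow> A = B"
  using components_nonoverlap by fastforce

text \<open>Two jump functions of the same arc differ by a continuous integer-valued function, hence
  by a constant near \<open>x\<close>. Once that constant is 0, equal level sets lie in both
  candidate faces, and faces that meet coincide.\<close>

lemma sides_on_unique:
  assumes "sides_on K g R L U" "sides_on K g R' L' U'" "x \<in> U \<inter> U'" "x \<in> K"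
    and "R \<in> components (- K)" "L \<in> components (- K)" "R' \<in> components (- K)" "L' \<in> components (- K)"
  shows "R = R' \<and> L = L'"
proof -
  have "open (U \<inter> U')" using assms(1,2) by (auto simp: sides_on_def)
  then obtain e where e: "0 < e" "ball x e \<subseteq> U \<inter> U'"
    using assms(3) open_contains_ball by blast
  let ?B = "ball x e"
  have s: "sides_on K g R L ?B" "sides_on K g R' L' ?B"
    using sides_on_subset[OF assms(1)] sides_on_subset[OF assms(2)] e by auto
  from s(1) obtain \<sigma> h where h0: "continuous_on ?B h"
    "\<forall>y\<in>?B - K. winding_number g y = \<sigma> y + h y"
    "\<forall>y\<in>?B - K. \<sigma> y = 0 \<and> y \<in> R \<or> \<sigma> y = 1 \<and> y \<in> L"
    "\<forall>x\<in>?B \<inter> K. x \<in> closure {y \<in> ?B - K. \<sigma> y = 0}"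
    "\<forall>x\<in>?B \<inter> K. x \<in> closure {y \<in> ?B - K. \<sigma> y = 1}"
    by (rule sides_onE)
  note h = h0(1) h0(2-5)[rule_format]
  from s(2) obtain \<sigma>' h' where h'0: "continuous_on ?B h'"
    "\<forall>y\<in>?B - K. winding_number g y = \<sigma>' y + h' y"
    "\<forall>y\<in>?B - K. \<sigma>' y = 0 \<and> y \<in> R' \<or> \<sigma>' y = 1 \<and> y \<in> L'"
    by (rule sides_onE)
  note h' = h'0(1) h'0(2-3)[rule_format]
  have eq: "\<sigma> y - \<sigma>' y = h' y - h y" if "y \<in> ?B - K" for y
    using h(2)[OF that] h'(2)[OF that] by (simp add: algebra_simps)
  have "(\<lambda>y. h' y - h y) constant_on ?B"
  proof (rule integer_valued_constant_on[OF connected_ball _ _ sides_on_dense[OF s(1)]])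
    show "continuous_on ?B (\<lambda>y. h' y - h y)" using h(1) h'(1) by (intro continuous_intros)
    fix y assume y: "y \<in> ?B - K"
    show "h' y - h y \<in> \<int>" using h(3)[OF y] h'(3)[OF y] by (auto simp flip: eq[OF y])
  qed auto
  then obtain k where k: "\<And>y. y \<in> ?B - K \<Longrightarrow> \<sigma> y - \<sigma>' y = k"
    unfolding constant_on_def using eq by (metis DiffD1)
  have x: "x \<in> ?B \<inter> K" using e(1) assms(4) by auto
  obtain y0 where y0: "y0 \<in> ?B - K" "\<sigma> y0 = 0"
    using closure_memD[OF h(4)[OF x]] by blast
  obtain y1 where y1: "y1 \<in> ?B - K" "\<sigma> y1 = 1"
    using closure_memD[OF h(5)[OF x]] by blast
  \<comment> \<open>\<open>\<sigma>\<close> takes both values 0 and 1, so a nonzero shift would push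
    a value of \<open>\<sigma>'\<close> out of this range.\<close>
  have "k = 0" using k[OF y0(1)] k[OF y1(1)] h'(3)[OF y0(1)] h'(3)[OF y1(1)] y0(2) y1(2) by auto
  then have "y0 \<in> R \<inter> R'" "y1 \<in> L \<inter> L'"
    using k[OF y0(1)] k[OF y1(1)] h'(3)[OF y0(1)] h'(3)[OF y1(1)] h(3)[OF y0(1)] h(3)[OF y1(1)] y0(2) y1(2)
    by auto
  then show ?thesis using components_eqI assms(5-8) by blast
qed

section \<open>Sides of a whole arc, and their agreement with \<open>on_right\<close> and
  \<open>on_left\<close>\<close>

definition arc_sides :: "complex set \<Rightarrow> (real \<Rightarrow> complex) \<Rightarrow> complex set \<Rightarrow> complex set \<Rightarrow> bool" where
  "arc_sides K g R L \<longleftrightarrow> R \<in> components (- K) \<and> L \<in> components (- K) \<and>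
     (\<forall>t\<in>{0<..<1}. \<exists>U. g t \<in> U \<and> sides_on K g R L U)"

text \<open>The pair of faces found near \<open>g t\<close> depends only on \<open>t\<close>, by
  uniqueness, and is locally constant in it; connectedness of the open interval leaves one pair for
  the whole arc.\<close>

lemma arc_sides_exist:
  fixes g :: "real \<Rightarrow> complex"
  assumes g: "arc g" and K: "closed K" "path_image g \<subseteq> K"
    and r: "\<And>t. t \<in> {0<..<1} \<Longrightarrow> \<exists>r>0. ball (g t) r \<inter> K \<subseteq> path_image g"
  obtains R L where "arc_sides K g R L"
proof -
  define P where "P t F \<longleftrightarrow> fst F \<in> components (- K) \<and> snd F \<in> components (- K) \<and>
     (\<exists>U. g t \<in> U \<and> sides_on K g (fst F) (snd F) U)" for t F
  define \<Phi> where "\<Phi> t = (SOME F. P t F)" for t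
  have \<Phi>: "P t (\<Phi> t)" if t: "t \<in> {0<..<1}" for t
  proof -
    obtain r where "0 < r" "ball (g t) r \<inter> K \<subseteq> path_image g" using r[OF t] by blast
    then obtain R L U where "g t \<in> U" "sides_on K g R L U" "R \<in> components (- K)" "L \<in> components (- K)"
      using sides_on_exist[OF g _ _ K] t by (metis greaterThanLessThan_iff)
    then have "P t (R, L)" unfolding P_def by auto
    then show ?thesis unfolding \<Phi>_def by (rule someI)
  qed
  have "\<Phi> constant_on {0<..<1}"
  proof (rule locally_constant_imp_constant)
    fix t :: real assume t: "t \<in> {0<..<1}"
    from \<Phi>[OF t] obtain U where U: "g t \<in> U" "sides_on K g (fst (\<Phi> t)) (snd (\<Phi> t)) U"
      unfolding P_def by blast
    have "continuous_on {0<..<1} g"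
      using g by (auto simp: arc_def path_def intro: continuous_on_subset)
    then have "openin (top_of_set {0<..<1}) ({0<..<1} \<inter> g -` U)"
      using U(2) by (intro continuous_openin_preimage_gen) (auto simp: sides_on_def)
    moreover have "\<Phi> s = \<Phi> t" if s: "s \<in> {0<..<1} \<inter> g -` U" for s
    proof -
      from \<Phi>[of s] s obtain U' where U': "g s \<in> U'" "sides_on K g (fst (\<Phi> s)) (snd (\<Phi> s)) U'"
        unfolding P_def by blast
      have "g s \<in> K" using K(2) s by (auto simp: path_image_def)
      then show ?thesis
        using sides_on_unique[OF U'(2) U(2), of "g s"] U' s \<Phi>[of s] \<Phi>[OF t]
        by (auto simp: P_def prod_eq_iff)
    qed
    moreover have "t \<in> {0<..<1} \<inter> g -` U" using U(1) t by simp
    ultimately show "\<exists>T. openin (top_of_set {0<..<1}) T \<and> t \<in> T \<and> (\<forall>x\<in>T. \<Phi> x = \<Phi> t)"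
      by metis
  qed auto
  then obtain F where "\<And>t. t \<in> {0<..<1} \<Longrightarrow> \<Phi> t = F" unfolding constant_on_def by blast
  then have "P t F" if "t \<in> {0<..<1}" for t using \<Phi>[OF that] that by simp
  moreover have "(1/2::real) \<in> {0<..<1}" by simp
  ultimately have "arc_sides K g (fst F) (snd F)" unfolding arc_sides_def P_def by blast
  then show thesis by (rule that)
qed

text \<open>For every admissible choice of \<open>q\<close> and \<open>x\<close>, the winding number
  of the closed loop near \<open>x\<close> is the same jump function up to a constant. Hence all
  choices single out the same face.\<close>

lemma on_right_iff:
  fixes g :: "real \<Rightarrow> complex"
  assumes g: "arc g" and K: "path_image g \<subseteq> K" and s: "arc_sides K g R L" and f: "f \<in> components (- K)"
  shows "on_right g f \<longleftrightarrow> f = R"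
proof -
  have pg: "path g" using g by (rule arc_imp_path)
  have fK: "f \<inter> K = {}" using in_components_subset[OF f] by auto
  \<comment> \<open>The term added to \<open>\<sigma>\<close> is continuous near \<open>x\<close>,
    since \<open>q\<close> avoids \<open>x\<close>, and integral off \<open>K\<close>, since the
    loop is closed; it is therefore a constant \<open>k\<close>.\<close>
  have key: "\<exists>e>0. \<exists>\<sigma> k. ball x e \<inter> K \<subseteq> path_image g \<and> ball x e \<inter> path_image q = {} \<and>
      (\<forall>y\<in>ball x e - K. winding_number (g +++ q) y = \<sigma> y + k \<and> (\<sigma> y = 0 \<and> y \<in> R \<or> \<sigma> y = 1 \<and> y \<in> L)) \<and>
      x \<in> closure {y \<in> ball x e - K. \<sigma> y = 0} \<and> x \<in> closure {y \<in> ball x e - K. \<sigma> y = 1}"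
    if q: "path q" "pathstart q = pathfinish g" "pathfinish q = pathstart g"
      "x \<in> path_image g - path_image q" for q x
  proof -
    obtain t where t: "x = g t" "t \<in> {0..1}" using q(4) by (auto simp: path_image_def)
    \<comment> \<open>The closing path passes through both endpoints of \<open>g\<close>, whereas
      \<open>x\<close> is not on it.\<close>
    have "t \<noteq> 0" "t \<noteq> 1"
      using q(2-4) t pathstart_in_path_image[of q] pathfinish_in_path_image[of q]
      by (auto simp: pathstart_def pathfinish_def)
    then have "t \<in> {0<..<1}" using t(2) by auto
    then obtain U where U: "x \<in> U" "sides_on K g R L U" using s t(1) unfolding arc_sides_def by blast
    have "open (U - path_image q)"
      using U(2) q(1) by (auto simp: sides_on_def intro!: open_Diff closed_path_image)
    then obtain e where e: "0 < e" "ball x e \<subseteq> U - path_image q"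
      using U(1) q(4) open_contains_ball by blast
    let ?B = "ball x e"
    have sB: "sides_on K g R L ?B" using sides_on_subset[OF U(2)] e by auto
    from sB obtain \<sigma> h where h0: "continuous_on ?B h"
      "\<forall>y\<in>?B - K. winding_number g y = \<sigma> y + h y"
      "\<forall>y\<in>?B - K. \<sigma> y = 0 \<and> y \<in> R \<or> \<sigma> y = 1 \<and> y \<in> L"
      "\<forall>x\<in>?B \<inter> K. x \<in> closure {y \<in> ?B - K. \<sigma> y = 0}"
      "\<forall>x\<in>?B \<inter> K. x \<in> closure {y \<in> ?B - K. \<sigma> y = 1}"
    by (rule sides_onE)
  note h = h0(1) h0(2-5)[rule_format]
    have w: "winding_number (g +++ q) y = \<sigma> y + (h y + winding_number q y)" if y: "y \<in> ?B - K" for y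
    proof -
      have "y \<notin> path_image g" "y \<notin> path_image q" using y K e(2) by auto
      then show ?thesis using h(2)[OF y] pg q by (subst winding_number_join) auto
    qed
    have "(\<lambda>y. h y + winding_number q y) constant_on ?B"
    proof (rule integer_valued_constant_on[OF connected_ball _ _ sides_on_dense[OF sB]])
      show "continuous_on ?B (\<lambda>y. h y + winding_number q y)"
        using h(1) q(1) e(2) by (intro continuous_intros continuous_on_subset[OF continuous_on_winding_number]) auto
      fix y assume y: "y \<in> ?B - K"
      have "y \<notin> path_image (g +++ q)" using y K e(2) q by (subst path_image_join) auto
      then have "winding_number (g +++ q) y \<in> \<int>"
        using pg q by (intro integer_winding_number) auto
      then have "\<sigma> y + (h y + winding_number q y) \<in> \<int>" unfolding w[OF y] .
      moreover have "\<sigma> y \<in> \<int>" using h(3)[OF y] by auto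
      ultimately show "h y + winding_number q y \<in> \<int>" by (metis Ints_diff add_diff_cancel_left')
    qed auto
    then obtain k where k: "\<And>y. y \<in> ?B \<Longrightarrow> h y + winding_number q y = k"
      unfolding constant_on_def by blast
    have "x \<in> ?B \<inter> K" using e(1) q(4) K by auto
    then show ?thesis
      using e sB w k h(3-5) by (intro exI[of _ e] conjI exI[of _ \<sigma>] exI[of _ k]) (auto simp: sides_on_def)
  qed
  show ?thesis
  proof
    assume "on_right g f"
    then obtain q x where q: "path q" "pathstart q = pathfinish g" "pathfinish q = pathstart g"
      "x \<in> path_image g - path_image q" and
      ex: "\<And>e. e > 0 \<Longrightarrow> \<exists>y \<in> ball x e \<inter> f - path_image (g +++ q). \<exists>z \<in> ball x e - path_image (g +++ q).
           winding_number (g +++ q) z = winding_number (g +++ q) y + 1"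
      unfolding on_right_def by blast
    from key[OF q] obtain e \<sigma> k where e: "0 < e" "ball x e \<inter> K \<subseteq> path_image g" "ball x e \<inter> path_image q = {}"
      "\<And>y. y\<in>ball x e - K \<Longrightarrow> winding_number (g +++ q) y = \<sigma> y + k \<and> (\<sigma> y = 0 \<and> y \<in> R \<or> \<sigma> y = 1 \<and> y \<in> L)"
      by blast
    from ex[OF e(1)] obtain y z where yz: "y \<in> ball x e" "y \<in> f" "z \<in> ball x e" "z \<notin> path_image (g +++ q)"
      "winding_number (g +++ q) z = winding_number (g +++ q) y + 1" by blast
    have "z \<notin> path_image g" using yz(4) q(2) by (auto simp: path_image_join)
    then have D: "y \<in> ball x e - K" "z \<in> ball x e - K" using yz(1-3) e(2) fK by auto
    \<comment> \<open>An increase by exactly 1 between values in {0, 1} starts at 0, which places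
      \<open>y\<close> on the right.\<close>
    then have "\<sigma> z = \<sigma> y + 1" using yz(5) e(4)[OF D(1)] e(4)[OF D(2)] by simp
    then have "y \<in> R" using e(4)[OF D(1)] e(4)[OF D(2)] by auto
    then show "f = R" using components_eqI[OF f _ yz(2)] s by (auto simp: arc_sides_def)
  next
    assume "f = R"
    define x where "x = g (1/2)"
    have inj: "inj_on g {0..1}" using g by (simp add: arc_def)
    have "g 0 \<noteq> x" "g 1 \<noteq> x"
      using inj_onD[OF inj, of 0 "1/2"] inj_onD[OF inj, of 1 "1/2"] by (auto simp: x_def)
    \<comment> \<open>Any path between the endpoints that avoids the midpoint can serve as
      \<open>q\<close>, and the punctured plane contains one.\<close>
    moreover have "path_connected (- {x})" by (rule path_connected_punctured_universe) simp
    ultimately obtain q where q: "path q" "path_image q \<subseteq> - {x}" "pathstart q = g 1" "pathfinish q = g 0"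
      unfolding path_connected_def by blast
    have q': "path q" "pathstart q = pathfinish g" "pathfinish q = pathstart g" "x \<in> path_image g - path_image q"
      using q by (auto simp: pathstart_def pathfinish_def x_def path_image_def)
    from key[OF q'] obtain e \<sigma> k where e: "0 < e" "ball x e \<inter> path_image q = {}"
      "\<And>y. y\<in>ball x e - K \<Longrightarrow> winding_number (g +++ q) y = \<sigma> y + k \<and> (\<sigma> y = 0 \<and> y \<in> R \<or> \<sigma> y = 1 \<and> y \<in> L)"
      "x \<in> closure {y \<in> ball x e - K. \<sigma> y = 0}" "x \<in> closure {y \<in> ball x e - K. \<sigma> y = 1}"
      by blast
    have off: "y \<notin> path_image (g +++ q)" if "y \<in> ball x e - K" for y
      using that e(2) K q'(2) by (subst path_image_join) auto
    have "\<exists>y \<in> ball x \<epsilon> \<inter> f - path_image (g +++ q). \<exists>z \<in> ball x \<epsilon> - path_image (g +++ q).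
           winding_number (g +++ q) z = winding_number (g +++ q) y + 1" if eps: "\<epsilon> > 0" for \<epsilon>
    proof -
      obtain y where y: "y \<in> ball x e - K" "\<sigma> y = 0" "dist y x < \<epsilon>"
        using closure_approachableD[OF e(4) eps] by blast
      obtain z where z: "z \<in> ball x e - K" "\<sigma> z = 1" "dist z x < \<epsilon>"
        using closure_approachableD[OF e(5) eps] by blast
      have "y \<in> ball x \<epsilon> \<inter> f - path_image (g +++ q)" "z \<in> ball x \<epsilon> - path_image (g +++ q)"
        using y z off e(3)[OF y(1)] \<open>f = R\<close> by (auto simp: dist_commute)
      moreover have "winding_number (g +++ q) z = winding_number (g +++ q) y + 1"
        using e(3)[OF y(1)] e(3)[OF z(1)] y z by simp
      ultimately show ?thesis by blast
    qed
    then show "on_right g f" unfolding on_right_def using q' by blast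
  qed
qed

lemma on_left_iff:
  fixes g :: "real \<Rightarrow> complex"
  assumes g: "arc g" and K: "path_image g \<subseteq> K" and s: "arc_sides K g R L" and f: "f \<in> components (- K)"
  shows "on_left g f \<longleftrightarrow> f = L"
  unfolding on_left_def
proof (rule on_right_iff[OF _ _ _ f])
  have "\<exists>U. reversepath g t \<in> U \<and> sides_on K (reversepath g) L R U" if "t \<in> {0<..<1}" for t
  proof -
    have "1 - t \<in> {0<..<1}" using that by auto
    then obtain U where "g (1 - t) \<in> U" "sides_on K g R L U" using s unfolding arc_sides_def by blast
    then show ?thesis using sides_on_reversepath[OF arc_imp_path[OF g] K]
      by (auto simp: reversepath_def)
  qed
  then show "arc_sides K (reversepath g) L R" using s unfolding arc_sides_def by blast
qed (use g K arc_reversepath in auto)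

section \<open>Faces of a plane quiver\<close>

text \<open>Two local formulas agree with \<open>F\<close> on the dense set \<open>D\<close>, hence
  with each other wherever both apply in \<open>S\<close>. The values \<open>h z z\<close> therefore
  glue to a single continuous function.\<close>

lemma continuous_extension_local:
  fixes F :: "'a::t2_space \<Rightarrow> complex"
  assumes "D \<subseteq> S" "S \<subseteq> closure D"
    and loc: "\<And>z. z \<in> S \<Longrightarrow> \<exists>U h. open U \<and> z \<in> U \<and> continuous_on U h \<and> (\<forall>y\<in>U \<inter> D. F y = h y)"
  obtains G where "continuous_on S G" "\<And>y. y \<in> D \<Longrightarrow> G y = F y"
proof -
  have "\<forall>z\<in>S. \<exists>U h. open U \<and> z \<in> U \<and> continuous_on U h \<and> (\<forall>y\<in>U \<inter> D. F y = h y)"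
    using loc by blast
  then obtain U h where U: "\<And>z. z \<in> S \<Longrightarrow> open (U z)" "\<And>z. z \<in> S \<Longrightarrow> z \<in> U z"
    "\<And>z. z \<in> S \<Longrightarrow> continuous_on (U z) (h z)" "\<And>z y. z \<in> S \<Longrightarrow> y \<in> U z \<Longrightarrow> y \<in> D \<Longrightarrow> F y = h z y"
    unfolding bchoice_iff by (metis IntI)
  define G where "G z = h z z" for z
  have eq: "h z' z' = h z z'" if z: "z \<in> S" "z' \<in> S" "z' \<in> U z" for z z'
  proof -
    let ?V = "U z \<inter> U z'"
    have V: "open ?V" "z' \<in> ?V" using U z by auto
    have "h z' z' - h z z' \<in> {0}"
    proof (rule dense_closed_preimage[where S = "?V \<inter> S" and D = "?V \<inter> D" and f = "\<lambda>y. h z' y - h z y"])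
      show "continuous_on (?V \<inter> S) (\<lambda>y. h z' y - h z y)"
        by (intro continuous_intros continuous_on_subset[OF U(3)[OF z(1)]] continuous_on_subset[OF U(3)[OF z(2)]]) auto
      have "?V \<inter> S \<subseteq> ?V \<inter> closure D" using assms(2) by auto
      also have "\<dots> \<subseteq> closure (?V \<inter> D)" using V(1) by (rule open_Int_closure_subset)
      finally show "?V \<inter> S \<subseteq> closure (?V \<inter> D)" .
      show "h z' y - h z y \<in> {0}" if "y \<in> ?V \<inter> D" for y
        using U(4)[OF z(1), of y] U(4)[OF z(2), of y] that by auto
    qed (use assms(1) V z in auto)
    then show ?thesis by simp
  qed
  have "continuous_on S G"
  proof (unfold continuous_on_eq_continuous_within, rule ballI)
    fix z assume z: "z \<in> S"
    have "isCont (h z) z"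
      using U(1-3)[OF z] continuous_on_eq_continuous_at by blast
    then have "(h z \<longlongrightarrow> h z z) (at z within S)"
      unfolding isCont_def by (rule tendsto_within_subset) simp
    moreover have "\<forall>\<^sub>F z' in at z within S. h z z' = G z'"
    proof -
      have "\<forall>\<^sub>F z' in at z within S. z' \<in> U z"
        using U(1,2)[OF z] by (metis eventually_at_topological)
      moreover have "\<forall>\<^sub>F z' in at z within S. z' \<in> S"
        by (simp add: eventually_at_filter)
      ultimately show ?thesis
        by eventually_elim (use z eq in \<open>simp add: G_def\<close>)
    qed
    ultimately have "(G \<longlongrightarrow> h z z) (at z within S)"
      by (rule Lim_transform_eventually)
    then show "continuous (at z within S) G"
      by (simp add: continuous_within G_def)
  qed
  moreover have "G y = F y" if "y \<in> D" for y
    using U(2)[of y] U(4)[of y y] that assms(1) by (auto simp: G_def)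
  ultimately show thesis by (rule that)
qed

text \<open>A logarithm of \<open>w - y\<close> turns the path into the exponential of another path.
  If one logarithm serves the whole drawing, the winding numbers of edges become potential
  differences, which cancel along cycles.\<close>

lemma winding_number_log_diff:
  assumes "path g" "path_image g \<subseteq> S" "continuous_on S l" "\<And>w. w \<in> S \<Longrightarrow> w - y = exp (l w)"
  shows "winding_number g y = (l (pathfinish g) - l (pathstart g)) / (2 * of_real pi * \<i>)"
proof -
  have "path (l \<circ> g)"
    using assms(1-3) by (intro path_continuous_image) (auto intro: continuous_on_subset)
  have "winding_number g y = winding_number (\<lambda>t. g t - y) 0"
    by (rule winding_number_offset)
  also have "\<dots> = winding_number (exp \<circ> (l \<circ> g)) 0"
  proof (rule winding_number_cong)
    fix t :: real assume "0 \<le> t" "t \<le> 1"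
    then have "g t \<in> S" using assms(2) by (auto simp: path_image_def)
    then show "g t - y = (exp \<circ> (l \<circ> g)) t" using assms(4) by simp
  qed
  also have "\<dots> = (l (pathfinish g) - l (pathstart g)) / (2 * of_real pi * \<i>)"
    by (subst winding_number_compose_exp[OF \<open>path (l \<circ> g)\<close>]) (simp add: pathfinish_def pathstart_def)
  finally show ?thesis .
qed

section \<open>The incidence matrix\<close>

context fin_digraph
begin

definition incidence :: "'b \<Rightarrow> 'a \<Rightarrow> int" where
  "incidence e v = of_bool (head G e = v) - of_bool (tail G e = v)"

text \<open>Summation by parts: the boundary map is the transpose of the coboundary map.\<close>

lemma sum_incidence:
  fixes z :: "'b \<Rightarrow> 'c::comm_ring_1" and \<phi> :: "'a \<Rightarrow> 'c"
  shows "(\<Sum>e\<in>arcs G. z e * (\<phi> (head G e) - \<phi> (tail G e))) =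
    (\<Sum>v\<in>verts G. \<phi> v * (\<Sum>e\<in>arcs G. z e * of_int (incidence e v)))"
proof -
  have "\<phi> (head G e) - \<phi> (tail G e) = (\<Sum>v\<in>verts G. \<phi> v * of_int (incidence e v))" if "e \<in> arcs G" for e
  proof -
    have "(\<Sum>v\<in>verts G. \<phi> v * of_int (incidence e v)) =
      (\<Sum>v\<in>verts G. if v = head G e then \<phi> v else 0) - (\<Sum>v\<in>verts G. if v = tail G e then \<phi> v else 0)"
      unfolding incidence_def sum_subtractf[symmetric] by (intro sum.cong) auto
    then show ?thesis using that by simp
  qed
  then have "(\<Sum>e\<in>arcs G. z e * (\<phi> (head G e) - \<phi> (tail G e))) =
    (\<Sum>e\<in>arcs G. \<Sum>v\<in>verts G. \<phi> v * (z e * of_int (incidence e v)))"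
    by (intro sum.cong) (auto simp: sum_distrib_left algebra_simps)
  also have "\<dots> = (\<Sum>v\<in>verts G. \<Sum>e\<in>arcs G. \<phi> v * (z e * of_int (incidence e v)))"
    by (rule sum.swap)
  finally show ?thesis by (simp add: sum_distrib_left)
qed

lemma cycle_sum_eq_0:
  fixes z :: "'b \<Rightarrow> int" and \<phi> :: "'a \<Rightarrow> 'c::comm_ring_1"
  assumes "\<And>v. v \<in> verts G \<Longrightarrow> (\<Sum>e\<in>arcs G. z e * incidence e v) = 0"
  shows "(\<Sum>e\<in>arcs G. of_int (z e) * (\<phi> (head G e) - \<phi> (tail G e))) = 0"
proof -
  have "(\<Sum>e\<in>arcs G. of_int (z e) * of_int (incidence e v)) = (0::'c)" if "v \<in> verts G" for v
    unfolding of_int_mult[symmetric] of_int_sum[symmetric] assms[OF that] by simp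
  then show ?thesis by (simp add: sum_incidence[of "\<lambda>e. of_int (z e)" \<phi>])
qed

end

text \<open>Excluding loops gives every edge two distinct endpoints, so that it is an arc rather
  than a closed curve.\<close>

locale plane_quiver = fin_digraph G for G :: "('v, 'e) pre_digraph" +
  fixes pos :: "'v \<Rightarrow> complex" and \<gamma> :: "'e \<Rightarrow> real \<Rightarrow> complex"
  assumes emb: "plane_embedding G pos \<gamma>"
    and loopless: "e \<in> arcs G \<Longrightarrow> tail G e \<noteq> head G e"
begin

abbreviation K :: "complex set" where "K \<equiv> drawing G pos \<gamma>"

lemma arc_edge:
  assumes "e \<in> arcs G"
  shows "Path_Connected.arc (\<gamma> e)" "pathstart (\<gamma> e) = pos (tail G e)" "pathfinish (\<gamma> e) = pos (head G e)"
proof -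
  show *: "pathstart (\<gamma> e) = pos (tail G e)" "pathfinish (\<gamma> e) = pos (head G e)"
    using emb assms by (auto simp: plane_embedding_def)
  have "inj_on pos (verts G)" "simple_path (\<gamma> e)" using emb assms by (auto simp: plane_embedding_def)
  then show "Path_Connected.arc (\<gamma> e)"
    using * loopless[OF assms] assms inj_onD[of pos "verts G"]
    by (metis arc_simple_path head_in_verts tail_in_verts)
qed

lemma compact_drawing: "compact K"
proof -
  have "compact (path_image (\<gamma> e))" if "e \<in> arcs G" for e
    using arc_edge(1)[OF that] by (simp add: compact_arc_image)
  then show ?thesis
    unfolding drawing_def by (intro compact_Un compact_UN finite_imp_compact[of "pos ` _"]) auto
qed

lemma closed_drawing: "closed K"
  by (rule compact_imp_closed[OF compact_drawing])

lemma edge_in_drawing: "e \<in> arcs G \<Longrightarrow> path_image (\<gamma> e) \<subseteq> K"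
  by (auto simp: drawing_def)

lemma pos_in_drawing: "v \<in> verts G \<Longrightarrow> pos v \<in> K"
  by (auto simp: drawing_def)

lemma path_image_edge:
  assumes "e \<in> arcs G"
  shows "path_image (\<gamma> e) = \<gamma> e ` {0<..<1} \<union> {pos (tail G e), pos (head G e)}"
proof -
  have "{0..1::real} = {0<..<1} \<union> {0, 1}" by auto
  then show ?thesis
    using arc_edge(2,3)[OF assms] by (auto simp: path_image_def pathstart_def pathfinish_def)
qed

lemma edge_neighbourhood:
  assumes "e \<in> arcs G" "t \<in> {0<..<1}"
  obtains r where "0 < r" "\<And>e'. e' \<in> arcs G \<Longrightarrow> e' \<noteq> e \<Longrightarrow> ball (\<gamma> e t) r \<inter> path_image (\<gamma> e') = {}"
    "ball (\<gamma> e t) r \<inter> pos ` verts G = {}"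
proof -
  define C where "C = pos ` verts G \<union> (\<Union>e'\<in>arcs G - {e}. path_image (\<gamma> e'))"
  have "closed (path_image (\<gamma> e'))" if "e' \<in> arcs G" for e'
    using arc_edge(1)[OF that] by (simp add: closed_arc_image)
  then have "closed C"
    unfolding C_def by (intro closed_Un closed_UN finite_imp_closed[of "pos ` _"]) auto
  moreover have "\<gamma> e t \<notin> C"
  proof -
    have v: "\<gamma> e t \<notin> pos ` verts G" using emb assms unfolding plane_embedding_def by blast
    moreover have "\<gamma> e t \<notin> path_image (\<gamma> e')" if "e' \<in> arcs G - {e}" for e'
    proof -
      have "\<gamma> e t \<notin> \<gamma> e' ` {0<..<1}" using emb assms that unfolding plane_embedding_def by blast
      then show ?thesis using v that by (auto simp: path_image_edge)
    qed
    ultimately show ?thesis by (auto simp: C_def)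
  qed
  ultimately obtain r where "0 < r" "ball (\<gamma> e t) r \<subseteq> - C"
    by (metis ComplI open_Compl open_contains_ball)
  then show thesis using that[of r] by (auto simp: C_def)
qed

lemma edge_sides_exist:
  assumes "e \<in> arcs G"
  shows "\<exists>R L. arc_sides K (\<gamma> e) R L"
proof (rule arc_sides_exist[OF arc_edge(1)[OF assms] closed_drawing edge_in_drawing[OF assms]])
  fix t :: real assume "t \<in> {0<..<1}"
  from edge_neighbourhood[OF assms this] obtain r where "0 < r"
    "\<And>e'. e' \<in> arcs G \<Longrightarrow> e' \<noteq> e \<Longrightarrow> ball (\<gamma> e t) r \<inter> path_image (\<gamma> e') = {}"
    "ball (\<gamma> e t) r \<inter> pos ` verts G = {}" by metis
  then show "\<exists>r>0. ball (\<gamma> e t) r \<inter> K \<subseteq> path_image (\<gamma> e)"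
    by (intro exI[of _ r]) (force simp: drawing_def)
qed blast

definition right_face :: "'e \<Rightarrow> complex set" where
  "right_face e = (SOME R. \<exists>L. arc_sides K (\<gamma> e) R L)"

text \<open>Chosen after \<open>right_face\<close> and relative to it, so that the two choices
  together satisfy \<open>arc_sides\<close>.\<close>

definition left_face :: "'e \<Rightarrow> complex set" where
  "left_face e = (SOME L. arc_sides K (\<gamma> e) (right_face e) L)"

lemma edge_sides:
  assumes "e \<in> arcs G"
  shows "arc_sides K (\<gamma> e) (right_face e) (left_face e)"
  unfolding left_face_def
  by (rule someI_ex, unfold right_face_def, rule someI_ex, rule edge_sides_exist[OF assms])

lemma faces_of_edge:
  assumes "e \<in> arcs G"
  shows "right_face e \<in> components (- K)" "left_face e \<in> components (- K)"
  using edge_sides[OF assms] by (auto simp: arc_sides_def)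

lemma on_right_edge_iff: "e \<in> arcs G \<Longrightarrow> f \<in> components (- K) \<Longrightarrow> on_right (\<gamma> e) f \<longleftrightarrow> f = right_face e"
  by (rule on_right_iff[OF arc_edge(1) edge_in_drawing edge_sides])

lemma on_left_edge_iff: "e \<in> arcs G \<Longrightarrow> f \<in> components (- K) \<Longrightarrow> on_left (\<gamma> e) f \<longleftrightarrow> f = left_face e"
  by (rule on_left_iff[OF arc_edge(1) edge_in_drawing edge_sides])

lemma edge_point_sides:
  assumes "e \<in> arcs G" "t \<in> {0<..<1}"
  obtains r where "0 < r" "sides_on K (\<gamma> e) (right_face e) (left_face e) (ball (\<gamma> e t) r)"
    "\<And>e'. e' \<in> arcs G \<Longrightarrow> e' \<noteq> e \<Longrightarrow> ball (\<gamma> e t) r \<inter> path_image (\<gamma> e') = {}"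
proof -
  from edge_neighbourhood[OF assms] obtain r where r: "0 < r"
    "\<And>e'. e' \<in> arcs G \<Longrightarrow> e' \<noteq> e \<Longrightarrow> ball (\<gamma> e t) r \<inter> path_image (\<gamma> e') = {}" by metis
  obtain U where U: "\<gamma> e t \<in> U" "sides_on K (\<gamma> e) (right_face e) (left_face e) U"
    using edge_sides[OF assms(1)] assms(2) unfolding arc_sides_def by blast
  then have "open (U \<inter> ball (\<gamma> e t) r)" "\<gamma> e t \<in> U \<inter> ball (\<gamma> e t) r" using r(1) by (auto simp: sides_on_def)
  then obtain s where s: "0 < s" "ball (\<gamma> e t) s \<subseteq> U \<inter> ball (\<gamma> e t) r"
    by (metis open_contains_ball)
  show thesis
  proof (rule that[OF s(1)])
    show "sides_on K (\<gamma> e) (right_face e) (left_face e) (ball (\<gamma> e t) s)"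
      using sides_on_subset[OF U(2)] s(2) by auto
  qed (use r(2) s(2) in blast)
qed

lemma edge_winding_continuous:
  assumes "e \<in> arcs G" "U \<inter> path_image (\<gamma> e) = {}"
  shows "continuous_on U (winding_number (\<gamma> e))"
  using assms arc_edge(1)[OF assms(1)]
  by (intro continuous_on_subset[OF continuous_on_winding_number] arc_imp_path) auto

lemma drawing_cases:
  assumes "z \<in> K"
  obtains v where "v \<in> verts G" "z = pos v" | e t where "e \<in> arcs G" "t \<in> {0<..<1}" "z = \<gamma> e t"
proof (cases "z \<in> pos ` verts G")
  case False
  then obtain e where "e \<in> arcs G" "z \<in> path_image (\<gamma> e)" using assms by (auto simp: drawing_def)
  then show thesis using False that(2) by (auto simp: path_image_edge)
qed (use that in auto)

lemma faces_dense: "- pos ` verts G \<subseteq> closure (- K)"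
proof
  fix z assume z: "z \<in> - pos ` verts G"
  show "z \<in> closure (- K)"
  proof (cases "z \<in> K")
    case True
    then obtain e t where e: "e \<in> arcs G" "t \<in> {0<..<1}" "z = \<gamma> e t"
      using z by (elim drawing_cases) auto
    from edge_point_sides[OF e(1,2)] obtain r where r: "0 < r"
      "sides_on K (\<gamma> e) (right_face e) (left_face e) (ball z r)" using e(3) by metis
    have "z \<in> closure (ball z r - K)" using sides_on_dense[OF r(2)] r(1) by auto
    then show ?thesis by (rule subsetD[OF closure_mono, rotated]) auto
  qed (use closure_subset in blast)
qed

section \<open>Functions on faces and their jumps across edges\<close>

abbreviation face :: "complex \<Rightarrow> complex set" where "face \<equiv> connected_component_set (- K)"

lemma face_component: "f \<in> components (- K) \<Longrightarrow> y \<in> f \<Longrightarrow> face y = f"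
  by (metis componentsE connected_component_eq)

lemma face_in_components: "y \<notin> K \<Longrightarrow> face y \<in> components (- K)"
  by (auto intro: componentsI)

text \<open>Crossing \<open>e\<close> from right to left lowers \<open>c\<close> by the coefficient
  of \<open>e\<close>, while the winding number of \<open>e\<close> gains 1. The two jumps cancel at
  inner points of edges, so only the vertices remain singular.\<close>

lemma winding_sum_extension:
  fixes c :: "complex set \<Rightarrow> complex"
  obtains W where "continuous_on (- pos ` verts G) W"
    "\<And>y. y \<notin> K \<Longrightarrow> W y = c (face y) + (\<Sum>e\<in>arcs G. (c (right_face e) - c (left_face e)) * winding_number (\<gamma> e) y)"
proof -
  define a where "a e = c (right_face e) - c (left_face e)" for e
  define F where "F y = c (face y) + (\<Sum>e\<in>arcs G. a e * winding_number (\<gamma> e) y)" for y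
  have "\<exists>U h. open U \<and> z \<in> U \<and> continuous_on U h \<and> (\<forall>y\<in>U \<inter> - K. F y = h y)" if z: "z \<in> - pos ` verts G" for z
  proof (cases "z \<in> K")
    case False
    then obtain r where r: "0 < r" "ball z r \<subseteq> - K"
      using closed_drawing by (metis ComplI open_Compl open_contains_ball)
    have "face y = face z" if "y \<in> ball z r" for y
    proof -
      have "connected_component (- K) z y"
        unfolding connected_component_def using r that by (intro exI[of _ "ball z r"]) auto
      then show ?thesis using connected_component_eq[of y "- K" z] by auto
    qed
    then have "\<forall>y\<in>ball z r \<inter> - K. F y = c (face z) + (\<Sum>e\<in>arcs G. a e * winding_number (\<gamma> e) y)"
      by (simp add: F_def)
    moreover have "continuous_on (ball z r) (\<lambda>y. c (face z) + (\<Sum>e\<in>arcs G. a e * winding_number (\<gamma> e) y))"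
      using r edge_in_drawing by (intro continuous_intros edge_winding_continuous) blast+
    ultimately show ?thesis
      using r(1) by (intro exI[of _ "ball z r"] exI[of _ "\<lambda>y. c (face z) + (\<Sum>e\<in>arcs G. a e * winding_number (\<gamma> e) y)"] conjI)
        simp_all
  next
    case True
    then obtain e t where e: "e \<in> arcs G" "t \<in> {0<..<1}" "z = \<gamma> e t"
      using z by (elim drawing_cases) auto
    from edge_point_sides[OF e(1,2)] obtain r where r: "0 < r"
      "sides_on K (\<gamma> e) (right_face e) (left_face e) (ball z r)"
      "\<And>e'. e' \<in> arcs G \<Longrightarrow> e' \<noteq> e \<Longrightarrow> ball z r \<inter> path_image (\<gamma> e') = {}" using e(3) by metis
    from r(2) obtain \<sigma> h where h0: "continuous_on (ball z r) h"
      "\<forall>y\<in>ball z r - K. winding_number (\<gamma> e) y = \<sigma> y + h y"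
      "\<forall>y\<in>ball z r - K. \<sigma> y = 0 \<and> y \<in> right_face e \<or> \<sigma> y = 1 \<and> y \<in> left_face e"
      by (rule sides_onE)
    \<comment> \<open>The formula for \<open>F\<close> with both jumps removed: the value of
      \<open>c\<close> on the right face, and of the winding number of \<open>e\<close> only its
      continuous part.\<close>
    define H where "H y = c (right_face e) + a e * h y + (\<Sum>e'\<in>arcs G - {e}. a e' * winding_number (\<gamma> e') y)" for y
    have "continuous_on (ball z r) H"
      unfolding H_def using h0(1) r(3) by (intro continuous_intros edge_winding_continuous) auto
    moreover have "F y = H y" if y: "y \<in> ball z r \<inter> - K" for y
    proof -
      have "(\<Sum>e'\<in>arcs G. a e' * winding_number (\<gamma> e') y) =
        a e * (\<sigma> y + h y) + (\<Sum>e'\<in>arcs G - {e}. a e' * winding_number (\<gamma> e') y)"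
        using e(1) y h0(2) by (subst sum.remove[of _ e]) auto
      moreover have "c (face y) = c (right_face e) - a e * \<sigma> y"
      proof -
        have "\<sigma> y = 0 \<and> y \<in> right_face e \<or> \<sigma> y = 1 \<and> y \<in> left_face e" using h0(3) y by blast
        then show ?thesis using faces_of_edge[OF e(1)] by (auto simp: a_def face_component)
      qed
      ultimately show ?thesis by (simp add: F_def H_def algebra_simps)
    qed
    ultimately show ?thesis
      using r(1) by (intro exI[of _ "ball z r"] exI[of _ H] conjI) simp_all
  qed
  moreover have "- K \<subseteq> - pos ` verts G" using pos_in_drawing by auto
  ultimately obtain W where "continuous_on (- pos ` verts G) W" "\<And>y. y \<in> - K \<Longrightarrow> W y = F y"
    using continuous_extension_local[OF _ faces_dense] by metis
  then show thesis using that[of W] by (auto simp: F_def a_def)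
qed

lemma finite_complement_connected: "connected (- pos ` verts G)"
proof -
  have "connected (UNIV - pos ` verts G)"
    by (rule connected_open_delete_finite) auto
  then show ?thesis by (simp add: Compl_eq_Diff_UNIV)
qed

text \<open>Without jumps the winding numbers drop out of \<open>winding_sum_extension\<close>.
  Applied to the indicator \<open>b\<close> of one value of \<open>c\<close>, it gives a continuous
  integer-valued function on the connected complement of the vertices; the indicator also admits
  values of arbitrary type.\<close>

lemma face_function_constant:
  assumes eq: "\<And>e. e \<in> arcs G \<Longrightarrow> c (right_face e) = c (left_face e)"
    and f: "f \<in> components (- K)" "f' \<in> components (- K)"
  shows "c f = c f'"
proof -
  define b where "b g = (of_bool (c g = c f) :: complex)" for g
  obtain W where W: "continuous_on (- pos ` verts G) W" "\<And>y. y \<notin> K \<Longrightarrow> W y = b (face y)"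
    using winding_sum_extension[of b] eq by (auto simp: b_def)
  have "W constant_on - pos ` verts G"
  proof (rule integer_valued_constant_on[OF finite_complement_connected W(1) _ faces_dense])
    show "W y \<in> \<int>" if "y \<in> - K" for y using W(2) that by (auto simp: b_def)
  qed (use pos_in_drawing in auto)
  then obtain k where k: "\<And>y. y \<notin> K \<Longrightarrow> W y = k"
    using pos_in_drawing unfolding constant_on_def by blast
  obtain y y' where y: "y \<in> f" "y' \<in> f'" using f[THEN in_components_nonempty] by blast
  then have "y \<notin> K" "y' \<notin> K" using f in_components_subset by blast+
  then have "b f = b f'" using k W(2) face_component f y by metis
  then show ?thesis by (auto simp: b_def split: if_splits)
qed

text \<open>The exponential of the winding number of an open path depends only on its endpoints.
  Integer weights turn into integer powers, so the choice of the logarithms \<open>l v\<close> is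
  immaterial.\<close>

lemma exp_winding_sum:
  fixes z :: "'e \<Rightarrow> int"
  assumes y: "y \<notin> K" and l: "\<And>v. v \<in> verts G \<Longrightarrow> exp (l v) = pos v - y"
  shows "exp (2 * of_real pi * \<i> * (\<Sum>e\<in>arcs G. of_int (z e) * winding_number (\<gamma> e) y)) =
    exp (\<Sum>e\<in>arcs G. of_int (z e) * (l (head G e) - l (tail G e)))"
proof -
  have "exp (2 * of_real pi * \<i> * winding_number (\<gamma> e) y) = exp (l (head G e) - l (tail G e))" if e: "e \<in> arcs G" for e
  proof -
    have "y \<notin> path_image (\<gamma> e)" using y edge_in_drawing[OF e] by auto
    from winding_number_exp_2pi[OF arc_imp_path[OF arc_edge(1)[OF e]] this]
    have "exp (l (head G e)) = exp (2 * of_real pi * \<i> * winding_number (\<gamma> e) y) * exp (l (tail G e))"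
      using e by (simp add: arc_edge(2,3) l)
    then show ?thesis by (simp add: exp_diff field_simps)
  qed
  then have "exp (2 * of_real pi * \<i> * winding_number (\<gamma> e) y) powi z e = exp (l (head G e) - l (tail G e)) powi z e"
    if "e \<in> arcs G" for e using that by simp
  then show ?thesis
    by (simp add: sum_distrib_left exp_sum exp_power_int mult.left_commute cong: prod.cong)
qed

text \<open>The exponential of \<open>2 pi i W\<close> is the rational function \<open>P\<close>,
  whose order at \<open>pos v0\<close> is the sum in question. Since \<open>W\<close> is
  single-valued near that vertex, \<open>P\<close> has a continuous logarithm along a small circle
  about it, so the order is 0.\<close>

lemma face_boundary_cycle:
  fixes c :: "complex set \<Rightarrow> int"
  assumes v0: "v0 \<in> verts G"
  shows "(\<Sum>e\<in>arcs G. (c (right_face e) - c (left_face e)) * incidence e v0) = 0"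
proof -
  define z where "z e = c (right_face e) - c (left_face e)" for e
  let ?V = "pos ` verts G"
  obtain W where W: "continuous_on (- ?V) W"
    "\<And>y. y \<notin> K \<Longrightarrow> W y = of_int (c (face y)) + (\<Sum>e\<in>arcs G. of_int (z e) * winding_number (\<gamma> e) y)"
    using winding_sum_extension[of "\<lambda>f. of_int (c f)"] by (auto simp: z_def)
  define P where "P y = (\<Prod>e\<in>arcs G. ((pos (head G e) - y) / (pos (tail G e) - y)) powi z e)" for y
  have P_exp: "P y = exp (\<Sum>e\<in>arcs G. of_int (z e) * (l (head G e) - l (tail G e)))"
    if "\<And>v. v \<in> verts G \<Longrightarrow> exp (l v) = pos v - y" for l y
  proof -
    have "(pos (head G e) - y) / (pos (tail G e) - y) = exp (l (head G e) - l (tail G e))" if "e \<in> arcs G" for e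
      using that \<open>\<And>v. v \<in> verts G \<Longrightarrow> exp (l v) = pos v - y\<close> by (simp add: exp_diff)
    then show ?thesis by (simp add: P_def exp_sum exp_power_int cong: prod.cong)
  qed
  \<comment> \<open>Off the drawing the integer \<open>c (face y)\<close> disappears under the
    exponential and the winding numbers give \<open>P\<close>; continuity and density carry the
    identity over to the edges.\<close>
  have WP: "exp (2 * of_real pi * \<i> * W y) - P y \<in> {0}" if "y \<in> - ?V" for y
  proof (rule dense_closed_preimage[OF _ _ _ faces_dense, of "\<lambda>y. exp (2 * of_real pi * \<i> * W y) - P y"])
    show "continuous_on (- ?V) (\<lambda>y. exp (2 * of_real pi * \<i> * W y) - P y)"
      unfolding P_def by (intro continuous_intros W(1)) auto
    fix y assume y: "y \<in> - K"
    then have nz: "pos v - y \<noteq> 0" if "v \<in> verts G" for v using pos_in_drawing[OF that] by auto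
    let ?l = "\<lambda>v. Ln (pos v - y)"
    have "exp (2 * of_real pi * \<i> * W y) = exp (2 * of_real pi * \<i> * of_int (c (face y))) *
      exp (2 * of_real pi * \<i> * (\<Sum>e\<in>arcs G. of_int (z e) * winding_number (\<gamma> e) y))"
      using W(2)[of y] y by (simp add: exp_add[symmetric] algebra_simps)
    also have "exp (2 * of_real pi * \<i> * of_int (c (face y))) = 1"
      by (auto simp: exp_eq_1)
    also have "exp (2 * of_real pi * \<i> * (\<Sum>e\<in>arcs G. of_int (z e) * winding_number (\<gamma> e) y)) = P y"
      using y nz by (subst exp_winding_sum[where l = ?l], simp_all, subst P_exp[where l = ?l]) auto
    finally show "exp (2 * of_real pi * \<i> * W y) - P y \<in> {0}" by simp
  qed (use that pos_in_drawing in auto)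
  define x0 where "x0 = pos v0"
  have "finite (?V - {x0})" by simp
  then have "open (- (?V - {x0}))" by (intro open_Compl finite_imp_closed)
  then obtain r where r: "0 < r" "ball x0 r \<subseteq> - (?V - {x0})"
    by (metis (no_types, lifting) ComplI Diff_iff insertI1 open_contains_ball)
  have pos_eq: "v = v0" if "v \<in> verts G" "pos v \<in> ball x0 r" for v
  proof -
    have "pos v = pos v0" using r(2) that by (auto simp: x0_def)
    then show ?thesis using emb that(1) v0 by (auto simp: plane_embedding_def dest: inj_onD)
  qed
  have "\<exists>l. continuous_on (ball x0 r) l \<and> (\<forall>y\<in>ball x0 r. pos v - y = exp (l y))"
    if v: "v \<in> verts G" "v \<noteq> v0" for v
  proof -
    have nz: "pos v - y \<noteq> 0" if "y \<in> ball x0 r" for y using pos_eq[OF v(1)] v(2) that by auto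
    have "continuous_on (ball x0 r) (\<lambda>y. pos v - y)" by (intro continuous_intros)
    from continuous_logarithm_on_ball[OF this nz] obtain l where "continuous_on (ball x0 r) l"
      "\<And>y. y \<in> ball x0 r \<Longrightarrow> pos v - y = exp (l y)" by blast
    then show ?thesis by (intro exI[of _ l] conjI ballI)
  qed
  then obtain l where l: "\<And>v. v \<in> verts G \<Longrightarrow> v \<noteq> v0 \<Longrightarrow> continuous_on (ball x0 r) (l v)"
    "\<And>v y. v \<in> verts G \<Longrightarrow> v \<noteq> v0 \<Longrightarrow> y \<in> ball x0 r \<Longrightarrow> pos v - y = exp (l v y)"
    by metis
  \<comment> \<open>The test point \<open>x0 - w t\<close> runs once around the vertex at radius
    \<open>r / 2\<close>, inside the ball that contains no other vertex.\<close>
  define w where "w t = of_real (r / 2) * exp (2 * of_real pi * \<i> * of_real t)" for t :: real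
  have nw: "norm (w t) = r / 2" for t
    using r(1) by (simp add: w_def norm_mult)
  have wB: "x0 - w t \<in> ball x0 r" for t using nw[of t] r(1) by (simp add: dist_norm)
  have wV: "x0 - w t \<in> - ?V" for t
  proof -
    have "w t \<noteq> 0" using nw[of t] r(1) by auto
    moreover have "x0 - w t \<in> insert x0 (- ?V)" using r(2) wB[of t] by blast
    ultimately show ?thesis by simp
  qed
  \<comment> \<open>At \<open>v0\<close> the difference to the test point is \<open>w t\<close>,
    whose logarithm is explicit and gains \<open>2 pi i\<close> in one turn. At every other vertex a
    logarithm on the whole ball exists and returns to its initial value.\<close>
  define lg where "lg v t = (if v = v0 then of_real (ln (r / 2)) + 2 * of_real pi * \<i> * of_real t else l v (x0 - w t))"
    for v and t :: real
  have cw: "continuous_on {0..1} (\<lambda>t. x0 - w t)" unfolding w_def by (intro continuous_intros)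
  have lg_exp: "exp (lg v t) = pos v - (x0 - w t)" if "v \<in> verts G" for v t
  proof (cases "v = v0")
    case True
    have "exp (of_real (ln (r / 2)) :: complex) = of_real (r / 2)"
      using r(1) by (simp add: exp_of_real)
    then show ?thesis using True by (simp add: lg_def w_def x0_def exp_add)
  qed (use that wB l(2) in \<open>simp add: lg_def\<close>)
  have lg_cont: "continuous_on {0..1} (lg v)" if "v \<in> verts G" for v
  proof (cases "v = v0")
    case True
    then have "lg v = (\<lambda>t. of_real (ln (r / 2)) + 2 * of_real pi * \<i> * of_real t)" by (auto simp: lg_def)
    then show ?thesis by (simp only:) (intro continuous_intros)
  next
    case False
    then have "lg v = (\<lambda>t. l v (x0 - w t))" by (auto simp: lg_def)
    then show ?thesis
      using continuous_on_compose2[OF l(1)[OF that False] cw image_subsetI[OF wB]] by simp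
  qed
  \<comment> \<open>Both terms come from logarithms of \<open>P\<close> along the circle, so
    \<open>Q\<close> is integer-valued; being continuous it is constant, and comparing
    \<open>t = 0\<close> with \<open>t = 1\<close> isolates the contribution of
    \<open>v0\<close>.\<close>
  define Q where "Q t = W (x0 - w t) -
    (\<Sum>e\<in>arcs G. of_int (z e) * (lg (head G e) t - lg (tail G e) t)) / (2 * of_real pi * \<i>)" for t
  have "Q constant_on {0..1}"
  proof (rule integer_valued_constant_on[where D = "{0..1}"])
    show "continuous_on {0..1} Q"
      unfolding Q_def
      by (intro continuous_intros continuous_on_compose2[OF W(1) cw] lg_cont) (use wV in auto)
    fix t :: real
    have "exp (2 * of_real pi * \<i> * W (x0 - w t)) = exp (\<Sum>e\<in>arcs G. of_int (z e) * (lg (head G e) t - lg (tail G e) t))"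
      using WP[OF wV] P_exp[of "\<lambda>v. lg v t" "x0 - w t"] lg_exp by simp
    then have "exp (2 * of_real pi * \<i> * Q t) = 1"
      by (simp add: Q_def right_diff_distrib exp_diff)
    then show "Q t \<in> \<int>"
      by (auto simp: exp_eq_1 complex_is_Int_iff)
  qed auto
  then have "Q 0 = Q 1" unfolding constant_on_def by (metis atLeastAtMost_iff order_refl zero_le_one)
  moreover have "w 0 = w 1" by (simp add: w_def)
  ultimately have "(\<Sum>e\<in>arcs G. of_int (z e) * (lg (head G e) 0 - lg (tail G e) 0)) =
     (\<Sum>e\<in>arcs G. of_int (z e) * (lg (head G e) 1 - lg (tail G e) 1))"
    by (simp add: Q_def)
  then have "(\<Sum>e\<in>arcs G. of_int (z e) * ((lg (head G e) 1 - lg (head G e) 0) - (lg (tail G e) 1 - lg (tail G e) 0))) = 0"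
    by (simp add: right_diff_distrib sum_subtractf algebra_simps)
  moreover have "lg v 1 - lg v 0 = (if v = v0 then 2 * of_real pi * \<i> else 0)" for v
    using \<open>w 0 = w 1\<close> by (simp add: lg_def)
  ultimately have "(\<Sum>e\<in>arcs G. of_int (z e) * ((if head G e = v0 then 2 * of_real pi * \<i> else 0) -
      (if tail G e = v0 then 2 * of_real pi * \<i> else 0))) = (0::complex)" by simp
  also have "(\<Sum>e\<in>arcs G. of_int (z e) * ((if head G e = v0 then 2 * of_real pi * \<i> else 0) -
      (if tail G e = v0 then 2 * of_real pi * \<i> else 0))) =
      2 * of_real pi * \<i> * of_int (\<Sum>e\<in>arcs G. z e * incidence e v0)"
    by (auto simp: sum_distrib_left incidence_def intro!: sum.cong)
  finally show ?thesis by (simp add: z_def flip: of_int_sum of_int_mult of_int_diff)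
qed

text \<open>The logarithms of \<open>pos v - y\<close> form a potential on the vertices, and a cycle
  is orthogonal to its coboundary; the exponential is therefore 1.\<close>

lemma cycle_winding_sum_Ints:
  fixes z :: "'e \<Rightarrow> int"
  assumes z: "\<And>v. v \<in> verts G \<Longrightarrow> (\<Sum>e\<in>arcs G. z e * incidence e v) = 0" and y: "y \<notin> K"
  shows "(\<Sum>e\<in>arcs G. of_int (z e) * winding_number (\<gamma> e) y) \<in> \<int>"
proof -
  have nz: "pos v - y \<noteq> 0" if "v \<in> verts G" for v using pos_in_drawing[OF that] y by auto
  have "exp (2 * of_real pi * \<i> * (\<Sum>e\<in>arcs G. of_int (z e) * winding_number (\<gamma> e) y)) = 1"
    using y nz cycle_sum_eq_0[OF z, of "\<lambda>v. Ln (pos v - y)"]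
    by (subst exp_winding_sum[where l = "\<lambda>v. Ln (pos v - y)"]) simp_all
  then show ?thesis by (auto simp: exp_eq_1 complex_is_Int_iff)
qed

text \<open>The weight of a face is the winding number of the cycle about any of its points. The
  order left minus right reflects that winding numbers grow from right to left.\<close>

lemma cycle_as_face_boundaries:
  fixes z :: "'e \<Rightarrow> int"
  assumes z: "\<And>v. v \<in> verts G \<Longrightarrow> (\<Sum>e\<in>arcs G. z e * incidence e v) = 0"
  obtains w :: "complex set \<Rightarrow> int" where
    "\<And>f. f \<in> components (- K) \<Longrightarrow> \<not> bounded f \<Longrightarrow> w f = 0"
    "\<And>e. e \<in> arcs G \<Longrightarrow> z e = w (left_face e) - w (right_face e)"
proof -
  define W where "W y = (\<Sum>e\<in>arcs G. of_int (z e) * winding_number (\<gamma> e) y)" for y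
  have W_int: "W y \<in> \<int>" if "y \<notin> K" for y
    unfolding W_def using z that by (rule cycle_winding_sum_Ints)
  have "\<exists>n. \<forall>y\<in>f. W y = of_int n" if f: "f \<in> components (- K)" for f
  proof -
    have fK: "f \<subseteq> - K" using in_components_subset[OF f] .
    have "W constant_on f"
    proof (rule integer_valued_constant_on[where D = f])
      show "continuous_on f W"
        unfolding W_def using fK edge_in_drawing by (intro continuous_intros edge_winding_continuous) blast+
    qed (use in_components_connected[OF f] closure_subset W_int fK in auto)
    then obtain k where k: "\<And>y. y \<in> f \<Longrightarrow> W y = k" unfolding constant_on_def by blast
    obtain y where "y \<in> f" using in_components_nonempty[OF f] by blast
    then have "k \<in> \<int>" using W_int[of y] k fK by auto
    then show ?thesis using k by (auto elim: Ints_cases)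
  qed
  then obtain w :: "complex set \<Rightarrow> int" where w: "\<And>f y. f \<in> components (- K) \<Longrightarrow> y \<in> f \<Longrightarrow> W y = of_int (w f)"
    by metis
  show thesis
  proof (rule that[of w])
    fix f assume f: "f \<in> components (- K)" "\<not> bounded f"
    \<comment> \<open>An unbounded face has a point \<open>y\<close> outside a ball containing the
      drawing. On that ball \<open>x - y\<close> has a logarithm, so the weighted winding numbers
      cancel along the cycle.\<close>
    obtain B where B: "K \<subseteq> ball 0 B"
      using bounded_subset_ballD[OF compact_imp_bounded[OF compact_drawing]] by blast
    obtain y where y: "y \<in> f" "y \<notin> ball 0 B"
      using f(2) bounded_subset[OF bounded_ball] by blast
    have nz: "x - y \<noteq> 0" if "x \<in> ball 0 B" for x using that y(2) by auto
    have "continuous_on (ball 0 B) (\<lambda>x. x - y)" by (intro continuous_intros)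
    from continuous_logarithm_on_ball[OF this nz]
    obtain l where l: "continuous_on (ball 0 B) l" "\<And>x. x \<in> ball 0 B \<Longrightarrow> x - y = exp (l x)" by blast
    have "winding_number (\<gamma> e) y = (l (pos (head G e)) - l (pos (tail G e))) / (2 * of_real pi * \<i>)"
      if "e \<in> arcs G" for e
      using winding_number_log_diff[OF arc_imp_path[OF arc_edge(1)[OF that]] _ l] edge_in_drawing[OF that] B
      by (auto simp: arc_edge(2,3)[OF that])
    then have "W y = (\<Sum>e\<in>arcs G. of_int (z e) * (l (pos (head G e)) - l (pos (tail G e)))) / (2 * of_real pi * \<i>)"
      by (simp add: W_def sum_divide_distrib)
    also have "\<dots> = 0"
      using cycle_sum_eq_0[OF z, of "\<lambda>v. l (pos v)"] by simp
    finally show "w f = 0" using w[OF f(1) y(1)] by simp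
  next
    fix e assume e: "e \<in> arcs G"
    define p where "p = \<gamma> e (1/2)"
    have half: "1/2 \<in> {0<..<1::real}" by simp
    from edge_point_sides[OF e half] obtain r where r: "0 < r"
      "sides_on K (\<gamma> e) (right_face e) (left_face e) (ball p r)"
      "\<And>e'. e' \<in> arcs G \<Longrightarrow> e' \<noteq> e \<Longrightarrow> ball p r \<inter> path_image (\<gamma> e') = {}" unfolding p_def by metis
    from r(2) obtain \<sigma> h where h0: "continuous_on (ball p r) h"
      "\<forall>y\<in>ball p r - K. winding_number (\<gamma> e) y = \<sigma> y + h y"
      "\<forall>y\<in>ball p r - K. \<sigma> y = 0 \<and> y \<in> right_face e \<or> \<sigma> y = 1 \<and> y \<in> left_face e"
      "\<forall>x\<in>ball p r \<inter> K. x \<in> closure {y \<in> ball p r - K. \<sigma> y = 0}"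
      "\<forall>x\<in>ball p r \<inter> K. x \<in> closure {y \<in> ball p r - K. \<sigma> y = 1}"
      by (rule sides_onE)
    note h = h0(1) h0(2-5)[rule_format]
    \<comment> \<open>Everything in \<open>W\<close> that is continuous near \<open>p\<close>; it
      differs from \<open>W\<close> by a multiple of \<open>z e\<close>, so it is integral there and
      hence constant.\<close>
    define H where "H y = of_int (z e) * h y + (\<Sum>e'\<in>arcs G - {e}. of_int (z e') * winding_number (\<gamma> e') y)" for y
    have WH: "W y = of_int (z e) * \<sigma> y + H y" if "y \<in> ball p r - K" for y
      unfolding W_def H_def using h(2)[OF that] e by (subst sum.remove[of _ e]) (auto simp: algebra_simps)
    have "H constant_on ball p r"
    proof (rule integer_valued_constant_on[OF connected_ball _ _ sides_on_dense[OF r(2)]])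
      show "continuous_on (ball p r) H"
        unfolding H_def using h(1) r(3) by (intro continuous_intros edge_winding_continuous) auto
      fix y assume y: "y \<in> ball p r - K"
      have "of_int (z e) * \<sigma> y \<in> \<int>" using h(3)[OF y] by auto
      then show "H y \<in> \<int>" using WH[OF y] W_int[of y] y by (metis DiffD2 Ints_diff add_diff_cancel_left')
    qed auto
    then obtain k where k: "\<And>y. y \<in> ball p r \<Longrightarrow> H y = k" unfolding constant_on_def by blast
    have "p \<in> ball p r \<inter> K" using r(1) edge_in_drawing[OF e] half unfolding p_def path_image_def by auto
    note cl = h(4)[OF this] h(5)[OF this]
    obtain y0 where y0: "y0 \<in> ball p r - K" "\<sigma> y0 = 0" using closure_memD[OF cl(1)] by blast
    obtain y1 where y1: "y1 \<in> ball p r - K" "\<sigma> y1 = 1" using closure_memD[OF cl(2)] by blast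
    have "y0 \<in> right_face e" "y1 \<in> left_face e" using h(3)[OF y0(1)] h(3)[OF y1(1)] y0(2) y1(2) by auto
    then have "W y0 = of_int (w (right_face e))" "W y1 = of_int (w (left_face e))"
      using w faces_of_edge[OF e] by auto
    then have "of_int (z e + w (right_face e)) = (of_int (w (left_face e)) :: complex)"
      using WH[OF y0(1)] WH[OF y1(1)] k y0 y1 by auto
    then show "z e = w (left_face e) - w (right_face e)" by (simp only: of_int_eq_iff)
  qed
qed

lemma unbounded_face_exists:
  obtains f where "f \<in> components (- K)" "\<not> bounded f"
proof -
  obtain y where "y \<in> - K" "\<not> bounded (face y)"
    using cobounded_unbounded_component[of "- K"] compact_imp_bounded[OF compact_drawing] by auto
  then show thesis using that[of "face y"] face_in_components by auto
qed

end

section \<open>Cycles and coboundaries\<close>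

text \<open>Gram-Schmidt: the induction hypothesis is applied to \<open>u\<close> and also to the
  new vector \<open>s j\<close>, whose orthogonal part \<open>v\<close> is then projected out of the
  remainder of \<open>u\<close>.\<close>

lemma orthogonal_decomposition:
  fixes s :: "'i \<Rightarrow> 'e \<Rightarrow> rat"
  assumes "finite I" "finite A"
  shows "\<exists>a z. (\<forall>e\<in>A. u e = (\<Sum>i\<in>I. a i * s i e) + z e) \<and> (\<forall>i\<in>I. (\<Sum>e\<in>A. z e * s i e) = 0)"
  using assms(1)
proof (induction I arbitrary: u)
  case empty
  then show ?case by auto
next
  case (insert j I)
  obtain a v where v: "\<And>e. e \<in> A \<Longrightarrow> s j e = (\<Sum>i\<in>I. a i * s i e) + v e"
    "\<And>i. i \<in> I \<Longrightarrow> (\<Sum>e\<in>A. v e * s i e) = 0"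
    using insert.IH[of "s j"] by blast
  obtain b z where z: "\<And>e. e \<in> A \<Longrightarrow> u e = (\<Sum>i\<in>I. b i * s i e) + z e"
    "\<And>i. i \<in> I \<Longrightarrow> (\<Sum>e\<in>A. z e * s i e) = 0"
    using insert.IH[of u] by blast
  define q where "q = (\<Sum>e\<in>A. v e * v e)"
  \<comment> \<open>If \<open>q = 0\<close>, then \<open>v\<close> vanishes on \<open>A\<close> and
    division by zero yields \<open>c = 0\<close>, so that nothing is projected out.\<close>
  define c where "c = (\<Sum>e\<in>A. z e * v e) / q"
  define y where "y e = z e - c * v e" for e
  have yv: "(\<Sum>e\<in>A. y e * v e) = 0"
  proof (cases "q = 0")
    case True
    then have "v e = 0" if "e \<in> A" for e
      using that assms(2) by (simp add: q_def sum_nonneg_eq_0_iff)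
    then show ?thesis by simp
  next
    case False
    have "(\<Sum>e\<in>A. y e * v e) = (\<Sum>e\<in>A. z e * v e) - c * q"
      by (simp add: y_def q_def left_diff_distrib sum_subtractf sum_distrib_left mult.assoc)
    then show ?thesis using False by (simp add: c_def)
  qed
  have ys: "(\<Sum>e\<in>A. y e * s i e) = 0" if "i \<in> I" for i
  proof -
    have "(\<Sum>e\<in>A. y e * s i e) = (\<Sum>e\<in>A. z e * s i e) - c * (\<Sum>e\<in>A. v e * s i e)"
      by (simp add: y_def left_diff_distrib sum_subtractf sum_distrib_left mult.assoc)
    then show ?thesis using v(2) z(2) that by simp
  qed
  have "(\<Sum>e\<in>A. y e * s j e) = (\<Sum>e\<in>A. \<Sum>i\<in>I. a i * (y e * s i e)) + (\<Sum>e\<in>A. y e * v e)"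
    by (simp add: v(1) distrib_left sum.distrib sum_distrib_left mult.left_commute cong: sum.cong)
  also have "(\<Sum>e\<in>A. \<Sum>i\<in>I. a i * (y e * s i e)) = (\<Sum>i\<in>I. a i * (\<Sum>e\<in>A. y e * s i e))"
    by (subst sum.swap) (simp add: sum_distrib_left)
  finally have yj: "(\<Sum>e\<in>A. y e * s j e) = 0" using ys yv by simp
  \<comment> \<open>Obtained by substituting \<open>z = y + c * v\<close> and solving the
    decomposition of \<open>s j\<close> for \<open>v\<close>.\<close>
  define d where "d i = (if i = j then c else b i - c * a i)" for i
  have "u e = (\<Sum>i\<in>insert j I. d i * s i e) + y e" if "e \<in> A" for e
  proof -
    have "(\<Sum>i\<in>I. d i * s i e) = (\<Sum>i\<in>I. b i * s i e) - c * (\<Sum>i\<in>I. a i * s i e)"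
      unfolding sum_distrib_left sum_subtractf[symmetric]
      using insert.hyps(2) by (intro sum.cong) (auto simp: d_def algebra_simps)
    then have "(\<Sum>i\<in>insert j I. d i * s i e) = c * s j e + (\<Sum>i\<in>I. b i * s i e) - c * (\<Sum>i\<in>I. a i * s i e)"
      using insert.hyps by (simp add: d_def)
    then show ?thesis using v(1)[OF that] z(1)[OF that] by (simp add: y_def algebra_simps)
  qed
  with ys yj show ?case by blast
qed

lemma common_denominator:
  fixes z :: "'e \<Rightarrow> rat"
  assumes "finite A"
  shows "\<exists>N>0. \<exists>n :: 'e \<Rightarrow> int. \<forall>e\<in>A. of_int N * z e = of_int (n e)"
proof -
  define den where "den e = snd (quotient_of (z e))" for e
  define N where "N = (\<Prod>e\<in>A. den e)"
  have den: "den e > 0" for e by (simp add: den_def quotient_of_denom_pos')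
  define n where "n e = (\<Prod>e'\<in>A - {e}. den e') * fst (quotient_of (z e))" for e
  have "of_int N * z e = of_int (n e)" if "e \<in> A" for e
  proof -
    have "z e = of_int (fst (quotient_of (z e))) / of_int (den e)"
      unfolding den_def by (rule quotient_of_div) simp
    then have "of_int (den e) * z e = of_int (fst (quotient_of (z e)))"
      using den[of e] by (simp add: field_simps)
    moreover have "N = (\<Prod>e'\<in>A - {e}. den e') * den e"
      unfolding N_def using that assms by (simp add: prod.remove mult.commute)
    ultimately show ?thesis by (simp add: n_def mult.assoc)
  qed
  moreover have "N > 0" unfolding N_def using den by (intro prod_pos) auto
  ultimately have "N > 0 \<and> (\<forall>e\<in>A. of_int N * z e = of_int (n e))" by simp
  then show ?thesis by blast
qed

text \<open>Characteristic 0 makes \<open>'k\<close> a vector space over its prime field, where the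
  functional sending \<open>a\<close> to 1 extends from the line through \<open>a\<close>.\<close>

lemma additive_functional_to_rat:
  fixes a :: "'k::field_char_0"
  assumes "a \<noteq> 0"
  obtains l :: "'k \<Rightarrow> rat" where "\<And>x y. l (x + y) = l x + l y" "l a \<noteq> 0"
proof -
  interpret vector_space_pair "\<lambda>(q::rat) (x::'k). of_rat q * x" "(*) :: rat \<Rightarrow> rat \<Rightarrow> rat"
    by unfold_locales (auto simp: algebra_simps of_rat_add of_rat_mult)
  have "vs1.independent {a}" using assms by (simp add: vs1.dependent_single)
  from linear_independent_extend[OF this, of "\<lambda>_. 1"]
  obtain l where l: "Vector_Spaces.linear (\<lambda>(q::rat) (x::'k). of_rat q * x) ((*) :: rat \<Rightarrow> rat \<Rightarrow> rat) l" "l a = 1"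
    by blast
  show thesis
    by (rule that[of l]) (use l linear_add in auto)
qed

section \<open>Face boundaries modulo coboundaries\<close>

context plane_quiver
begin

text \<open>Linear in \<open>d\<close>, so the integer result for the indicator of a single face
  suffices. Restricting to the faces that border an edge keeps the sum finite.\<close>

lemma rational_face_boundary_cycle:
  fixes d :: "complex set \<Rightarrow> rat"
  assumes v: "v \<in> verts G"
  shows "(\<Sum>e\<in>arcs G. (d (right_face e) - d (left_face e)) * of_int (incidence e v)) = 0"
proof -
  define F where "F = right_face ` arcs G \<union> left_face ` arcs G"
  have fin: "finite F" by (simp add: F_def)
  have "d (right_face e) - d (left_face e) =
      (\<Sum>f\<in>F. d f * of_int (of_bool (right_face e = f) - of_bool (left_face e = f)))" if "e \<in> arcs G" for e
  proof -
    have "(\<Sum>f\<in>F. d f * of_int (of_bool (right_face e = f) - of_bool (left_face e = f))) =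
        (\<Sum>f\<in>F. if f = right_face e then d f else 0) - (\<Sum>f\<in>F. if f = left_face e then d f else 0)"
      unfolding sum_subtractf[symmetric] by (intro sum.cong) auto
    then show ?thesis using that fin by (simp add: F_def)
  qed
  then have "(\<Sum>e\<in>arcs G. (d (right_face e) - d (left_face e)) * of_int (incidence e v)) =
    (\<Sum>e\<in>arcs G. \<Sum>f\<in>F. d f * of_int ((of_bool (right_face e = f) - of_bool (left_face e = f)) * incidence e v))"
    by (intro sum.cong) (auto simp: sum_distrib_right mult.assoc)
  also have "\<dots> = (\<Sum>f\<in>F. d f * of_int (\<Sum>e\<in>arcs G. (of_bool (right_face e = f) - of_bool (left_face e = f)) * incidence e v))"
    by (subst sum.swap) (simp add: sum_distrib_left)
  also have "\<dots> = 0"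
    using face_boundary_cycle[OF v, of "\<lambda>f'. of_bool (f' = f)" for f] by simp
  finally show ?thesis .
qed

text \<open>A vector that is both a cycle and a coboundary is orthogonal to itself, hence zero. Then
  \<open>d\<close> has no jumps and equals its value 0 on an unbounded face.\<close>

lemma rational_face_boundary_independent:
  fixes d :: "complex set \<Rightarrow> rat"
  assumes unb: "\<And>f. f \<in> components (- K) \<Longrightarrow> \<not> bounded f \<Longrightarrow> d f = 0"
    and eq: "\<And>e. e \<in> arcs G \<Longrightarrow> d (right_face e) - d (left_face e) = \<psi> (tail G e) - \<psi> (head G e)"
    and f: "f \<in> components (- K)"
  shows "d f = 0"
proof -
  let ?x = "\<lambda>e. d (right_face e) - d (left_face e)"
  have "(\<Sum>e\<in>arcs G. ?x e * ?x e) = - (\<Sum>e\<in>arcs G. ?x e * (\<psi> (head G e) - \<psi> (tail G e)))"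
    unfolding sum_negf[symmetric] by (intro sum.cong) (simp_all add: eq, simp add: algebra_simps)
  also have "\<dots> = 0"
    by (simp add: sum_incidence[of ?x \<psi>] rational_face_boundary_cycle)
  finally have "?x e = 0" if "e \<in> arcs G" for e
    using that by (simp add: sum_nonneg_eq_0_iff)
  then have "d (right_face e) = d (left_face e)" if "e \<in> arcs G" for e using that by simp
  from face_function_constant[OF this f] unb unbounded_face_exists show ?thesis by metis
qed

text \<open>An additive map to the rationals respects every difference in the hypotheses and can be
  chosen not to kill a given nonzero \<open>c f\<close>.\<close>

lemma face_boundary_independent:
  fixes c :: "complex set \<Rightarrow> 'k::field_char_0"
  assumes unb: "\<And>f. f \<in> components (- K) \<Longrightarrow> \<not> bounded f \<Longrightarrow> c f = 0"
    and eq: "\<And>e. e \<in> arcs G \<Longrightarrow> c (right_face e) - c (left_face e) = \<phi> (tail G e) - \<phi> (head G e)"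
    and f: "f \<in> components (- K)"
  shows "c f = 0"
proof (rule ccontr)
  assume "c f \<noteq> 0"
  then obtain l :: "'k \<Rightarrow> rat" where l: "\<And>x y. l (x + y) = l x + l y" "l (c f) \<noteq> 0"
    by (metis additive_functional_to_rat)
  have l0: "l 0 = 0" using l(1)[of 0 0] by simp
  have l_diff: "l (x - y) = l x - l y" for x y using l(1)[of "x - y" y] by simp
  have "l (c f) = 0"
  proof (rule rational_face_boundary_independent[where \<psi> = "\<lambda>v. l (\<phi> v)"])
    show "l (c (right_face e)) - l (c (left_face e)) = l (\<phi> (tail G e)) - l (\<phi> (head G e))" if "e \<in> arcs G" for e
      using eq[OF that] by (simp flip: l_diff)
  qed (use unb l0 f in auto)
  with l(2) show False by simp
qed

text \<open>A unit vector is rational, so it splits orthogonally into a coboundary and a cycle over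
  the rationals. The cycle is multiplied by \<open>N\<close> to become integral, where winding
  numbers apply, and the result is divided by \<open>N\<close> in \<open>'k\<close>.\<close>

lemma unit_vector_decomposition:
  assumes p: "p \<in> arcs G"
  shows "\<exists>\<phi> c. (\<forall>f\<in>components (- K). \<not> bounded f \<longrightarrow> c f = (0::'k::field_char_0)) \<and>
    (\<forall>e\<in>arcs G. of_bool (e = p) = \<phi> (tail G e) - \<phi> (head G e) + (c (right_face e) - c (left_face e)))"
proof -
  obtain a z where az: "\<And>e. e \<in> arcs G \<Longrightarrow> of_bool (e = p) = (\<Sum>v\<in>verts G. a v * of_int (incidence e v)) + z e"
    "\<And>v. v \<in> verts G \<Longrightarrow> (\<Sum>e\<in>arcs G. z e * of_int (incidence e v)) = (0::rat)"
    using orthogonal_decomposition[of "verts G" "arcs G" "\<lambda>e. of_bool (e = p)" "\<lambda>v e. of_int (incidence e v)"]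
    by auto
  obtain N n where Nn: "N > 0" "\<And>e. e \<in> arcs G \<Longrightarrow> of_int N * z e = of_int (n e)"
    using common_denominator[of "arcs G" z] by auto
  have "(\<Sum>e\<in>arcs G. n e * incidence e v) = 0" if v: "v \<in> verts G" for v
  proof -
    have "of_int (\<Sum>e\<in>arcs G. n e * incidence e v) = of_int N * (\<Sum>e\<in>arcs G. z e * of_int (incidence e v))"
      by (simp add: sum_distrib_left Nn(2)[symmetric] mult.assoc)
    also have "\<dots> = 0" using az(2)[OF v] by simp
    finally show ?thesis by (simp only: of_int_eq_0_iff)
  qed
  then obtain w :: "complex set \<Rightarrow> int" where w: "\<And>f. f \<in> components (- K) \<Longrightarrow> \<not> bounded f \<Longrightarrow> w f = 0"
    "\<And>e. e \<in> arcs G \<Longrightarrow> n e = w (left_face e) - w (right_face e)"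
    by (rule cycle_as_face_boundaries) blast+
  \<comment> \<open>Face derivations count the right side positively whereas \<open>w\<close> gives
    left minus right, hence the sign. The sign of \<open>\<phi>\<close> likewise turns head minus
    tail into tail minus head.\<close>
  define c where "c f = - of_int (w f) / (of_int N :: 'k)" for f
  define \<phi> where "\<phi> v = - (of_rat (a v) :: 'k)" for v
  have "of_bool (e = p) = \<phi> (tail G e) - \<phi> (head G e) + (c (right_face e) - c (left_face e))" if e: "e \<in> arcs G" for e
  proof -
    have "(\<Sum>v\<in>verts G. a v * of_int (incidence e v)) = a (head G e) - a (tail G e)"
    proof -
      have "(\<Sum>v\<in>verts G. a v * of_int (incidence e v)) =
        (\<Sum>v\<in>verts G. if v = head G e then a v else 0) - (\<Sum>v\<in>verts G. if v = tail G e then a v else 0)"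
        unfolding incidence_def sum_subtractf[symmetric] by (intro sum.cong) auto
      then show ?thesis using e by simp
    qed
    then have "(of_rat (of_bool (e = p)) :: 'k) = of_rat (a (head G e) - a (tail G e)) + of_rat (z e)"
      using az(1)[OF e] by (simp add: of_rat_add)
    moreover have "of_rat (z e) = (of_int (n e) / of_int N :: 'k)"
    proof -
      have "z e = of_int (n e) / of_int N" using Nn(1) Nn(2)[OF e] by (simp add: field_simps)
      then show ?thesis by (simp add: of_rat_divide)
    qed
    ultimately show ?thesis
      using w(2)[OF e] by (cases "e = p") (simp_all add: \<phi>_def c_def of_rat_diff diff_divide_distrib)
  qed
  then show ?thesis using w(1) by (intro exI[of _ \<phi>] exI[of _ c]) (auto simp: c_def)
qed

lemma face_boundary_spanning:
  fixes u :: "'e \<Rightarrow> 'k::field_char_0"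
  shows "\<exists>\<phi> c. (\<forall>f\<in>components (- K). \<not> bounded f \<longrightarrow> c f = 0) \<and>
    (\<forall>e\<in>arcs G. u e = \<phi> (tail G e) - \<phi> (head G e) + (c (right_face e) - c (left_face e)))"
proof -
  obtain \<phi> :: "'e \<Rightarrow> 'v \<Rightarrow> 'k" and c where
    c: "\<And>p f. p \<in> arcs G \<Longrightarrow> f \<in> components (- K) \<Longrightarrow> \<not> bounded f \<Longrightarrow> c p f = 0" and
    eq: "\<And>p e. p \<in> arcs G \<Longrightarrow> e \<in> arcs G \<Longrightarrow>
      of_bool (e = p) = \<phi> p (tail G e) - \<phi> p (head G e) + (c p (right_face e) - c p (left_face e))"
    using unit_vector_decomposition[where 'k = 'k] by metis
  show ?thesis
  proof (rule exI[of _ "\<lambda>v. \<Sum>p\<in>arcs G. u p * \<phi> p v"], rule exI[of _ "\<lambda>f. \<Sum>p\<in>arcs G. u p * c p f"],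
      intro conjI ballI impI)
    fix e assume e: "e \<in> arcs G"
    have "u e = (\<Sum>p\<in>arcs G. u p * of_bool (e = p))" using e by simp
    also have "\<dots> = (\<Sum>p\<in>arcs G. u p * (\<phi> p (tail G e) - \<phi> p (head G e) + (c p (right_face e) - c p (left_face e))))"
      using eq[OF _ e] by (intro sum.cong) auto
    finally show "u e = (\<Sum>p\<in>arcs G. u p * \<phi> p (tail G e)) - (\<Sum>p\<in>arcs G. u p * \<phi> p (head G e)) +
       ((\<Sum>p\<in>arcs G. u p * c p (right_face e)) - (\<Sum>p\<in>arcs G. u p * c p (left_face e)))"
      by (simp add: distrib_left right_diff_distrib sum.distrib sum_subtractf)
  qed (use c in simp)
qed

end

section \<open>Quotient modules\<close>

locale module_quotient = module K M for K (structure) and M (structure) +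
  fixes N
  assumes sub: "submodule K N M"
begin

lemma sub_carrier: "N \<subseteq> carrier M"
  using sub by (simp add: submodule_def)

lemma abelian_subgroup: "abelian_subgroup N M"
proof (rule abelian_subgroupI3[OF additive_subgroupI])
  have "\<ominus>\<^bsub>M\<^esub> x \<in> N" if "x \<in> N" for x
  proof -
    have "(\<ominus> \<one>) \<odot>\<^bsub>M\<^esub> x \<in> N" using sub that by (simp add: submodule_def)
    then show ?thesis using that sub_carrier by (simp add: smult_minus_1 subset_iff)
  qed
  then show "subgroup N (add_monoid M)"
    using sub by (intro M.add.subgroupI) (auto simp: submodule_def simp flip: a_inv_def)
qed (rule M.abelian_group_axioms)

sublocale abelian_subgroup N M by (rule abelian_subgroup)

abbreviation Q where "Q \<equiv> quotient_module M N"
abbreviation cls where "cls x \<equiv> N +>\<^bsub>M\<^esub> x"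

lemma cls_eq_iff:
  assumes "x \<in> carrier M" "y \<in> carrier M"
  shows "cls x = cls y \<longleftrightarrow> x \<ominus>\<^bsub>M\<^esub> y \<in> N"
proof
  assume "cls x = cls y"
  then have "x \<in> cls y" using a_rcos_self[OF assms(1)] by simp
  then obtain n where n: "n \<in> N" "x = n \<oplus>\<^bsub>M\<^esub> y" by (auto simp: a_r_coset_def')
  then have "x \<ominus>\<^bsub>M\<^esub> y = n"
    using assms sub_carrier by (simp add: M.minus_eq M.a_assoc M.r_neg subset_iff)
  with n show "x \<ominus>\<^bsub>M\<^esub> y \<in> N" by simp
next
  assume xy: "x \<ominus>\<^bsub>M\<^esub> y \<in> N"
  have "x = (x \<ominus>\<^bsub>M\<^esub> y) \<oplus>\<^bsub>M\<^esub> y" using assms by (simp add: M.minus_eq M.a_assoc M.l_neg)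
  then have "x \<in> cls y" using xy by (auto simp: a_r_coset_def')
  then show "cls x = cls y" using a_repr_independence'[of x y] assms abelian_subgroup
    by (metis a_repr_independence a_subgroup)
qed

lemma cls_mem_iff: "x \<in> carrier M \<Longrightarrow> cls x = N \<longleftrightarrow> x \<in> N"
  using cls_eq_iff[of x "\<zero>\<^bsub>M\<^esub>"] M.a_coset_add_zero[OF sub_carrier]
    M.minus_equality[of "\<zero>\<^bsub>M\<^esub>" "\<zero>\<^bsub>M\<^esub>"] by (simp add: M.minus_eq)

lemma carrier_quotient: "carrier Q = cls ` carrier M"
  by (auto simp: quotient_module_def A_RCOSETS_def')

lemma zero_quotient: "\<zero>\<^bsub>Q\<^esub> = cls \<zero>\<^bsub>M\<^esub>"
  using M.a_coset_add_zero[OF sub_carrier] by (simp add: quotient_module_def)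

lemma add_quotient: "x \<in> carrier M \<Longrightarrow> y \<in> carrier M \<Longrightarrow> cls x \<oplus>\<^bsub>Q\<^esub> cls y = cls (x \<oplus>\<^bsub>M\<^esub> y)"
  by (simp add: quotient_module_def a_rcos_sum)

text \<open>The quotient record scales a coset as a union over its representatives; this collapses
  because all of them give the same coset.\<close>

lemma smult_quotient:
  assumes "c \<in> carrier K" "x \<in> carrier M"
  shows "c \<odot>\<^bsub>Q\<^esub> cls x = cls (c \<odot>\<^bsub>M\<^esub> x)"
proof -
  have "cls (c \<odot>\<^bsub>M\<^esub> y) = cls (c \<odot>\<^bsub>M\<^esub> x)" if y: "y \<in> cls x" for y
  proof -
    obtain n where n: "n \<in> N" "y = n \<oplus>\<^bsub>M\<^esub> x" using y by (auto simp: a_r_coset_def')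
    then have nM: "n \<in> carrier M" using sub_carrier by auto
    have cl: "c \<odot>\<^bsub>M\<^esub> n \<in> carrier M" "c \<odot>\<^bsub>M\<^esub> x \<in> carrier M"
      using assms nM by auto
    have cy: "c \<odot>\<^bsub>M\<^esub> y = c \<odot>\<^bsub>M\<^esub> n \<oplus>\<^bsub>M\<^esub> c \<odot>\<^bsub>M\<^esub> x"
      unfolding n(2) by (rule smult_r_distr[OF assms(1) nM assms(2)])
    have "c \<odot>\<^bsub>M\<^esub> y \<ominus>\<^bsub>M\<^esub> c \<odot>\<^bsub>M\<^esub> x = c \<odot>\<^bsub>M\<^esub> n"
      unfolding cy using cl by (simp add: M.minus_eq M.a_assoc M.r_neg)
    also have "c \<odot>\<^bsub>M\<^esub> n \<in> N" using sub n(1) assms(1) by (simp add: submodule_def)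
    finally show ?thesis
      using cls_eq_iff[OF _ cl(2)] cl by (simp add: cy)
  qed
  then have "(\<Union>y\<in>cls x. cls (c \<odot>\<^bsub>M\<^esub> y)) = (\<Union>y\<in>cls x. cls (c \<odot>\<^bsub>M\<^esub> x))"
    by (rule SUP_cong[OF refl])
  also have "\<dots> = cls (c \<odot>\<^bsub>M\<^esub> x)"
    using a_rcos_self[OF assms(2)] by (simp only: UN_constant if_False empty_iff split: if_splits) blast
  finally show ?thesis by (simp add: quotient_module_def)
qed

lemmas quotient_simps = carrier_quotient zero_quotient add_quotient smult_quotient

lemma quotient_is_module: "module K Q"
proof (rule module_criteria)
  show "\<forall>v\<in>carrier Q. \<exists>neg_v\<in>carrier Q. v \<oplus>\<^bsub>Q\<^esub> neg_v = \<zero>\<^bsub>Q\<^esub>"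
  proof
    fix v assume "v \<in> carrier Q"
    then obtain x where "v = cls x" "x \<in> carrier M" by (auto simp: carrier_quotient)
    then show "\<exists>neg_v\<in>carrier Q. v \<oplus>\<^bsub>Q\<^esub> neg_v = \<zero>\<^bsub>Q\<^esub>"
      by (intro bexI[of _ "cls (\<ominus>\<^bsub>M\<^esub> x)"]) (auto simp: quotient_simps M.r_neg)
  qed
qed (auto simp: quotient_simps M.a_ac smult_r_distr smult_l_distr smult_assoc1 R.is_cring)

lemma finsum_quotient:
  assumes "finite A" "f \<in> A \<rightarrow> carrier M"
  shows "(\<Oplus>\<^bsub>Q\<^esub>i\<in>A. cls (f i)) = cls (\<Oplus>\<^bsub>M\<^esub>i\<in>A. f i)"
proof -
  interpret Q: module K Q by (rule quotient_is_module)
  show ?thesis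
    using assms
  proof (induction A)
    case empty
    then show ?case by (simp add: zero_quotient)
  next
    case (insert i A)
    then have "f \<in> A \<rightarrow> carrier M" "f i \<in> carrier M" by auto
    moreover have "(\<lambda>i. cls (f i)) \<in> A \<rightarrow> carrier Q" "cls (f i) \<in> carrier Q"
      using insert.prems by (auto simp: carrier_quotient)
    ultimately show ?case
      using insert by (simp add: M.finsum_closed add_quotient)
  qed
qed

end

text \<open>Stating independence for indexed representatives modulo \<open>N\<close> also covers
  injectivity, since a repeated class is a relation between two indices.\<close>

lemma basis_family_quotient:
  assumes "field K" "module K M" "submodule K N M"
    and b: "\<And>i. i \<in> I \<Longrightarrow> b i \<in> carrier M"
    and indep: "\<And>J a j. finite J \<Longrightarrow> J \<subseteq> I \<Longrightarrow> a \<in> J \<rightarrow> carrier K \<Longrightarrow>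
        (\<Oplus>\<^bsub>M\<^esub>j\<in>J. a j \<odot>\<^bsub>M\<^esub> b j) \<in> N \<Longrightarrow> j \<in> J \<Longrightarrow> a j = \<zero>\<^bsub>K\<^esub>"
    and span: "\<And>x. x \<in> carrier M \<Longrightarrow> \<exists>J a. finite J \<and> J \<subseteq> I \<and> a \<in> J \<rightarrow> carrier K \<and>
        x \<ominus>\<^bsub>M\<^esub> (\<Oplus>\<^bsub>M\<^esub>j\<in>J. a j \<odot>\<^bsub>M\<^esub> b j) \<in> N"
  shows "basis_family K (quotient_module M N) I (\<lambda>i. N +>\<^bsub>M\<^esub> b i)"
proof -
  interpret K: field K by fact
  interpret module_quotient K M N
    using assms(2,3) by (simp add: module_quotient_def module_quotient_axioms_def)
  interpret V: vectorspace K Q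
    using quotient_is_module assms(1) by (simp add: vectorspace_def)
  let ?B = "\<lambda>i. cls (b i)"
  have BQ: "?B ` I \<subseteq> carrier Q" using b by (auto simp: carrier_quotient)
  have inj: "inj_on ?B I"
  proof (rule inj_onI, rule ccontr)
    fix i j assume ij: "i \<in> I" "j \<in> I" "?B i = ?B j" "i \<noteq> j"
    \<comment> \<open>The relation \<open>b i - b j\<close> that equal classes would
      produce.\<close>
    define a where "a k = (if k = i then \<one>\<^bsub>K\<^esub> else \<ominus>\<^bsub>K\<^esub> \<one>\<^bsub>K\<^esub>)" for k
    have "(\<Oplus>\<^bsub>M\<^esub>k\<in>{i, j}. a k \<odot>\<^bsub>M\<^esub> b k) = b i \<ominus>\<^bsub>M\<^esub> b j"
      using ij b by (subst M.finsum_insert) (auto simp: a_def smult_minus_1 M.minus_eq)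
    also have "\<dots> \<in> N" using ij b cls_eq_iff by auto
    finally have "a i = \<zero>\<^bsub>K\<^esub>" using ij by (intro indep[of "{i, j}" a i]) (auto simp: a_def)
    then show False by (simp add: a_def)
  qed
  have lin: "V.lincomb a (?B ` J) = cls (\<Oplus>\<^bsub>M\<^esub>j\<in>J. a (?B j) \<odot>\<^bsub>M\<^esub> b j)"
    if J: "finite J" "J \<subseteq> I" "a \<in> ?B ` J \<rightarrow> carrier K" for a J
  proof -
    have "V.lincomb a (?B ` J) = (\<Oplus>\<^bsub>Q\<^esub>j\<in>J. a (?B j) \<odot>\<^bsub>Q\<^esub> ?B j)"
      unfolding V.lincomb_def
      using J BQ inj_on_subset[OF inj J(2)] by (intro V.M.add.finprod_reindex) (auto intro!: V.smult_closed)
    also have "\<dots> = (\<Oplus>\<^bsub>Q\<^esub>j\<in>J. cls (a (?B j) \<odot>\<^bsub>M\<^esub> b j))"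
      using J b by (intro V.M.add.finprod_cong') (auto simp: smult_quotient carrier_quotient Pi_iff subset_iff)
    also have "\<dots> = cls (\<Oplus>\<^bsub>M\<^esub>j\<in>J. a (?B j) \<odot>\<^bsub>M\<^esub> b j)"
      using J b by (intro finsum_quotient) auto
    finally show ?thesis .
  qed
  have "V.lin_indpt (?B ` I)"
  proof
    assume "V.lin_dep (?B ` I)"
    then obtain A a v where A: "finite A" "A \<subseteq> ?B ` I" "a \<in> A \<rightarrow> carrier K" "V.lincomb a A = \<zero>\<^bsub>Q\<^esub>"
      "v \<in> A" "a v \<noteq> \<zero>\<^bsub>K\<^esub>"
      unfolding V.lin_dep_def by blast
    then obtain J where J: "J \<subseteq> I" "finite J" "A = ?B ` J"
      by (metis finite_subset_image)
    have "a (?B j) \<odot>\<^bsub>M\<^esub> b j \<in> carrier M" if "j \<in> J" for j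
      using J A(3) b that by (intro smult_closed) auto
    then have car: "(\<Oplus>\<^bsub>M\<^esub>j\<in>J. a (?B j) \<odot>\<^bsub>M\<^esub> b j) \<in> carrier M"
      by (intro M.finsum_closed) auto
    have "cls (\<Oplus>\<^bsub>M\<^esub>j\<in>J. a (?B j) \<odot>\<^bsub>M\<^esub> b j) = N"
      using lin[of J a] A J by (simp add: quotient_module_def)
    then have "(\<Oplus>\<^bsub>M\<^esub>j\<in>J. a (?B j) \<odot>\<^bsub>M\<^esub> b j) \<in> N" using cls_mem_iff[OF car] by simp
    then have "a (?B j) = \<zero>\<^bsub>K\<^esub>" if "j \<in> J" for j
      using J A that by (intro indep[of J "\<lambda>j. a (?B j)" j]) auto
    then show False using A J by auto
  qed
  moreover have "V.gen_set (?B ` I)"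
  proof
    show "V.span (?B ` I) \<subseteq> carrier Q" using V.span_is_subset2[OF BQ] .
    show "carrier Q \<subseteq> V.span (?B ` I)"
    proof
      fix X assume "X \<in> carrier Q"
      then obtain x where x: "x \<in> carrier M" "X = cls x" by (auto simp: carrier_quotient)
      from span[OF x(1)] obtain J a where J: "finite J" "J \<subseteq> I" "a \<in> J \<rightarrow> carrier K"
        "x \<ominus>\<^bsub>M\<^esub> (\<Oplus>\<^bsub>M\<^esub>j\<in>J. a j \<odot>\<^bsub>M\<^esub> b j) \<in> N" by blast
      \<comment> \<open>\<open>V.lincomb\<close> takes coefficients on cosets rather than on
        indices; injectivity permits the transfer.\<close>
      define a' where "a' v = a (the_inv_into J ?B v)" for v
      have a': "a' (?B j) = a j" if "j \<in> J" for j
        using the_inv_into_f_f[OF inj_on_subset[OF inj J(2)] that] by (simp add: a'_def)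
      have eq: "(\<Oplus>\<^bsub>M\<^esub>j\<in>J. a' (?B j) \<odot>\<^bsub>M\<^esub> b j) = (\<Oplus>\<^bsub>M\<^esub>j\<in>J. a j \<odot>\<^bsub>M\<^esub> b j)"
        using J b a' by (intro M.add.finprod_cong') auto
      have car: "(\<Oplus>\<^bsub>M\<^esub>j\<in>J. a j \<odot>\<^bsub>M\<^esub> b j) \<in> carrier M"
        using J b by (intro M.finsum_closed) auto
      have "a' \<in> ?B ` J \<rightarrow> carrier K" using J(3) a' by (auto simp: Pi_iff)
      from lin[OF J(1,2) this] have "X = V.lincomb a' (?B ` J)"
        using J(4) eq cls_eq_iff[OF x(1) car] x(2) by simp
      then show "X \<in> V.span (?B ` I)"
        using J a' unfolding V.span_def by (auto intro!: exI[of _ a'] exI[of _ "?B ` J"])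
    qed
  qed
  ultimately show ?thesis
    using inj BQ V.vectorspace_axioms unfolding basis_family_def V.basis_def by simp
qed

section \<open>Path algebras\<close>

abbreviation scale :: "'k::field \<Rightarrow> ('a \<Rightarrow>\<^sub>0 'k) \<Rightarrow> ('a \<Rightarrow>\<^sub>0 'k)" where
  "scale c \<equiv> Poly_Mapping.map ((*) c)"

lemma lookup_scale: "Poly_Mapping.lookup (scale c a) p = c * Poly_Mapping.lookup a p"
  by (simp add: Poly_Mapping.map.rep_eq when_def)

lemma keys_scale: "Poly_Mapping.keys (scale c a) \<subseteq> Poly_Mapping.keys a"
  by (auto simp: in_keys_iff lookup_scale)

lemma scale_add: "scale c (a + b) = scale c a + scale c b"
  by (rule poly_mapping_eqI) (simp add: lookup_scale lookup_add distrib_left)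

lemma scale_add_left: "scale (c + d) a = scale c a + scale d a"
  by (rule poly_mapping_eqI) (simp add: lookup_scale lookup_add distrib_right)

lemma scale_scale: "scale c (scale d a) = scale (c * d) a"
  by (rule poly_mapping_eqI) (simp add: lookup_scale)

lemma scale_one: "scale 1 a = a"
  by (rule poly_mapping_eqI) (simp add: lookup_scale)

lemma scale_zero_left: "scale 0 a = 0"
  by (rule poly_mapping_eqI) (simp add: lookup_scale)

lemma scale_zero: "scale c 0 = 0"
  by (rule poly_mapping_eqI) (simp add: lookup_scale)

lemma scale_minus_one: "scale (- 1) a = - a"
  by (rule poly_mapping_eqI) (simp add: lookup_scale)

lemma scale_single: "scale c (Poly_Mapping.single p d) = Poly_Mapping.single p (c * d)"
  by (rule poly_mapping_eqI) (simp add: lookup_scale lookup_single when_def)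

lemma sum_single_keys: "(\<Sum>p\<in>Poly_Mapping.keys a. Poly_Mapping.single p (Poly_Mapping.lookup a p)) = a"
proof (rule poly_mapping_eqI)
  fix q
  show "Poly_Mapping.lookup (\<Sum>p\<in>Poly_Mapping.keys a. Poly_Mapping.single p (Poly_Mapping.lookup a p)) q = Poly_Mapping.lookup a q"
    by (simp add: lookup_sum lookup_single when_def in_keys_iff)
qed

text \<open>A finitely supported function is the sum of its monomials. The support of the partial
  sums is carried through the induction because \<open>step\<close> asks for it.\<close>

lemma keys_induct [consumes 1, case_names zero single_add]:
  fixes a :: "'a \<Rightarrow>\<^sub>0 'b::comm_monoid_add"
  assumes "Poly_Mapping.keys a \<subseteq> S" "P 0"
    and step: "\<And>p c b. p \<in> S \<Longrightarrow> Poly_Mapping.keys b \<subseteq> S \<Longrightarrow> P b \<Longrightarrow> P (Poly_Mapping.single p c + b)"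
  shows "P a"
proof -
  have "P (\<Sum>p\<in>X. Poly_Mapping.single p (Poly_Mapping.lookup a p)) \<and>
    Poly_Mapping.keys (\<Sum>p\<in>X. Poly_Mapping.single p (Poly_Mapping.lookup a p)) \<subseteq> S"
    if "finite X" "X \<subseteq> S" for X
    using that
  proof (induction X)
    case (insert p X)
    then have IH: "P (\<Sum>p\<in>X. Poly_Mapping.single p (Poly_Mapping.lookup a p))"
      "Poly_Mapping.keys (\<Sum>p\<in>X. Poly_Mapping.single p (Poly_Mapping.lookup a p)) \<subseteq> S" by auto
    show ?case
      using insert step[OF _ IH(2,1)] IH(2)
      by (auto dest!: subsetD[OF keys_add] split: if_splits)
  qed (use assms(2) in simp)
  from this[OF finite_keys assms(1)] show ?thesis by (simp add: sum_single_keys)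
qed

text \<open>Reduces identities that are additive in one argument to monomials. Additivity is asked
  only for supports in \<open>S\<close>, as derivations are governed only on the carrier.\<close>

lemma additive_eq_on_keys:
  fixes F H :: "('a \<Rightarrow>\<^sub>0 'k::field) \<Rightarrow> ('b \<Rightarrow>\<^sub>0 'k)"
  assumes "Poly_Mapping.keys a \<subseteq> S" "F 0 = H 0"
    and "\<And>a b. Poly_Mapping.keys a \<subseteq> S \<Longrightarrow> Poly_Mapping.keys b \<subseteq> S \<Longrightarrow> F (a + b) = F a + F b"
    and "\<And>a b. Poly_Mapping.keys a \<subseteq> S \<Longrightarrow> Poly_Mapping.keys b \<subseteq> S \<Longrightarrow> H (a + b) = H a + H b"
    and "\<And>p c. p \<in> S \<Longrightarrow> F (Poly_Mapping.single p c) = H (Poly_Mapping.single p c)"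
  shows "F a = H a"
  using assms(1)
proof (induction rule: keys_induct)
  case (single_add p c b)
  then have "Poly_Mapping.keys (Poly_Mapping.single p c) \<subseteq> S" by auto
  with single_add assms show ?case by simp
qed (use assms in simp)

definition linear_extension :: "('a \<Rightarrow> ('b \<Rightarrow>\<^sub>0 'k::field)) \<Rightarrow> ('a \<Rightarrow>\<^sub>0 'k) \<Rightarrow> ('b \<Rightarrow>\<^sub>0 'k)" where
  "linear_extension F a = (\<Sum>p\<in>Poly_Mapping.keys a. scale (Poly_Mapping.lookup a p) (F p))"

lemma linear_extension_superset:
  assumes "finite X" "Poly_Mapping.keys a \<subseteq> X"
  shows "linear_extension F a = (\<Sum>p\<in>X. scale (Poly_Mapping.lookup a p) (F p))"
  unfolding linear_extension_def using assms
  by (intro sum.mono_neutral_left) (auto simp: in_keys_iff scale_zero_left)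

lemma linear_extension_add: "linear_extension F (a + b) = linear_extension F a + linear_extension F b"
proof -
  let ?X = "Poly_Mapping.keys a \<union> Poly_Mapping.keys b"
  have *: "finite ?X" "Poly_Mapping.keys a \<subseteq> ?X" "Poly_Mapping.keys b \<subseteq> ?X" "Poly_Mapping.keys (a + b) \<subseteq> ?X"
    using keys_add[of a b] by auto
  show ?thesis
    by (simp add: linear_extension_superset[OF *(1,2)] linear_extension_superset[OF *(1,3)]
        linear_extension_superset[OF *(1,4)] lookup_add scale_add_left sum.distrib)
qed

lemma linear_extension_single: "linear_extension F (Poly_Mapping.single p c) = scale c (F p)"
  by (subst linear_extension_superset[of "{p}"]) auto

lemma linear_extension_zero: "linear_extension F 0 = 0"
  by (simp add: linear_extension_def)

lemma linear_extension_scale: "linear_extension F (scale c a) = scale c (linear_extension F a)"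
proof (rule additive_eq_on_keys[of a UNIV "\<lambda>a. linear_extension F (scale c a)" "\<lambda>a. scale c (linear_extension F a)"])
qed (simp_all add: linear_extension_add linear_extension_single scale_add scale_single scale_scale linear_extension_zero scale_zero)

lemma keys_linear_extension:
  "Poly_Mapping.keys (linear_extension F a) \<subseteq> (\<Union>p\<in>Poly_Mapping.keys a. Poly_Mapping.keys (F p))"
  unfolding linear_extension_def by (rule order_trans[OF keys_sum UN_mono[OF order_refl keys_scale]])

section \<open>Multiplication in the path algebra\<close>

context wf_digraph
begin

abbreviation mult (infixl \<open>\<star>\<close> 70) where "a \<star> b \<equiv> path_mult G a b"

text \<open>Common finite index sets allow products with different supports to be added term by
  term.\<close>

lemma path_mult_superset:
  assumes "finite X" "finite Y" "Poly_Mapping.keys a \<subseteq> X" "Poly_Mapping.keys b \<subseteq> Y"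
  shows "a \<star> b = (\<Sum>p\<in>X. \<Sum>q\<in>Y. if qpath_head G p = qpath_tail q
       then Poly_Mapping.single (fst p, snd p @ snd q) (Poly_Mapping.lookup a p * Poly_Mapping.lookup b q) else 0)"
proof -
  have "(\<Sum>q\<in>Poly_Mapping.keys b. if qpath_head G p = qpath_tail q
       then Poly_Mapping.single (fst p, snd p @ snd q) (Poly_Mapping.lookup a p * Poly_Mapping.lookup b q) else 0) =
       (\<Sum>q\<in>Y. if qpath_head G p = qpath_tail q
       then Poly_Mapping.single (fst p, snd p @ snd q) (Poly_Mapping.lookup a p * Poly_Mapping.lookup b q) else 0)" for p
    using assms by (intro sum.mono_neutral_left) (auto simp: in_keys_iff)
  then show ?thesis
    unfolding path_mult_def using assms by (simp, intro sum.mono_neutral_left) (auto simp: in_keys_iff intro!: sum.neutral)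
qed

lemma path_mult_single:
  "Poly_Mapping.single p c \<star> Poly_Mapping.single q d =
     (if qpath_head G p = fst q then Poly_Mapping.single (fst p, snd p @ snd q) (c * d) else 0)"
  by (subst path_mult_superset[of "{p}" "{q}"]) (auto simp: qpath_tail_def)

lemma path_mult_add_left: "(a + b) \<star> c = a \<star> c + b \<star> c"
proof -
  let ?X = "Poly_Mapping.keys a \<union> Poly_Mapping.keys b" and ?Y = "Poly_Mapping.keys c"
  have *: "finite ?X" "finite ?Y" "Poly_Mapping.keys a \<subseteq> ?X" "Poly_Mapping.keys b \<subseteq> ?X" "Poly_Mapping.keys (a + b) \<subseteq> ?X" "?Y \<subseteq> ?Y"
    using keys_add[of a b] by auto
  show ?thesis
    unfolding path_mult_superset[OF *(1,2,3,6)] path_mult_superset[OF *(1,2,4,6)] path_mult_superset[OF *(1,2,5,6)]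
      sum.distrib[symmetric]
    by (intro sum.cong) (auto simp: lookup_add distrib_right single_add)
qed

lemma path_mult_add_right: "a \<star> (b + c) = a \<star> b + a \<star> c"
proof -
  let ?X = "Poly_Mapping.keys a" and ?Y = "Poly_Mapping.keys b \<union> Poly_Mapping.keys c"
  have *: "finite ?X" "finite ?Y" "Poly_Mapping.keys b \<subseteq> ?Y" "Poly_Mapping.keys c \<subseteq> ?Y" "Poly_Mapping.keys (b + c) \<subseteq> ?Y" "?X \<subseteq> ?X"
    using keys_add[of b c] by auto
  show ?thesis
    unfolding path_mult_superset[OF *(1,2,6,3)] path_mult_superset[OF *(1,2,6,4)] path_mult_superset[OF *(1,2,6,5)]
      sum.distrib[symmetric]
    by (intro sum.cong) (auto simp: lookup_add distrib_left single_add)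
qed

lemma path_mult_zero: "0 \<star> a = 0" "a \<star> 0 = 0"
  by (simp_all add: path_mult_def)

lemma path_mult_sum_left: "(\<Sum>i\<in>S. f i) \<star> a = (\<Sum>i\<in>S. f i \<star> a)"
  by (induction S rule: infinite_finite_induct) (simp_all add: path_mult_zero path_mult_add_left)

lemma path_mult_sum_right: "a \<star> (\<Sum>i\<in>S. f i) = (\<Sum>i\<in>S. a \<star> f i)"
  by (induction S rule: infinite_finite_induct) (simp_all add: path_mult_zero path_mult_add_right)

lemma path_mult_scale_left: "scale c a \<star> b = scale c (a \<star> b)"
proof (rule additive_eq_on_keys[of a UNIV "\<lambda>a. scale c a \<star> b" "\<lambda>a. scale c (a \<star> b)"])
  fix p and d :: 'c
  show "scale c (Poly_Mapping.single p d) \<star> b = scale c (Poly_Mapping.single p d \<star> b)"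
    by (rule additive_eq_on_keys[of b UNIV "\<lambda>b. scale c (Poly_Mapping.single p d) \<star> b" "\<lambda>b. scale c (Poly_Mapping.single p d \<star> b)"])
      (simp_all add: path_mult_zero path_mult_add_right scale_add scale_zero scale_single path_mult_single mult.assoc)
qed (simp_all add: path_mult_zero path_mult_add_left scale_add scale_zero)

lemma path_mult_scale_right: "a \<star> scale c b = scale c (a \<star> b)"
proof (rule additive_eq_on_keys[of a UNIV "\<lambda>a. a \<star> scale c b" "\<lambda>a. scale c (a \<star> b)"])
  fix p and d :: 'c
  show "Poly_Mapping.single p d \<star> scale c b = scale c (Poly_Mapping.single p d \<star> b)"
    by (rule additive_eq_on_keys[of b UNIV "\<lambda>b. Poly_Mapping.single p d \<star> scale c b" "\<lambda>b. scale c (Poly_Mapping.single p d \<star> b)"])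
      (simp_all add: path_mult_zero path_mult_add_right scale_add scale_zero scale_single path_mult_single mult.left_commute)
qed (simp_all add: path_mult_zero path_mult_add_left scale_add scale_zero)

lemma path_mult_minus: "(- a) \<star> b = - (a \<star> b)" "a \<star> (- b) = - (a \<star> b)"
  by (simp_all flip: scale_minus_one add: path_mult_scale_left path_mult_scale_right)

lemma path_mult_diff: "(a - b) \<star> c = a \<star> c - b \<star> c" "a \<star> (b - c) = a \<star> b - a \<star> c"
  using path_mult_add_left[of a "- b" c] path_mult_add_right[of a b "- c"] by (simp_all add: path_mult_minus)

lemma qpath_head_append:
  "qpath_head G p = fst q \<Longrightarrow> qpath_head G (fst p, snd p @ snd q) = qpath_head G q"
  by (simp add: qpath_head_def awlast_append)

lemma path_mult_assoc: "a \<star> b \<star> c = a \<star> (b \<star> c)"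
proof (rule additive_eq_on_keys[of a UNIV "\<lambda>a. a \<star> b \<star> c" "\<lambda>a. a \<star> (b \<star> c)"])
  fix p :: "('a, 'b) qpath" and x :: 'c
  let ?p = "Poly_Mapping.single p x"
  show "?p \<star> b \<star> c = ?p \<star> (b \<star> c)"
  proof (rule additive_eq_on_keys[of b UNIV "\<lambda>b. ?p \<star> b \<star> c" "\<lambda>b. ?p \<star> (b \<star> c)"])
    fix q :: "('a, 'b) qpath" and y :: 'c
    let ?q = "Poly_Mapping.single q y"
    show "?p \<star> ?q \<star> c = ?p \<star> (?q \<star> c)"
      by (rule additive_eq_on_keys[of c UNIV "\<lambda>c. ?p \<star> ?q \<star> c" "\<lambda>c. ?p \<star> (?q \<star> c)"])
        (auto simp: path_mult_zero path_mult_add_right path_mult_single qpath_head_append[of p q] mult.assoc)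
  qed (simp_all add: path_mult_zero path_mult_add_left path_mult_add_right)
qed (simp_all add: path_mult_zero path_mult_add_left)

lemma keys_path_mult:
  assumes "s \<in> Poly_Mapping.keys (a \<star> b)"
  obtains p q where "p \<in> Poly_Mapping.keys a" "q \<in> Poly_Mapping.keys b" "qpath_head G p = fst q"
    "s = (fst p, snd p @ snd q)"
proof -
  let ?f = "\<lambda>p q. if qpath_head G p = qpath_tail q
       then Poly_Mapping.single (fst p, snd p @ snd q) (Poly_Mapping.lookup a p * Poly_Mapping.lookup b q) else 0"
  obtain p where p: "p \<in> Poly_Mapping.keys a" "s \<in> Poly_Mapping.keys (\<Sum>q\<in>Poly_Mapping.keys b. ?f p q)"
    using subsetD[OF keys_sum assms[unfolded path_mult_def]] by blast
  obtain q where "q \<in> Poly_Mapping.keys b" "s \<in> Poly_Mapping.keys (?f p q)"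
    using subsetD[OF keys_sum p(2)] by blast
  with p(1) show thesis using that by (auto simp: qpath_tail_def split: if_splits)
qed

lemma path_mult_eq_0:
  assumes "\<And>p q. p \<in> Poly_Mapping.keys a \<Longrightarrow> q \<in> Poly_Mapping.keys b \<Longrightarrow> qpath_head G p \<noteq> fst q"
  shows "a \<star> b = 0"
  unfolding path_mult_def using assms by (intro sum.neutral ballI) (auto simp: qpath_tail_def)

abbreviation idem :: "'a \<Rightarrow> ('a, 'b) qpath \<Rightarrow>\<^sub>0 'k::field" where
  "idem v \<equiv> Poly_Mapping.single (v, []) 1"

lemma qpath_head_trivial [simp]: "qpath_head G (v, []) = v"
  by (simp add: qpath_head_def)

lemma lookup_idem_mult:
  "Poly_Mapping.lookup (idem v \<star> b) p = (if fst p = v then Poly_Mapping.lookup b p else 0)"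
proof -
  have "Poly_Mapping.keys b \<subseteq> UNIV" by simp
  then show ?thesis
  proof (induction rule: keys_induct)
    case (single_add q c b)
    then show ?case
      by (cases p; cases q) (auto simp: path_mult_add_right lookup_add path_mult_single lookup_single when_def)
  qed (simp add: path_mult_zero)
qed

lemma lookup_mult_idem:
  "Poly_Mapping.lookup (b \<star> idem v) p = (if qpath_head G p = v then Poly_Mapping.lookup b p else 0)"
proof -
  have "Poly_Mapping.keys b \<subseteq> UNIV" by simp
  then show ?thesis
  proof (induction rule: keys_induct)
    case (single_add q c b)
    then show ?case
      by (auto simp: path_mult_add_left lookup_add path_mult_single lookup_single when_def)
  qed (simp add: path_mult_zero)
qed

lemma idem_mult_eq: "(\<And>p. p \<in> Poly_Mapping.keys b \<Longrightarrow> fst p = v) \<Longrightarrow> idem v \<star> b = b"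
  by (rule poly_mapping_eqI) (auto simp: lookup_idem_mult in_keys_iff)

lemma mult_idem_eq: "(\<And>p. p \<in> Poly_Mapping.keys b \<Longrightarrow> qpath_head G p = v) \<Longrightarrow> b \<star> idem v = b"
  by (rule poly_mapping_eqI) (auto simp: lookup_mult_idem in_keys_iff)

abbreviation elements :: "(('a, 'b) qpath \<Rightarrow>\<^sub>0 'k::field) set" where
  "elements \<equiv> {a. Poly_Mapping.keys a \<subseteq> qpaths G}"

lemma qpath_append:
  assumes "p \<in> qpaths G" "q \<in> qpaths G" "qpath_head G p = fst q"
  shows "(fst p, snd p @ snd q) \<in> qpaths G"
proof -
  from assms(1) obtain w where "awalk (fst p) (snd p) w" by (auto simp: qpaths_def)
  moreover from this have "w = fst q" using assms(3) by (simp add: qpath_head_def)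
  moreover from assms(2) obtain x where "awalk (fst q) (snd q) x" by (auto simp: qpaths_def)
  ultimately have "awalk (fst p) (snd p @ snd q) x" by (metis awalk_appendI)
  then show ?thesis by (auto simp: qpaths_def)
qed

lemma path_mult_closed: "a \<in> elements \<Longrightarrow> b \<in> elements \<Longrightarrow> a \<star> b \<in> elements"
  by (auto elim!: keys_path_mult intro!: qpath_append)

lemma add_closed: "a \<in> elements \<Longrightarrow> b \<in> elements \<Longrightarrow> a + b \<in> elements"
  using keys_add[of a b] by auto

lemma diff_closed: "a \<in> elements \<Longrightarrow> b \<in> elements \<Longrightarrow> a - b \<in> elements"
  using keys_diff[of a b] by auto

lemma scale_closed: "a \<in> elements \<Longrightarrow> scale c a \<in> elements"
  using keys_scale[of c a] by auto

lemma sum_closed: "(\<And>i. i \<in> S \<Longrightarrow> f i \<in> elements) \<Longrightarrow> sum f S \<in> elements"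
  using keys_sum[of f S] by fastforce

lemma trivial_qpath: "v \<in> verts G \<Longrightarrow> (v, []) \<in> qpaths G"
  by (auto simp: qpaths_def awalk_Nil_iff)

lemma arrow_qpath: "e \<in> arcs G \<Longrightarrow> arrow G e \<in> qpaths G"
  by (auto simp: qpaths_def arrow_def awalk_simps)

lemma qpath_head_arrow [simp]: "qpath_head G (arrow G e) = head G e"
  by (simp add: qpath_head_def arrow_def)

lemma fst_arrow [simp]: "fst (arrow G e) = tail G e"
  by (simp add: arrow_def)

lemma qpath_ends: "p \<in> qpaths G \<Longrightarrow> fst p \<in> verts G \<and> qpath_head G p \<in> verts G"
  by (auto simp: qpaths_def qpath_head_def dest: awalk_hd_in_verts awalk_last_in_verts)

end

section \<open>Derivations of path algebras\<close>

context wf_digraph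
begin

lemma path_algebra_simps [simp]:
  "carrier (path_algebra G) = elements"
  "a \<oplus>\<^bsub>path_algebra G\<^esub> b = a + b"
  "a \<otimes>\<^bsub>path_algebra G\<^esub> b = a \<star> b"
  "\<zero>\<^bsub>path_algebra G\<^esub> = 0"
  "c \<odot>\<^bsub>path_algebra G\<^esub> a = scale c a"
  by (simp_all add: path_algebra_def)

lemma path_algebra_abelian_group: "abelian_group (path_algebra G :: ('k::field, ('a, 'b) qpath \<Rightarrow>\<^sub>0 'k) module)"
proof (rule abelian_groupI)
  fix x assume "x \<in> carrier (path_algebra G :: ('k, ('a, 'b) qpath \<Rightarrow>\<^sub>0 'k) module)"
  then show "\<exists>y\<in>carrier (path_algebra G). y \<oplus>\<^bsub>path_algebra G\<^esub> x = \<zero>\<^bsub>path_algebra G\<^esub>"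
    by (intro bexI[of _ "- x"]) auto
qed (auto simp: algebra_simps dest: subsetD[OF keys_add])

lemma path_algebra_minus:
  fixes a b :: "('a, 'b) qpath \<Rightarrow>\<^sub>0 'k::field"
  assumes "a \<in> elements" "b \<in> elements"
  shows "a \<ominus>\<^bsub>path_algebra G\<^esub> b = a - b"
proof -
  interpret A: abelian_group "path_algebra G :: ('k, ('a, 'b) qpath \<Rightarrow>\<^sub>0 'k) module"
    by (rule path_algebra_abelian_group)
  have "\<ominus>\<^bsub>path_algebra G\<^esub> b = - b" by (rule A.minus_equality) (use assms in auto)
  then show ?thesis by (simp add: a_minus_def)
qed

abbreviation Ders :: "((('a, 'b) qpath \<Rightarrow>\<^sub>0 'k::field) \<Rightarrow> (('a, 'b) qpath \<Rightarrow>\<^sub>0 'k)) set" where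
  "Ders \<equiv> derivations class_ring (path_algebra G)"

lemma derivationI:
  assumes "D \<in> extensional elements" "\<And>a. a \<in> elements \<Longrightarrow> D a \<in> elements"
    and "\<And>a b. a \<in> elements \<Longrightarrow> b \<in> elements \<Longrightarrow> D (a + b) = D a + D b"
    and "\<And>c a. a \<in> elements \<Longrightarrow> D (scale c a) = scale c (D a)"
    and "\<And>a b. a \<in> elements \<Longrightarrow> b \<in> elements \<Longrightarrow> D (a \<star> b) = D a \<star> b + a \<star> D b"
  shows "D \<in> Ders"
  using assms by (auto simp: derivations_def LinearCombinations.module_hom_def)

lemma derivationD:
  assumes "D \<in> Ders"
  shows derivation_extensional: "D \<in> extensional elements"
    and derivation_closed: "a \<in> elements \<Longrightarrow> D a \<in> elements"
    and derivation_add: "a \<in> elements \<Longrightarrow> b \<in> elements \<Longrightarrow> D (a + b) = D a + D b"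
    and derivation_scale: "a \<in> elements \<Longrightarrow> D (scale c a) = scale c (D a)"
    and derivation_mult: "a \<in> elements \<Longrightarrow> b \<in> elements \<Longrightarrow> D (a \<star> b) = D a \<star> b + a \<star> D b"
  using assms by (auto simp: derivations_def LinearCombinations.module_hom_def)

lemma derivation_zero: "D \<in> Ders \<Longrightarrow> D 0 = 0"
  using derivation_add[of D 0 0] by simp

abbreviation arr :: "'b \<Rightarrow> ('a, 'b) qpath \<Rightarrow>\<^sub>0 'k::field" where
  "arr e \<equiv> Poly_Mapping.single (arrow G e) 1"

lemma single_in_elements: "p \<in> qpaths G \<Longrightarrow> Poly_Mapping.single p c \<in> elements"
  by auto

lemma single_Cons:
  "Poly_Mapping.single (tail G e, e # es) (1::'k::field) = arr e \<star> Poly_Mapping.single (head G e, es) 1"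
  by (simp add: path_mult_single) (simp add: arrow_def)

text \<open>Vertices and arrows generate the path algebra; the Leibniz rule propagates agreement
  along a path arrow by arrow.\<close>

lemma derivation_eqI:
  fixes D D' :: "(('a, 'b) qpath \<Rightarrow>\<^sub>0 'k::field) \<Rightarrow> (('a, 'b) qpath \<Rightarrow>\<^sub>0 'k)"
  assumes D: "D \<in> Ders" "D' \<in> Ders"
    and v: "\<And>v. v \<in> verts G \<Longrightarrow> D (idem v) = D' (idem v)"
    and e: "\<And>e. e \<in> arcs G \<Longrightarrow> D (arr e) = D' (arr e)"
  shows "D = D'"
proof (rule extensionalityI[OF derivation_extensional[OF D(1)] derivation_extensional[OF D(2)]])
  have path: "D (Poly_Mapping.single (u, es) 1) = D' (Poly_Mapping.single (u, es) 1)" if "awalk u es x" for u es x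
    using that
  proof (induction es arbitrary: u)
    case Nil
    then have "u \<in> verts G" unfolding awalk_Nil_iff by blast
    then show ?case by (rule v)
  next
    case (Cons f es)
    then have f: "f \<in> arcs G" "u = tail G f" "awalk (head G f) es x" by (auto simp: awalk_Cons_iff)
    have el: "arr f \<in> elements" "Poly_Mapping.single (head G f, es) 1 \<in> elements"
      using arrow_qpath[OF f(1)] f(3) by (auto simp: qpaths_def)
    show ?case
      unfolding f(2) single_Cons
      by (simp only: derivation_mult[OF D(1) el] derivation_mult[OF D(2) el] e[OF f(1)] Cons.IH[OF f(3)])
  qed
  fix a :: "('a, 'b) qpath \<Rightarrow>\<^sub>0 'k" assume a: "a \<in> elements"
  show "D a = D' a"
  proof (rule additive_eq_on_keys[of a "qpaths G"])
    fix p and c :: 'k assume p: "p \<in> qpaths G"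
    then obtain x where "awalk (fst p) (snd p) x" by (auto simp: qpaths_def)
    from path[OF this] have "D (Poly_Mapping.single p 1) = D' (Poly_Mapping.single p 1)" by simp
    moreover have "Poly_Mapping.single p c = scale c (Poly_Mapping.single p 1)" by (simp add: scale_single)
    ultimately show "D (Poly_Mapping.single p c) = D' (Poly_Mapping.single p c)"
      using derivation_scale[OF D(1)] derivation_scale[OF D(2)] single_in_elements[OF p] by metis
  qed (use a D in \<open>auto simp: derivation_zero derivation_add\<close>)
qed

text \<open>A derivation that kills the vertices commutes with multiplication by vertices, so its
  arrow values must satisfy this; conversely such values always extend.\<close>

definition parallel_family :: "('b \<Rightarrow> ('a, 'b) qpath \<Rightarrow>\<^sub>0 'k::field) \<Rightarrow> bool" where
  "parallel_family w \<longleftrightarrow> (\<forall>e\<in>arcs G. \<forall>s\<in>Poly_Mapping.keys (w e). s \<in> qpaths G \<and> parallel G s (arrow G e))"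

text \<open>The Leibniz expansion of a path: one summand for each arrow, in which that arrow is
  replaced by its prescribed value.\<close>

primrec path_value :: "('b \<Rightarrow> ('a, 'b) qpath \<Rightarrow>\<^sub>0 'k::field) \<Rightarrow> 'a \<Rightarrow> 'b list \<Rightarrow> ('a, 'b) qpath \<Rightarrow>\<^sub>0 'k" where
  "path_value w u [] = 0"
| "path_value w u (e # es) = w e \<star> Poly_Mapping.single (head G e, es) 1
     + arr e \<star> path_value w (head G e) es"

lemma keys_path_value:
  fixes w :: "'b \<Rightarrow> ('a, 'b) qpath \<Rightarrow>\<^sub>0 'k::field"
  assumes "parallel_family w" "awalk u es x" "s \<in> Poly_Mapping.keys (path_value w u es)"
  shows "s \<in> qpaths G \<and> fst s = u \<and> qpath_head G s = x"
  using assms(2,3)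
proof (induction es arbitrary: u s)
  case (Cons f es)
  then have f: "f \<in> arcs G" "u = tail G f" "awalk (head G f) es x" by (auto simp: awalk_Cons_iff)
  have es: "(head G f, es) \<in> qpaths G" "qpath_head G (head G f, es) = x"
    using f(3) by (auto simp: qpaths_def qpath_head_def)
  consider "s \<in> Poly_Mapping.keys (w f \<star> Poly_Mapping.single (head G f, es) 1)"
    | "s \<in> Poly_Mapping.keys ((arr f :: ('a, 'b) qpath \<Rightarrow>\<^sub>0 'k) \<star> path_value w (head G f) es)"
    using Cons.prems(2) subsetD[OF keys_add] by fastforce
  then show ?case
  proof cases
    case 1
    then obtain p where p: "p \<in> Poly_Mapping.keys (w f)" "qpath_head G p = head G f" "s = (fst p, snd p @ es)"
      by (elim keys_path_mult) auto
    have "p \<in> qpaths G" "fst p = u"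
      using assms(1) f p(1) by (auto simp: parallel_family_def parallel_def qpath_tail_def)
    with p es show ?thesis
      using qpath_append[of p "(head G f, es)"] qpath_head_append[of p "(head G f, es)"] by auto
  next
    case 2
    then obtain q where q: "q \<in> Poly_Mapping.keys (path_value w (head G f) es)" "s = (tail G f, [f] @ snd q)"
      by (elim keys_path_mult) (auto simp: arrow_def)
    from Cons.IH[OF f(3) q(1)] have "q \<in> qpaths G" "fst q = head G f" "qpath_head G q = x" by auto
    with q f show ?thesis
      using qpath_append[of "arrow G f" q] qpath_head_append[of "arrow G f" q] arrow_qpath[OF f(1)]
      by (auto simp: arrow_def qpath_head_def)
  qed
qed simp

text \<open>The Leibniz rule for composable paths. Parallelism enters in the base case, where a
  vertex must act as an identity on the value of a path starting there.\<close>

lemma path_value_append: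
  fixes w :: "'b \<Rightarrow> ('a, 'b) qpath \<Rightarrow>\<^sub>0 'k::field"
  assumes "parallel_family w" "awalk u es x" "awalk x fs y"
  shows "path_value w u (es @ fs) = path_value w u es \<star> Poly_Mapping.single (x, fs) 1
    + Poly_Mapping.single (u, es) 1 \<star> path_value w x fs"
  using assms(2)
proof (induction es arbitrary: u)
  case Nil
  then have "u = x" by (simp add: awalk_Nil_iff)
  then show ?case
    using keys_path_value[OF assms(1,3)] by (simp add: path_mult_zero idem_mult_eq)
next
  case (Cons f es)
  then have f: "f \<in> arcs G" "u = tail G f" "awalk (head G f) es x" by (auto simp: awalk_Cons_iff)
  have "qpath_head G (head G f, es) = x" using f(3) by (auto simp: qpath_head_def)
  then have s: "Poly_Mapping.single (head G f, es @ fs) (1::'k) =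
      Poly_Mapping.single (head G f, es) 1 \<star> Poly_Mapping.single (x, fs) 1"
    by (simp add: path_mult_single)
  show ?case
    by (simp add: Cons.IH[OF f(3)] s single_Cons f(2) path_mult_assoc path_mult_add_left path_mult_add_right add.assoc)
qed

lemma arrow_derivation_exists:
  fixes w :: "'b \<Rightarrow> ('a, 'b) qpath \<Rightarrow>\<^sub>0 'k::field"
  assumes w: "parallel_family w"
  shows "\<exists>D\<in>Ders. (\<forall>v\<in>verts G. D (idem v) = 0) \<and> (\<forall>e\<in>arcs G. D (arr e) = w e)"
proof -
  let ?F = "\<lambda>p. path_value w (fst p) (snd p)"
  let ?L = "linear_extension ?F"
  have keysF: "s \<in> qpaths G \<and> fst s = fst p \<and> qpath_head G s = qpath_head G p"
    if p: "p \<in> qpaths G" "s \<in> Poly_Mapping.keys (?F p)" for p s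
  proof -
    obtain x where "awalk (fst p) (snd p) x" using p(1) by (auto simp: qpaths_def)
    from keys_path_value[OF w this p(2)] this show ?thesis by (auto simp: qpath_head_def)
  qed
  have closed: "?L a \<in> elements" if "a \<in> elements" for a
    using keys_linear_extension[of ?F a] keysF that by blast
  have mult1: "?L (Poly_Mapping.single p c \<star> Poly_Mapping.single q d) =
      ?L (Poly_Mapping.single p c) \<star> Poly_Mapping.single q d + Poly_Mapping.single p c \<star> ?L (Poly_Mapping.single q d)"
    if pq: "p \<in> qpaths G" "q \<in> qpaths G" for p q and c d :: 'k
  proof (cases "qpath_head G p = fst q")
    case True
    obtain x y where xy: "awalk (fst p) (snd p) x" "awalk (fst q) (snd q) y" using pq by (auto simp: qpaths_def)
    then have x: "x = fst q" using True by (simp add: qpath_head_def)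
    define p1 q1 where "p1 = Poly_Mapping.single p (1::'k)" and "q1 = Poly_Mapping.single q (1::'k)"
    have *: "Poly_Mapping.single p c = scale c p1" "Poly_Mapping.single q d = scale d q1"
      by (simp_all add: scale_single p1_def q1_def)
    have "?L (p1 \<star> q1) = ?F (fst p, snd p @ snd q)"
      using True by (simp add: p1_def q1_def path_mult_single linear_extension_single scale_one)
    also have "\<dots> = ?F p \<star> q1 + p1 \<star> ?F q"
      using path_value_append[OF w xy(1) xy(2)[folded x]] x by (simp add: p1_def q1_def)
    finally have "?L (p1 \<star> q1) = ?F p \<star> q1 + p1 \<star> ?F q" .
    moreover have "?L p1 = ?F p" "?L q1 = ?F q"
      by (simp_all add: p1_def q1_def linear_extension_single scale_one)
    ultimately show ?thesis
      unfolding * by (simp add: linear_extension_scale path_mult_scale_left path_mult_scale_right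
          scale_scale scale_add mult.commute[of d c])
  next
    case False
    \<comment> \<open>Values keep the endpoints of their paths, so for paths that do not compose
      both Leibniz terms vanish along with the product.\<close>
    have "?F p \<star> Poly_Mapping.single q d = 0"
      by (rule path_mult_eq_0) (use keysF[OF pq(1)] False in \<open>simp split: if_splits\<close>)
    moreover have "Poly_Mapping.single p c \<star> ?F q = 0"
      by (rule path_mult_eq_0) (use keysF[OF pq(2)] False in \<open>simp split: if_splits\<close>)
    ultimately show ?thesis
      using False by (simp add: path_mult_single linear_extension_single linear_extension_zero
          path_mult_scale_left path_mult_scale_right scale_zero)
  qed
  have mult: "?L (a \<star> b) = ?L a \<star> b + a \<star> ?L b" if ab: "a \<in> elements" "b \<in> elements" for a b
  proof (rule additive_eq_on_keys[of a "qpaths G" "\<lambda>a. ?L (a \<star> b)" "\<lambda>a. ?L a \<star> b + a \<star> ?L b"])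
    fix p and c :: 'k assume p: "p \<in> qpaths G"
    let ?p = "Poly_Mapping.single p c"
    show "?L (?p \<star> b) = ?L ?p \<star> b + ?p \<star> ?L b"
      by (rule additive_eq_on_keys[of b "qpaths G" "\<lambda>b. ?L (?p \<star> b)" "\<lambda>b. ?L ?p \<star> b + ?p \<star> ?L b"])
        (use ab p mult1 in \<open>auto simp: linear_extension_add linear_extension_zero path_mult_zero path_mult_add_left path_mult_add_right algebra_simps\<close>)
  qed (use ab in \<open>auto simp: linear_extension_add linear_extension_zero path_mult_zero path_mult_add_left path_mult_add_right algebra_simps\<close>)
  have "restrict ?L elements \<in> Ders"
  proof (rule derivationI)
    fix a b :: "('a, 'b) qpath \<Rightarrow>\<^sub>0 'k" assume ab: "a \<in> elements" "b \<in> elements"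
    show "restrict ?L elements (a + b) = restrict ?L elements a + restrict ?L elements b"
      using ab add_closed[OF ab] by (simp add: linear_extension_add)
    show "restrict ?L elements (a \<star> b) = restrict ?L elements a \<star> b + a \<star> restrict ?L elements b"
      using ab path_mult_closed[OF ab] mult[OF ab] by simp
  next
    fix c and a :: "('a, 'b) qpath \<Rightarrow>\<^sub>0 'k" assume a: "a \<in> elements"
    show "restrict ?L elements (scale c a) = scale c (restrict ?L elements a)"
      using a scale_closed[OF a, of c] by (simp add: linear_extension_scale)
  qed (use closed in auto)
  moreover have "restrict ?L elements (idem v) = 0" if "v \<in> verts G" for v
    using trivial_qpath[OF that] by (simp add: linear_extension_single scale_zero)
  moreover have "restrict ?L elements (arr e) = w e" if e: "e \<in> arcs G" for e
  proof -
    have "w e \<star> idem (head G e) = w e"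
      using w e by (intro mult_idem_eq) (auto simp: parallel_family_def parallel_def)
    then have "?F (arrow G e) = w e" by (simp add: arrow_def path_mult_zero)
    then show ?thesis
      using arrow_qpath[OF e] by (simp add: linear_extension_single scale_one)
  qed
  ultimately show ?thesis by blast
qed

text \<open>Existence together with \<open>derivation_eqI\<close> makes the definite description in
  \<open>arrow_derivation\<close> meaningful.\<close>

lemma arrow_derivation_props:
  fixes w :: "'b \<Rightarrow> ('a, 'b) qpath \<Rightarrow>\<^sub>0 'k::field"
  assumes w: "parallel_family w"
  shows "arrow_derivation G w \<in> Ders"
    and "v \<in> verts G \<Longrightarrow> arrow_derivation G w (idem v) = 0"
    and "e \<in> arcs G \<Longrightarrow> arrow_derivation G w (arr e) = w e"
proof -
  let ?P = "\<lambda>D. D \<in> Ders \<and> (\<forall>v\<in>verts G. D (idem v) = 0) \<and> (\<forall>e\<in>arcs G. D (arr e) = w e)"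
  have "\<exists>!D. ?P D"
  proof (rule ex_ex1I)
    show "\<exists>D. ?P D" using arrow_derivation_exists[OF w] by blast
    show "D = D'" if "?P D" "?P D'" for D D'
      by (rule derivation_eqI) (use that in auto)
  qed
  then have "?P (arrow_derivation G w)"
    unfolding arrow_derivation_def by (rule theI')
  then show "arrow_derivation G w \<in> Ders"
    and "v \<in> verts G \<Longrightarrow> arrow_derivation G w (idem v) = 0"
    and "e \<in> arcs G \<Longrightarrow> arrow_derivation G w (arr e) = w e" by auto
qed

section \<open>Inner derivations\<close>

definition inner :: "(('a, 'b) qpath \<Rightarrow>\<^sub>0 'k::field) \<Rightarrow> (('a, 'b) qpath \<Rightarrow>\<^sub>0 'k) \<Rightarrow> (('a, 'b) qpath \<Rightarrow>\<^sub>0 'k)" where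
  "inner a = (\<lambda>b\<in>elements. a \<star> b - b \<star> a)"

lemma InDer_eq:
  "InDer (path_algebra G :: ('k::field, ('a, 'b) qpath \<Rightarrow>\<^sub>0 'k) module) = inner ` elements"
proof -
  have "a \<star> b \<ominus>\<^bsub>path_algebra G\<^esub> b \<star> a = a \<star> b - b \<star> a"
    if "a \<in> elements" "b \<in> elements" for a b :: "('a, 'b) qpath \<Rightarrow>\<^sub>0 'k"
    using that by (intro path_algebra_minus path_mult_closed)
  then show ?thesis
    unfolding InDer_def inner_def by (intro image_cong) (auto intro!: restrict_ext)
qed

lemma inner_derivation:
  fixes a :: "('a, 'b) qpath \<Rightarrow>\<^sub>0 'k::field"
  assumes a: "a \<in> elements"
  shows "inner a \<in> Ders"
proof (rule derivationI)
  fix b c :: "('a, 'b) qpath \<Rightarrow>\<^sub>0 'k" assume bc: "b \<in> elements" "c \<in> elements"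
  show "inner a (b + c) = inner a b + inner a c"
    using bc add_closed[OF bc] by (simp add: inner_def path_mult_add_left path_mult_add_right)
  show "inner a (b \<star> c) = inner a b \<star> c + b \<star> inner a c"
    using bc path_mult_closed[OF bc] by (simp add: inner_def path_mult_diff path_mult_assoc)
next
  fix c and b :: "('a, 'b) qpath \<Rightarrow>\<^sub>0 'k" assume b: "b \<in> elements"
  show "inner a (scale c b) = scale c (inner a b)"
    using b scale_closed[OF b, of c]
    by (simp add: inner_def path_mult_scale_left path_mult_scale_right scale_minus_one[symmetric]
        scale_add scale_scale diff_conv_add_uminus)
  show "inner a b \<in> elements"
    using diff_closed[OF path_mult_closed[OF a b] path_mult_closed[OF b a]] b by (simp add: inner_def)
qed (simp add: inner_def)

end

section \<open>The module of derivations and its submodule of inner ones\<close>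

context wf_digraph
begin

lemma Der_simps [simp]:
  "carrier (Der class_ring (path_algebra G)) = Ders"
  "D \<oplus>\<^bsub>Der class_ring (path_algebra G)\<^esub> D' = (\<lambda>a\<in>elements. D a + D' a)"
  "\<zero>\<^bsub>Der class_ring (path_algebra G)\<^esub> = (\<lambda>a\<in>elements. 0)"
  "c \<odot>\<^bsub>Der class_ring (path_algebra G)\<^esub> D = (\<lambda>a\<in>elements. scale c (D a))"
  by (simp_all add: Der_def)

lemma Der_add_closed:
  fixes D D' :: "(('a, 'b) qpath \<Rightarrow>\<^sub>0 'k::field) \<Rightarrow> (('a, 'b) qpath \<Rightarrow>\<^sub>0 'k)"
  assumes "D \<in> Ders" "D' \<in> Ders"
  shows "(\<lambda>a\<in>elements. D a + D' a) \<in> Ders"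
proof (rule derivationI)
  fix a b :: "('a, 'b) qpath \<Rightarrow>\<^sub>0 'k" assume ab: "a \<in> elements" "b \<in> elements"
  let ?S = "\<lambda>a\<in>elements. D a + D' a"
  show "?S (a + b) = ?S a + ?S b"
    using ab add_closed[OF ab] derivation_add[OF assms(1) ab] derivation_add[OF assms(2) ab] by simp
  show "?S (a \<star> b) = ?S a \<star> b + a \<star> ?S b"
    using ab path_mult_closed[OF ab] derivation_mult[OF assms(1) ab] derivation_mult[OF assms(2) ab]
    by (simp add: path_mult_add_left path_mult_add_right)
next
  fix c and a :: "('a, 'b) qpath \<Rightarrow>\<^sub>0 'k" assume a: "a \<in> elements"
  let ?S = "\<lambda>a\<in>elements. D a + D' a"
  show "?S a \<in> elements"
    using a add_closed[OF derivation_closed[OF assms(1) a] derivation_closed[OF assms(2) a]] by simp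
  show "?S (scale c a) = scale c (?S a)"
    using a scale_closed[OF a, of c] derivation_scale[OF assms(1) a] derivation_scale[OF assms(2) a]
    by (simp add: scale_add)
qed simp

lemma Der_scale_closed:
  fixes D :: "(('a, 'b) qpath \<Rightarrow>\<^sub>0 'k::field) \<Rightarrow> (('a, 'b) qpath \<Rightarrow>\<^sub>0 'k)"
  assumes "D \<in> Ders"
  shows "(\<lambda>a\<in>elements. scale c (D a)) \<in> Ders"
proof (rule derivationI)
  fix a b :: "('a, 'b) qpath \<Rightarrow>\<^sub>0 'k" assume ab: "a \<in> elements" "b \<in> elements"
  let ?S = "\<lambda>a\<in>elements. scale c (D a)"
  show "?S (a + b) = ?S a + ?S b"
    using ab add_closed[OF ab] derivation_add[OF assms(1) ab] by (simp add: scale_add)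
  show "?S (a \<star> b) = ?S a \<star> b + a \<star> ?S b"
    using ab path_mult_closed[OF ab] derivation_mult[OF assms(1) ab]
    by (simp add: scale_add path_mult_scale_left path_mult_scale_right)
next
  fix d and a :: "('a, 'b) qpath \<Rightarrow>\<^sub>0 'k" assume a: "a \<in> elements"
  let ?S = "\<lambda>a\<in>elements. scale c (D a)"
  show "?S a \<in> elements" using a scale_closed[OF derivation_closed[OF assms a], of c] by simp
  show "?S (scale d a) = scale d (?S a)"
    using a scale_closed[OF a, of d] derivation_scale[OF assms a]
    by (simp add: scale_scale mult.commute)
qed simp

lemma Der_zero_closed: "(\<lambda>a\<in>elements. 0 :: ('a, 'b) qpath \<Rightarrow>\<^sub>0 'k::field) \<in> Ders"
proof (rule derivationI)
  fix a b :: "('a, 'b) qpath \<Rightarrow>\<^sub>0 'k" assume ab: "a \<in> elements" "b \<in> elements"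
  show "(\<lambda>a\<in>elements. 0) (a + b) = (\<lambda>a\<in>elements. 0) a + (\<lambda>a\<in>elements. 0 :: ('a, 'b) qpath \<Rightarrow>\<^sub>0 'k) b"
    using ab add_closed[OF ab] by simp
  show "(\<lambda>a\<in>elements. 0) (a \<star> b) = (\<lambda>a\<in>elements. 0) a \<star> b + a \<star> (\<lambda>a\<in>elements. 0 :: ('a, 'b) qpath \<Rightarrow>\<^sub>0 'k) b"
    using ab path_mult_closed[OF ab] by (simp add: path_mult_zero)
next
  fix c and a :: "('a, 'b) qpath \<Rightarrow>\<^sub>0 'k" assume a: "a \<in> elements"
  show "(\<lambda>a\<in>elements. 0) (scale c a) = scale c ((\<lambda>a\<in>elements. 0 :: ('a, 'b) qpath \<Rightarrow>\<^sub>0 'k) a)"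
    using a scale_closed[OF a, of c] by (simp add: scale_zero)
qed auto

lemma restrict_derivation:
  fixes D :: "(('a, 'b) qpath \<Rightarrow>\<^sub>0 'k::field) \<Rightarrow> (('a, 'b) qpath \<Rightarrow>\<^sub>0 'k)"
  shows "D \<in> Ders \<Longrightarrow> (\<lambda>a\<in>elements. D a) = D"
  by (rule extensional_restrict[OF derivation_extensional])

lemma Der_module: "module class_ring (Der class_ring (path_algebra G :: ('k::field, ('a, 'b) qpath \<Rightarrow>\<^sub>0 'k) module))"
proof -
  have neg: "\<exists>D'\<in>Ders. (\<lambda>a\<in>elements. D a + D' a) = (\<lambda>a\<in>elements. 0)"
    if "D \<in> Ders" for D :: "(('a, 'b) qpath \<Rightarrow>\<^sub>0 'k) \<Rightarrow> (('a, 'b) qpath \<Rightarrow>\<^sub>0 'k)"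
    using Der_scale_closed[OF that, of "- 1"]
    by (intro bexI[of _ "\<lambda>a\<in>elements. scale (- 1) (D a)"]) (auto simp: scale_minus_one intro!: restrict_ext)
  \<comment> \<open>The conditional is the restricted zero map after unfolding its application, the
    form that arises in the module axioms.\<close>
  have zero: "(\<lambda>a\<in>elements. D a + (if Poly_Mapping.keys a \<subseteq> qpaths G then 0 else undefined)) = D"
    if "D \<in> Ders" for D :: "(('a, 'b) qpath \<Rightarrow>\<^sub>0 'k) \<Rightarrow> (('a, 'b) qpath \<Rightarrow>\<^sub>0 'k)"
    by (subst (2) restrict_derivation[OF that, symmetric]) (auto intro!: restrict_ext)
  show ?thesis
    by (rule module_criteria)
      (use neg zero in \<open>auto simp: class_cring.cring_axioms Der_add_closed Der_scale_closed Der_zero_closed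
        restrict_derivation scale_add scale_add_left scale_scale scale_one add_ac intro!: restrict_ext\<close>)
qed

lemma Der_minus:
  fixes D D' :: "(('a, 'b) qpath \<Rightarrow>\<^sub>0 'k::field) \<Rightarrow> (('a, 'b) qpath \<Rightarrow>\<^sub>0 'k)"
  assumes "D \<in> Ders" "D' \<in> Ders"
  shows "D \<ominus>\<^bsub>Der class_ring (path_algebra G)\<^esub> D' = (\<lambda>a\<in>elements. D a - D' a)"
proof -
  interpret M: module "class_ring :: 'k ring" "Der class_ring (path_algebra G :: ('k, ('a, 'b) qpath \<Rightarrow>\<^sub>0 'k) module)"
    by (rule Der_module)
  have "\<ominus>\<^bsub>Der class_ring (path_algebra G)\<^esub> D' = (\<lambda>a\<in>elements. scale (- 1) (D' a))"
    using assms(2) Der_scale_closed[OF assms(2), of "- 1"]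
    by (intro M.minus_equality) (auto simp: scale_minus_one intro!: restrict_ext)
  then show ?thesis
    by (auto simp: a_minus_def scale_minus_one intro!: restrict_ext)
qed

lemma Der_finsum:
  fixes f :: "'i \<Rightarrow> (('a, 'b) qpath \<Rightarrow>\<^sub>0 'k::field) \<Rightarrow> (('a, 'b) qpath \<Rightarrow>\<^sub>0 'k)"
  assumes "finite J" "\<And>j. j \<in> J \<Longrightarrow> f j \<in> Ders"
  shows "(\<Oplus>\<^bsub>Der class_ring (path_algebra G)\<^esub>j\<in>J. f j) = (\<lambda>a\<in>elements. \<Sum>j\<in>J. f j a)"
proof -
  interpret M: module "class_ring :: 'k ring" "Der class_ring (path_algebra G :: ('k, ('a, 'b) qpath \<Rightarrow>\<^sub>0 'k) module)"
    by (rule Der_module)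
  show ?thesis
    using assms
  proof (induction J)
    case empty
    show ?case using M.finsum_empty[of f] by simp
  next
    case (insert i J)
    then have "f \<in> J \<rightarrow> carrier (Der class_ring (path_algebra G))" "f i \<in> carrier (Der class_ring (path_algebra G))"
      by auto
    from M.finsum_insert[OF insert.hyps this] insert show ?case by (auto intro!: restrict_ext)
  qed
qed

lemma InDer_submodule:
  "submodule class_ring (InDer (path_algebra G)) (Der class_ring (path_algebra G :: ('k::field, ('a, 'b) qpath \<Rightarrow>\<^sub>0 'k) module))"
proof (rule submodule.intro)
  let ?M = "Der class_ring (path_algebra G :: ('k, ('a, 'b) qpath \<Rightarrow>\<^sub>0 'k) module)"
  show "module class_ring ?M" by (rule Der_module)
  show "InDer (path_algebra G) \<subseteq> carrier ?M"
    unfolding InDer_eq using inner_derivation by auto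
  show "v \<oplus>\<^bsub>?M\<^esub> w \<in> InDer (path_algebra G)" if vw: "v \<in> InDer (path_algebra G)" "w \<in> InDer (path_algebra G)" for v w
  proof -
    obtain a b where ab: "a \<in> elements" "b \<in> elements" "v = inner a" "w = inner b"
      using vw unfolding InDer_eq by blast
    have "v \<oplus>\<^bsub>?M\<^esub> w = inner (a + b)"
      unfolding ab(3,4) by (auto simp: inner_def path_mult_add_left path_mult_add_right intro!: restrict_ext)
    then show ?thesis unfolding InDer_eq using add_closed[OF ab(1,2)] by blast
  qed
  show "\<zero>\<^bsub>?M\<^esub> \<in> InDer (path_algebra G)"
    unfolding InDer_eq by (rule image_eqI[of _ _ 0]) (auto simp: inner_def path_mult_zero intro!: restrict_ext)
  show "c \<odot>\<^bsub>?M\<^esub> v \<in> InDer (path_algebra G)" if v: "v \<in> InDer (path_algebra G)" for c v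
  proof -
    obtain a where a: "a \<in> elements" "v = inner a" using v unfolding InDer_eq by blast
    have "scale c (x - y) = scale c x - scale c y" for x y :: "('a, 'b) qpath \<Rightarrow>\<^sub>0 'k"
      by (rule poly_mapping_eqI) (simp add: lookup_scale lookup_minus right_diff_distrib)
    then have "c \<odot>\<^bsub>?M\<^esub> v = inner (scale c a)"
      unfolding a(2) by (auto simp: inner_def path_mult_scale_left path_mult_scale_right intro!: restrict_ext)
    then show ?thesis unfolding InDer_eq using scale_closed[OF a(1), of c] by blast
  qed
qed

text \<open>An arrow is unchanged by multiplication with its tail on the left and its head on the
  right. As \<open>D\<close> kills vertices, the same holds for its image, which fixes the ends of
  every path there.\<close>

lemma derivation_arrow_parallel:
  fixes D :: "(('a, 'b) qpath \<Rightarrow>\<^sub>0 'k::field) \<Rightarrow> (('a, 'b) qpath \<Rightarrow>\<^sub>0 'k)"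
  assumes D: "D \<in> Ders" and v: "\<And>v. v \<in> verts G \<Longrightarrow> D (idem v) = 0"
  shows "parallel_family (\<lambda>e. D (arr e))"
  unfolding parallel_family_def
proof (intro ballI)
  fix e s assume e: "e \<in> arcs G" and s: "s \<in> Poly_Mapping.keys (D (arr e))"
  have el: "arr e \<in> elements" "idem (tail G e) \<in> elements" "idem (head G e) \<in> elements"
    using arrow_qpath[OF e] trivial_qpath e by auto
  have "arr e = idem (tail G e) \<star> (arr e :: ('a, 'b) qpath \<Rightarrow>\<^sub>0 'k)"
    by (simp add: path_mult_single arrow_def)
  then have "D (arr e) = D (idem (tail G e) \<star> arr e)" by simp
  also have "\<dots> = idem (tail G e) \<star> D (arr e)"
    using e by (simp only: derivation_mult[OF D el(2,1)] v tail_in_verts path_mult_zero add_0)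
  finally have "Poly_Mapping.lookup (D (arr e)) s = Poly_Mapping.lookup (idem (tail G e) \<star> D (arr e)) s" by simp
  then have "fst s = tail G e" using s by (auto simp: lookup_idem_mult in_keys_iff split: if_splits)
  moreover have "arr e = (arr e :: ('a, 'b) qpath \<Rightarrow>\<^sub>0 'k) \<star> idem (head G e)"
    by (simp add: path_mult_single) (simp add: arrow_def)
  then have "D (arr e) = D (arr e \<star> idem (head G e))" by simp
  then have "D (arr e) = D (arr e) \<star> idem (head G e)"
    using e by (simp only: derivation_mult[OF D el(1,3)] v head_in_verts path_mult_zero add_0_right)
  then have "Poly_Mapping.lookup (D (arr e)) s = Poly_Mapping.lookup (D (arr e) \<star> idem (head G e)) s" by simp
  then have "qpath_head G s = head G e" using s by (auto simp: lookup_mult_idem in_keys_iff split: if_splits)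
  moreover have "s \<in> qpaths G" using derivation_closed[OF D el(1)] s by auto
  ultimately show "s \<in> qpaths G \<and> parallel G s (arrow G e)"
    by (simp add: parallel_def qpath_tail_def)
qed

end

section \<open>Derivations on vertices and diagonal elements\<close>

context fin_digraph
begin

lemma mult_sum_idem:
  fixes a :: "('a, 'b) qpath \<Rightarrow>\<^sub>0 'k::field"
  assumes "a \<in> elements"
  shows "(\<Sum>v\<in>verts G. a \<star> idem v) = a"
proof (rule poly_mapping_eqI)
  fix p
  have "p \<in> Poly_Mapping.keys a \<Longrightarrow> qpath_head G p \<in> verts G" using assms qpath_ends[of p] by auto
  then show "Poly_Mapping.lookup (\<Sum>v\<in>verts G. a \<star> idem v) p = Poly_Mapping.lookup a p"
    by (auto simp: lookup_sum lookup_mult_idem in_keys_iff)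
qed

lemma derivation_inner_on_idems:
  fixes D :: "(('a, 'b) qpath \<Rightarrow>\<^sub>0 'k::field) \<Rightarrow> (('a, 'b) qpath \<Rightarrow>\<^sub>0 'k)"
  assumes D: "D \<in> Ders"
  obtains x where "x \<in> elements" "\<And>v. v \<in> verts G \<Longrightarrow> D (idem v) = inner x (idem v)"
proof -
  \<comment> \<open>Expanding \<open>D (e\<^sub>u e\<^sub>v)\<close> gives \<open>e\<^sub>u D(e\<^sub>v) e\<^sub>v = [u = v] D(e\<^sub>u) e\<^sub>u - D(e\<^sub>u) e\<^sub>v\<close>, whose sum over \<open>v\<close> is \<open>D(e\<^sub>u) e\<^sub>u - D(e\<^sub>u)\<close>.\<close>
  define x where "x = (\<Sum>v\<in>verts G. D (idem v) \<star> idem v)"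
  have idem: "idem v \<in> elements" if "v \<in> verts G" for v using trivial_qpath[OF that] by auto
  have x: "x \<in> elements"
    unfolding x_def by (intro sum_closed path_mult_closed derivation_closed[OF D] idem)
  have ii: "idem u \<star> idem v = (if u = v then idem v else (0 :: ('a, 'b) qpath \<Rightarrow>\<^sub>0 'k))" for u v
    by (simp add: path_mult_single)
  have "D (idem u) = inner x (idem u)" if u: "u \<in> verts G" for u
  proof -
    let ?b = "D (idem u)"
    have "x \<star> idem u = (\<Sum>v\<in>verts G. if v = u then ?b \<star> idem u else 0)"
      unfolding x_def path_mult_sum_left path_mult_assoc ii by (intro sum.cong) (auto simp: path_mult_zero)
    then have xu: "x \<star> idem u = ?b \<star> idem u" using u by simp
    have val: "idem u \<star> (D (idem v) \<star> idem v) = (if v = u then ?b \<star> idem u else 0) - ?b \<star> idem v"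
      if v: "v \<in> verts G" for v
    proof -
      have "D (idem u \<star> idem v) \<star> idem v = (?b \<star> idem v + idem u \<star> D (idem v)) \<star> idem v"
        by (simp only: derivation_mult[OF D idem[OF u] idem[OF v]])
      then have "D (idem u \<star> idem v) \<star> idem v = ?b \<star> idem v + idem u \<star> (D (idem v) \<star> idem v)"
        by (simp add: path_mult_add_left path_mult_assoc ii)
      moreover have "D (idem u \<star> idem v) \<star> idem v = (if v = u then ?b \<star> idem u else 0)"
        by (simp add: ii derivation_zero[OF D] path_mult_zero)
      ultimately show ?thesis by (simp add: eq_diff_eq add.commute)
    qed
    have "idem u \<star> x = (\<Sum>v\<in>verts G. (if v = u then ?b \<star> idem u else 0) - ?b \<star> idem v)"
      unfolding x_def path_mult_sum_right by (intro sum.cong refl val)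
    also have "\<dots> = ?b \<star> idem u - ?b"
      using u by (simp add: sum_subtractf mult_sum_idem[OF derivation_closed[OF D idem[OF u]]])
    finally show ?thesis
      using idem[OF u] by (simp add: inner_def xu)
  qed
  with x that show thesis by blast
qed

definition diagonal :: "('a \<Rightarrow> 'k) \<Rightarrow> ('a, 'b) qpath \<Rightarrow>\<^sub>0 'k::field" where
  "diagonal \<phi> = (\<Sum>v\<in>verts G. Poly_Mapping.single (v, []) (\<phi> v))"

lemma diagonal_closed: "diagonal \<phi> \<in> elements"
  unfolding diagonal_def by (intro sum_closed) (use trivial_qpath in auto)

lemma diagonal_mult_single:
  "fst p \<in> verts G \<Longrightarrow> diagonal \<phi> \<star> Poly_Mapping.single p c = Poly_Mapping.single p (\<phi> (fst p) * c)"
  by (simp add: diagonal_def path_mult_sum_left path_mult_single)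

lemma single_mult_diagonal:
  "qpath_head G p \<in> verts G \<Longrightarrow> Poly_Mapping.single p c \<star> diagonal \<phi> = Poly_Mapping.single p (c * \<phi> (qpath_head G p))"
  by (simp add: diagonal_def path_mult_sum_right path_mult_single)

text \<open>Arrows are eigenvectors of the bracket with a diagonal element; the eigenvalues are the
  coboundary of \<open>\<phi>\<close>, up to sign.\<close>

lemma inner_diagonal:
  "v \<in> verts G \<Longrightarrow> inner (diagonal \<phi>) (idem v) = 0"
  "e \<in> arcs G \<Longrightarrow> inner (diagonal \<phi>) (arr e) = Poly_Mapping.single (arrow G e) (\<phi> (tail G e) - \<phi> (head G e))"
  using trivial_qpath arrow_qpath
  by (auto simp: inner_def diagonal_mult_single single_mult_diagonal simp flip: single_diff)

text \<open>Commuting with the vertices forces every path in the support of \<open>x\<close> to be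
  closed, and an acyclic quiver has only trivial closed paths.\<close>

lemma central_on_idems_diagonal:
  fixes x :: "('a, 'b) qpath \<Rightarrow>\<^sub>0 'k::field"
  assumes acyc: "acyclic_quiver G" and x: "x \<in> elements"
    and c: "\<And>v. v \<in> verts G \<Longrightarrow> inner x (idem v) = 0"
  shows "x = diagonal (\<lambda>v. Poly_Mapping.lookup x (v, []))"
proof -
  have triv: "snd p = [] \<and> fst p \<in> verts G" if p: "p \<in> Poly_Mapping.keys x" for p
  proof -
    have pP: "p \<in> qpaths G" using p x by auto
    then have u: "fst p \<in> verts G" using qpath_ends by auto
    have "x \<star> idem (fst p) = idem (fst p) \<star> x"
      using c[OF u] trivial_qpath[OF u] by (simp add: inner_def)
    then have "Poly_Mapping.lookup (x \<star> idem (fst p)) p = Poly_Mapping.lookup (idem (fst p) \<star> x) p" by simp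
    then have "qpath_head G p = fst p"
      using p by (auto simp: lookup_mult_idem lookup_idem_mult in_keys_iff split: if_splits)
    then have "awalk (fst p) (snd p) (fst p)" using pP by (auto simp: qpaths_def qpath_head_def)
    then have "snd p = []"
      using acyc closed_w_imp_cycle[of "snd p"] by (auto simp: acyclic_quiver_def closed_w_def)
    with u show ?thesis by simp
  qed
  show ?thesis
  proof (rule poly_mapping_eqI)
    fix p :: "('a, 'b) qpath"
    have "Poly_Mapping.lookup (diagonal (\<lambda>v. Poly_Mapping.lookup x (v, []))) p =
        (\<Sum>v\<in>verts G. if v = fst p then if snd p = [] then Poly_Mapping.lookup x p else 0 else 0)"
      unfolding diagonal_def lookup_sum by (intro sum.cong refl, cases p) (auto simp: lookup_single when_def)
    also have "\<dots> = (if snd p = [] \<and> fst p \<in> verts G then Poly_Mapping.lookup x p else 0)"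
      by (simp add: sum.delta)
    finally show "Poly_Mapping.lookup x p = Poly_Mapping.lookup (diagonal (\<lambda>v. Poly_Mapping.lookup x (v, []))) p"
      using triv[of p] by (auto simp: in_keys_iff)
  qed
qed

end

section \<open>The basis\<close>

context plane_quiver
begin

definition face_sign :: "'e \<Rightarrow> complex set \<Rightarrow> 'k::field" where
  "face_sign e f = of_bool (f = right_face e) - of_bool (f = left_face e)"

definition basis_derivation :: "'e \<times> ('v, 'e) qpath + complex set \<Rightarrow>
    (('v, 'e) qpath \<Rightarrow>\<^sub>0 'k::field) \<Rightarrow> (('v, 'e) qpath \<Rightarrow>\<^sub>0 'k)" where
  "basis_derivation = case_sum (\<lambda>(p, r). path_derivation G p r) (face_derivation G \<gamma>)"

definition basis_value :: "'e \<times> ('v, 'e) qpath + complex set \<Rightarrow> 'e \<Rightarrow> ('v, 'e) qpath \<Rightarrow>\<^sub>0 'k::field" where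
  "basis_value j e = (case j of Inl (p, r) \<Rightarrow> if e = p then Poly_Mapping.single r 1 else 0
     | Inr f \<Rightarrow> Poly_Mapping.single (arrow G e) (face_sign e f))"

abbreviation indices :: "('e \<times> ('v, 'e) qpath + complex set) set" where
  "indices \<equiv> Sum_Type.Plus (almost_oriented_cycles G) (bounded_faces G pos \<gamma>)"

lemma basis_derivation_props:
  assumes "j \<in> indices"
  shows "(basis_derivation j :: _ \<Rightarrow> ('v, 'e) qpath \<Rightarrow>\<^sub>0 'k::field) \<in> Ders"
    and "v \<in> verts G \<Longrightarrow> (basis_derivation j :: _ \<Rightarrow> ('v, 'e) qpath \<Rightarrow>\<^sub>0 'k) (idem v) = 0"
    and "e \<in> arcs G \<Longrightarrow> (basis_derivation j :: _ \<Rightarrow> ('v, 'e) qpath \<Rightarrow>\<^sub>0 'k) (arr e) = basis_value j e"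
proof -
  obtain w :: "'e \<Rightarrow> ('v, 'e) qpath \<Rightarrow>\<^sub>0 'k" where w: "parallel_family w" "basis_derivation j = arrow_derivation G w"
    "\<And>e. e \<in> arcs G \<Longrightarrow> w e = basis_value j e"
  proof (cases j)
    case (Inl pr)
    obtain p r where pr: "pr = (p, r)" by (cases pr)
    have AL: "r \<in> qpaths G" "parallel G r (arrow G p)"
      using assms Inl pr by (auto simp: almost_oriented_cycles_def)
    show thesis
    proof (rule that[of "\<lambda>q. if q = p then Poly_Mapping.single r 1 else 0"])
      show "parallel_family (\<lambda>q. if q = p then Poly_Mapping.single r (1::'k) else 0)"
        using AL by (auto simp: parallel_family_def)
    qed (simp_all add: Inl pr basis_derivation_def path_derivation_def basis_value_def)
  next
    case (Inr f)
    have f: "f \<in> components (- K)" using assms Inr by (auto simp: bounded_faces_def)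
    show thesis
    proof (rule that[of "\<lambda>p. Poly_Mapping.single (arrow G p) (of_bool (on_right (\<gamma> p) f) - of_bool (on_left (\<gamma> p) f))"])
      show "parallel_family (\<lambda>p. Poly_Mapping.single (arrow G p) (of_bool (on_right (\<gamma> p) f) - of_bool (on_left (\<gamma> p) f) :: 'k))"
        using arrow_qpath by (auto simp: parallel_family_def parallel_def split: if_splits)
    qed (simp_all add: Inr basis_derivation_def face_derivation_def basis_value_def face_sign_def
        on_right_edge_iff[OF _ f] on_left_edge_iff[OF _ f])
  qed
  note props = arrow_derivation_props[OF w(1), folded w(2)]
  show "(basis_derivation j :: _ \<Rightarrow> ('v, 'e) qpath \<Rightarrow>\<^sub>0 'k::field) \<in> Ders"
    and "v \<in> verts G \<Longrightarrow> (basis_derivation j :: _ \<Rightarrow> ('v, 'e) qpath \<Rightarrow>\<^sub>0 'k) (idem v) = 0"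
    and "e \<in> arcs G \<Longrightarrow> (basis_derivation j :: _ \<Rightarrow> ('v, 'e) qpath \<Rightarrow>\<^sub>0 'k) (arr e) = basis_value j e"
    using props w(3) by simp_all
qed

text \<open>For \<open>J\<close> within \<open>indices\<close> the two kinds decouple: a path other
  than the arrow sees one almost oriented cycle, and the arrow itself sees only the faces on its two
  sides. Extending \<open>c\<close> by 0 spares a case distinction on these faces.\<close>

lemma lookup_sum_basis_value:
  fixes a :: "'e \<times> ('v, 'e) qpath + complex set \<Rightarrow> 'k::field"
  assumes J: "finite J"
  defines "c \<equiv> \<lambda>f. if Inr f \<in> J then a (Inr f) else 0"
  shows "Poly_Mapping.lookup (\<Sum>j\<in>J. scale (a j) (basis_value j e)) s =
    (if Inl (e, s) \<in> J then a (Inl (e, s)) else 0) + (if s = arrow G e then c (right_face e) - c (left_face e) else 0)"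
proof -
  have "Poly_Mapping.lookup (\<Sum>j\<in>J. scale (a j) (basis_value j e)) s =
    (\<Sum>j\<in>J. a j * Poly_Mapping.lookup (basis_value j e) s)"
    by (simp add: lookup_sum lookup_scale)
  also have "\<dots> = (\<Sum>j\<in>J. (if j = Inl (e, s) then a j else 0) +
     (if s = arrow G e then (if j = Inr (right_face e) then a j else 0) - (if j = Inr (left_face e) then a j else 0) else 0))"
    by (intro sum.cong refl)
      (auto simp: basis_value_def face_sign_def lookup_single when_def split: sum.splits prod.splits)
  also have "\<dots> = (\<Sum>j\<in>J. if j = Inl (e, s) then a j else 0) + (if s = arrow G e then
     (\<Sum>j\<in>J. if j = Inr (right_face e) then a j else 0) - (\<Sum>j\<in>J. if j = Inr (left_face e) then a j else 0) else 0)"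
    by (simp add: sum.distrib sum_subtractf)
  finally show ?thesis using J by (simp add: c_def)
qed

lemma basis_derivation_combination:
  fixes a :: "'e \<times> ('v, 'e) qpath + complex set \<Rightarrow> 'k::field"
  assumes "finite J" "J \<subseteq> indices"
  shows "(\<Oplus>\<^bsub>Der class_ring (path_algebra G)\<^esub>j\<in>J. a j \<odot>\<^bsub>Der class_ring (path_algebra G)\<^esub> basis_derivation j) =
    (\<lambda>b\<in>elements. \<Sum>j\<in>J. scale (a j) (basis_derivation j b))"
proof -
  have "(\<lambda>b\<in>elements. scale (a j) (basis_derivation j b)) \<in> Ders" if "j \<in> J" for j
    using that assms by (intro Der_scale_closed basis_derivation_props(1)) auto
  then show ?thesis
    using assms(1) by (simp add: Der_finsum) (auto intro!: restrict_ext)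
qed

text \<open>All summands kill the vertices, so an inner combination comes from a diagonal element
  and changes only the coefficient of each arrow in its own image. Other coefficients vanish at
  once; the face part is a coboundary.\<close>

lemma basis_derivation_independent:
  fixes a :: "'e \<times> ('v, 'e) qpath + complex set \<Rightarrow> 'k::field_char_0"
  assumes acyc: "acyclic_quiver G" and J: "finite J" "J \<subseteq> indices"
    and S: "(\<Oplus>\<^bsub>Der class_ring (path_algebra G)\<^esub>j\<in>J. a j \<odot>\<^bsub>Der class_ring (path_algebra G)\<^esub> basis_derivation j)
      \<in> InDer (path_algebra G)"
    and i: "i \<in> J"
  shows "a i = 0"
proof -
  obtain x where x: "x \<in> elements" "(\<lambda>b\<in>elements. \<Sum>j\<in>J. scale (a j) (basis_derivation j b)) = inner x"
    using S unfolding InDer_eq basis_derivation_combination[OF J] by blast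
  have ev: "inner x b = (\<Sum>j\<in>J. scale (a j) (basis_derivation j b))" if "b \<in> elements" for b
    using fun_cong[OF x(2), of b] that by simp
  have "inner x (idem v) = 0" if v: "v \<in> verts G" for v
  proof -
    have "inner x (idem v) = (\<Sum>j\<in>J. scale (a j) (basis_derivation j (idem v)))"
      using trivial_qpath[OF v] by (intro ev) simp
    also have "\<dots> = 0"
      by (intro sum.neutral ballI) (simp add: basis_derivation_props(2)[OF subsetD[OF J(2)] v] scale_zero)
    finally show ?thesis .
  qed
  note zero_idem = this
  define \<phi> where "\<phi> = (\<lambda>v. Poly_Mapping.lookup x (v, []))"
  have xd: "x = diagonal \<phi>"
    unfolding \<phi>_def by (rule central_on_idems_diagonal[OF acyc x(1) zero_idem])
  define c where "c f = (if Inr f \<in> J then a (Inr f) else 0)" for f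
  have key: "Poly_Mapping.lookup (Poly_Mapping.single (arrow G e) (\<phi> (tail G e) - \<phi> (head G e))) s =
    (if Inl (e, s) \<in> J then a (Inl (e, s)) else 0) + (if s = arrow G e then c (right_face e) - c (left_face e) else 0)"
    if e: "e \<in> arcs G" for e s
  proof -
    have "Poly_Mapping.single (arrow G e) (\<phi> (tail G e) - \<phi> (head G e)) = inner x (arr e)"
      unfolding inner_diagonal(2)[OF e, symmetric] xd[symmetric] ..
    also have "\<dots> = (\<Sum>j\<in>J. scale (a j) (basis_derivation j (arr e)))"
      using arrow_qpath[OF e] by (intro ev) simp
    also have "\<dots> = (\<Sum>j\<in>J. scale (a j) (basis_value j e))"
      by (intro sum.cong refl) (simp add: basis_derivation_props(3)[OF subsetD[OF J(2)] e])
    finally show ?thesis using lookup_sum_basis_value[OF J(1), of a e s] by (simp add: c_def)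
  qed
  have c0: "c f = 0" if f: "f \<in> components (- K)" for f
  proof (rule face_boundary_independent[OF _ _ f, where \<phi> = \<phi>])
    show "c f = 0" if "\<not> bounded f" for f
      using that J(2) by (auto simp: c_def bounded_faces_def)
    show "c (right_face e) - c (left_face e) = \<phi> (tail G e) - \<phi> (head G e)" if e: "e \<in> arcs G" for e
    proof -
      \<comment> \<open>The arrow itself is excluded from the almost oriented cycles, so this
        coefficient compares faces with the coboundary alone.\<close>
      have "Inl (e, arrow G e) \<notin> J" using J(2) by (auto simp: almost_oriented_cycles_def)
      then show ?thesis using key[OF e, of "arrow G e"] by simp
    qed
  qed
  show "a i = 0"
  proof (cases i)
    case (Inl q)
    obtain e s where q: "q = (e, s)" by (cases q)
    then have "e \<in> arcs G" "s \<noteq> arrow G e" using J(2) i Inl by (auto simp: almost_oriented_cycles_def)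
    then show ?thesis using key[of e s] i Inl q by (simp add: lookup_single when_def)
  next
    case (Inr f)
    then have "f \<in> components (- K)" using J(2) i by (auto simp: bounded_faces_def)
    then show ?thesis using c0[of f] i Inr by (simp add: c_def)
  qed
qed

lemma basis_derivation_spanning:
  fixes D :: "(('v, 'e) qpath \<Rightarrow>\<^sub>0 'k::field_char_0) \<Rightarrow> (('v, 'e) qpath \<Rightarrow>\<^sub>0 'k)"
  assumes D: "D \<in> Ders"
  shows "\<exists>J a. finite J \<and> J \<subseteq> indices \<and> D \<ominus>\<^bsub>Der class_ring (path_algebra G)\<^esub>
    (\<Oplus>\<^bsub>Der class_ring (path_algebra G)\<^esub>j\<in>J. a j \<odot>\<^bsub>Der class_ring (path_algebra G)\<^esub> basis_derivation j)
      \<in> InDer (path_algebra G)"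
proof -
  interpret M: module "class_ring :: 'k ring" "Der class_ring (path_algebra G :: ('k, ('v, 'e) qpath \<Rightarrow>\<^sub>0 'k) module)"
    by (rule Der_module)
  have idem: "(idem v :: ('v, 'e) qpath \<Rightarrow>\<^sub>0 'k) \<in> elements" if "v \<in> verts G" for v using trivial_qpath[OF that] by simp
  have arr: "(arr e :: ('v, 'e) qpath \<Rightarrow>\<^sub>0 'k) \<in> elements" if "e \<in> arcs G" for e using arrow_qpath[OF that] by simp
  obtain x where x: "x \<in> elements" "\<And>v. v \<in> verts G \<Longrightarrow> D (idem v) = inner x (idem v)"
    using derivation_inner_on_idems[OF D] by blast
  \<comment> \<open>Removing \<open>inner x\<close> makes the derivation vanish on vertices, so that
    its arrow values are parallel.\<close>
  define D1 where "D1 = (\<lambda>b\<in>elements. D b - inner x b)"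
  have D1: "D1 \<in> Ders"
    using M.M.minus_closed[of D "inner x"] D inner_derivation[OF x(1)]
    by (simp add: Der_minus D1_def)
  define w where "w e = D1 (arr e)" for e
  have w: "parallel_family w"
    unfolding w_def using derivation_arrow_parallel[OF D1] x(2) idem by (simp add: D1_def)
  obtain \<phi> c where c0: "\<forall>f\<in>components (- K). \<not> bounded f \<longrightarrow> c f = (0::'k)"
    "\<forall>e\<in>arcs G. Poly_Mapping.lookup (w e) (arrow G e) =
       \<phi> (tail G e) - \<phi> (head G e) + (c (right_face e) - c (left_face e))"
    using face_boundary_spanning[of "\<lambda>e. Poly_Mapping.lookup (w e) (arrow G e)"] by (elim exE conjE)
  note c = c0[rule_format]
  define P where "P = (SIGMA e:arcs G. Poly_Mapping.keys (w e) - {arrow G e})"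
  define F where "F = {f \<in> right_face ` arcs G \<union> left_face ` arcs G. bounded f}"
  define J where "J = Sum_Type.Plus P F"
  define a where "a = case_sum (\<lambda>(e, s). Poly_Mapping.lookup (w e) s) c"
  have finJ: "finite J" by (auto simp: J_def P_def F_def intro!: finite_Plus finite_SigmaI)
  have J: "J \<subseteq> indices"
    using w faces_of_edge
    by (auto simp: J_def P_def F_def almost_oriented_cycles_def bounded_faces_def parallel_family_def)
  have cJ: "(if Inr f \<in> J then a (Inr f) else 0) = c f" if "e \<in> arcs G" "f = right_face e \<or> f = left_face e" for e f
    using that c(1) faces_of_edge[OF that(1)] by (auto simp: J_def F_def a_def)
  let ?S = "\<lambda>b\<in>elements. \<Sum>j\<in>J. scale (a j) (basis_derivation j b)"
  have S: "(\<Oplus>\<^bsub>Der class_ring (path_algebra G)\<^esub>j\<in>J. a j \<odot>\<^bsub>Der class_ring (path_algebra G)\<^esub> basis_derivation j) = ?S"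
    by (rule basis_derivation_combination[OF finJ J])
  have "(\<Oplus>\<^bsub>Der class_ring (path_algebra G)\<^esub>j\<in>J. a j \<odot>\<^bsub>Der class_ring (path_algebra G)\<^esub> basis_derivation j)
      \<in> carrier (Der class_ring (path_algebra G))"
    by (intro M.M.finsum_closed Pi_I M.smult_closed)
      (simp_all add: basis_derivation_props(1)[OF subsetD[OF J]])
  then have SD: "?S \<in> Ders" unfolding S by simp
  \<comment> \<open>\<open>x\<close> accounts for the values on vertices and
    \<open>diagonal \<phi>\<close> for the coboundary part of the arrow coefficients; vertices and
    arrows determine the rest.\<close>
  have "(\<lambda>b\<in>elements. D b - ?S b) = inner (x + diagonal \<phi>)"
  proof (rule derivation_eqI)
    show "(\<lambda>b\<in>elements. D b - ?S b) \<in> Ders"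
      using M.M.minus_closed[of D ?S] D SD Der_minus[OF D SD] by simp
    show "inner (x + diagonal \<phi>) \<in> Ders"
      by (rule inner_derivation[OF add_closed[OF x(1) diagonal_closed]])
    have inner_add: "inner (x + diagonal \<phi>) b = inner x b + inner (diagonal \<phi>) b" if "b \<in> elements" for b
      using that by (simp add: inner_def path_mult_add_left path_mult_add_right)
    show "(\<lambda>b\<in>elements. D b - ?S b) (idem v) = inner (x + diagonal \<phi>) (idem v)" if v: "v \<in> verts G" for v
    proof -
      have "(\<Sum>j\<in>J. scale (a j) (basis_derivation j (idem v))) = 0"
        by (intro sum.neutral ballI) (simp add: basis_derivation_props(2)[OF subsetD[OF J] v] scale_zero)
      then show ?thesis using idem[OF v] x(2)[OF v] inner_diagonal(1)[OF v, of \<phi>] by (simp add: inner_add)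
    qed
    show "(\<lambda>b\<in>elements. D b - ?S b) (arr e) = inner (x + diagonal \<phi>) (arr e)" if e: "e \<in> arcs G" for e
    proof -
      have "(\<Sum>j\<in>J. scale (a j) (basis_derivation j (arr e))) = (\<Sum>j\<in>J. scale (a j) (basis_value j e))"
        by (intro sum.cong refl) (simp add: basis_derivation_props(3)[OF subsetD[OF J] e])
      moreover have "w e = (\<Sum>j\<in>J. scale (a j) (basis_value j e)) + Poly_Mapping.single (arrow G e) (\<phi> (tail G e) - \<phi> (head G e))"
      proof (rule poly_mapping_eqI)
        fix s
        have "Inl (e, s) \<in> J \<longleftrightarrow> s \<noteq> arrow G e \<and> Poly_Mapping.lookup (w e) s \<noteq> 0"
          using e by (auto simp: J_def P_def in_keys_iff)
        then have "(if Inl (e, s) \<in> J then a (Inl (e, s)) else 0) =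
            (if s = arrow G e then 0 else Poly_Mapping.lookup (w e) s)"
          by (simp add: a_def)
        then show "Poly_Mapping.lookup (w e) s = Poly_Mapping.lookup ((\<Sum>j\<in>J. scale (a j) (basis_value j e)) +
            Poly_Mapping.single (arrow G e) (\<phi> (tail G e) - \<phi> (head G e))) s"
          unfolding lookup_add lookup_sum_basis_value[OF finJ]
            cJ[OF e disjI1[OF refl]] cJ[OF e disjI2[OF refl]]
          using c(2)[OF e] by (cases "s = arrow G e") (simp_all add: lookup_single when_def)
      qed
      moreover have "w e = D (arr e) - inner x (arr e)" using arr[OF e] by (simp add: w_def D1_def)
      ultimately show ?thesis
        using arr[OF e] by (simp add: inner_add inner_diagonal(2)[OF e] algebra_simps)
    qed
  qed
  then have "D \<ominus>\<^bsub>Der class_ring (path_algebra G)\<^esub> ?S \<in> InDer (path_algebra G)"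
    unfolding Der_minus[OF D SD] InDer_eq using add_closed[OF x(1) diagonal_closed] by blast
  then show ?thesis using finJ J S by (intro exI[of _ J] exI[of _ a]) simp
qed

lemma HH1_basis:
  assumes "acyclic_quiver G"
  shows "basis_family class_ring
    (HH1 class_ring (path_algebra G :: ('k::field_char_0, ('v, 'e) qpath \<Rightarrow>\<^sub>0 'k) module)) indices
    (\<lambda>j. HH1_class class_ring (path_algebra G) (basis_derivation j))"
  unfolding HH1_def HH1_class_def
proof (rule basis_family_quotient)
  let ?M = "Der class_ring (path_algebra G :: ('k, ('v, 'e) qpath \<Rightarrow>\<^sub>0 'k) module)"
  show "field (class_ring :: 'k ring)" by (rule class_field)
  show "module class_ring ?M" by (rule Der_module)
  show "submodule class_ring (InDer (path_algebra G)) ?M" by (rule InDer_submodule)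
  show "basis_derivation j \<in> carrier ?M" if "j \<in> indices" for j
    using basis_derivation_props(1)[OF that] by simp
  show "a j = \<zero>\<^bsub>class_ring\<^esub>"
    if "finite J" "J \<subseteq> indices" "(\<Oplus>\<^bsub>?M\<^esub>j\<in>J. a j \<odot>\<^bsub>?M\<^esub> basis_derivation j) \<in> InDer (path_algebra G)" "j \<in> J"
    for J a j
    using basis_derivation_independent[OF assms that] by simp
  show "\<exists>J a. finite J \<and> J \<subseteq> indices \<and> a \<in> J \<rightarrow> carrier class_ring \<and>
      D \<ominus>\<^bsub>?M\<^esub> (\<Oplus>\<^bsub>?M\<^esub>j\<in>J. a j \<odot>\<^bsub>?M\<^esub> basis_derivation j) \<in> InDer (path_algebra G)"
    if "D \<in> carrier ?M" for D
    using basis_derivation_spanning[of D] that by auto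
qed

end

theorem corollary5p6:
  fixes \<Gamma> :: "('v, 'e) pre_digraph"
    and pos :: "'v \<Rightarrow> complex" and \<gamma> :: "'e \<Rightarrow> real \<Rightarrow> complex"
  assumes "fin_digraph \<Gamma>" and "Digraph_Component.connected \<Gamma>" and "acyclic_quiver \<Gamma>"
    and "plane_embedding \<Gamma> pos \<gamma>"
  shows "basis_family class_ring
    (HH1 class_ring (path_algebra \<Gamma> :: ('k::field_char_0, ('v, 'e) qpath \<Rightarrow>\<^sub>0 'k) module))
    (almost_oriented_cycles \<Gamma> <+> bounded_faces \<Gamma> pos \<gamma>)
    (case_sum
      (\<lambda>(p, r). HH1_class class_ring (path_algebra \<Gamma>) (path_derivation \<Gamma> p r))
      (\<lambda>f. HH1_class class_ring (path_algebra \<Gamma>) (face_derivation \<Gamma> \<gamma> f)))"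
proof -
  interpret fin_digraph \<Gamma> by fact
  interpret plane_quiver \<Gamma> pos \<gamma>
  proof
    fix e assume e: "e \<in> arcs \<Gamma>"
    show "tail \<Gamma> e \<noteq> head \<Gamma> e"
    proof
      assume "tail \<Gamma> e = head \<Gamma> e"
      \<comment> \<open>A loop would itself be an oriented cycle of length 1.\<close>
      then have "cycle [e]" using e by (auto simp: cycle_def awalk_simps)
      then show False using assms(3) by (auto simp: acyclic_quiver_def)
    qed
  qed fact
  have "(\<lambda>j. HH1_class class_ring (path_algebra \<Gamma>) (basis_derivation j)) = case_sum
      (\<lambda>(p, r). HH1_class class_ring (path_algebra \<Gamma>) (path_derivation \<Gamma> p r))
      (\<lambda>f. HH1_class class_ring (path_algebra \<Gamma> :: ('k, ('v, 'e) qpath \<Rightarrow>\<^sub>0 'k) module) (face_derivation \<Gamma> \<gamma> f))"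
    by (auto simp: basis_derivation_def fun_eq_iff split: sum.splits)
  then show ?thesis using HH1_basis[OF assms(3), where 'k = 'k] by (simp only:)
qed

end
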